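(* Let $n=4$ and $\lambda=0$. There exists an open interval $I$ containing $0$ such that for each $\gamma\in I$ there is a pair $(\alpha,\beta)\in\mathbb{R}^2$ with: (1) $\alpha^2+\beta^2+\gamma^2=1$; (2) the solution $(\mathcal{L},X_1,X_2,X_3,Y_1,Y_2,Y_3)$ of the system $(F)$ starting at $\phi(\alpha,\beta,\gamma)$ exists for all $s>0$ and is convergent as $s\to\infty$; (3) $\lim_{s\to\infty}(\mathcal{L},X_1,X_2,X_3,Y_1,Y_2,Y_3)=(l,0,0,0,a,b,c)$ with $l>0$, and either $a=b$, $c=0$ or $a=c$, $b=0$.
   Context: The steady soliton system for $(\xi,L_1,L_2,L_3,R_1,R_2,R_3)$ in $r$ is $\xi'=-L_1^2-L_2^2-L_3^2$, $L_i'=-\xi L_i+\frac{R_i^2}{2}-\frac{(R_j-R_k)^2}{2}$, $R_i'=R_i(L_i-L_j-L_k)$, $\{i,j,k\}=\{1,2,3\}$ (it encodes $\mathrm{Ric}+\mathrm{Hess}(u)=0$ for $dr^2+\sum f_i^2\omega_i^2$ on $SU(2)/\mathbb{Z}_4$-principal orbits of $M=SU(2)\times_{U(1)}\mathbb{R}^2$, via $L_i=f_i'/f_i$, $R_i=f_i/(f_jf_k)$, $\xi=\sum f_i'/f_i-u'$). Standing fact: there are $T>0$ and a continuous $\phi:\mathbb{S}^2\to(1,\infty)\times\mathbb{R}^6$ such that for each $(\alpha,\beta,\gamma)\in\mathbb{S}^2$, $\phi(\alpha,\beta,\gamma)$ is the value at $r=T$ of the (unique) solution on $(0,T]$ of the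 form $\xi=\frac1r+\eta_0$, $L_1=\frac1r+\eta_1$, $L_2=\gamma+\eta_2$, $L_3=-\gamma+\eta_3$, $R_1=\eta_4$, $R_2=\frac{1}{2r}+\gamma+\eta_5$, $R_3=\frac{1}{2r}-\gamma+\eta_6$ with $\eta_m$ smooth on $[0,T]$, $\eta_m(0)=0$, and with $\alpha=\lim_{r\to0}\frac{\xi-L_1-L_2-L_3}{r}$, $\beta=\lim_{r\to0}\frac{R_1}{r}$, $\gamma=\lim_{r\to0}\frac{L_2-L_3}{2}$. Change of variables: $\mathcal{L}=1/\xi$, $X_i=\mathcal{L}L_i$, $Y_i=\mathcal{L}R_i$, $dr/ds=\mathcal{L}(r(s))$, $r(0)=T$, giving system $(F)$: $\frac{d\mathcal{L}}{ds}=\mathcal{L}(X_1^2+X_2^2+X_3^2)$, $\frac{dX_i}{ds}=\frac{Y_i^2}{2}-\frac{(Y_j-Y_k)^2}{2}-X_i+X_i(X_1^2+X_2^2+X_3^2)$, $\frac{dY_i}{ds}=Y_i(X_i-X_j-X_k+X_1^2+X_2^2+X_3^2)$. "The solution of $(F)$ starting at $\phi(\alpha,\beta,\gamma)$" is the maximal solution of $(F)$ with initial data at $s=0$ obtained from $\phi(\alpha,\beta,\gamma)$ by this change of variables. *)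

theory Defs
  imports "HOL-Analysis.Analysis"
begin

type_synonym state7 = "real \<times> real \<times> real \<times> real \<times> real \<times> real \<times> real"

definition soliton_rhs :: "state7 \<Rightarrow> state7" where
  "soliton_rhs = (\<lambda>(xi, L1, L2, L3, R1, R2, R3).
     ( - (L1^2 + L2^2 + L3^2),
       - xi * L1 + R1^2 / 2 - (R2 - R3)^2 / 2,
       - xi * L2 + R2^2 / 2 - (R3 - R1)^2 / 2,
       - xi * L3 + R3^2 / 2 - (R1 - R2)^2 / 2,
       R1 * (L1 - L2 - L3),
       R2 * (L2 - L3 - L1),
       R3 * (L3 - L1 - L2)))"

definition F_rhs :: "state7 \<Rightarrow> state7" where
  "F_rhs = (\<lambda>(Lc, X1, X2, X3, Y1, Y2, Y3).
     (let Q = X1^2 + X2^2 + X3^2 in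
     ( Lc * Q,
       Y1^2 / 2 - (Y2 - Y3)^2 / 2 - X1 + X1 * Q,
       Y2^2 / 2 - (Y3 - Y1)^2 / 2 - X2 + X2 * Q,
       Y3^2 / 2 - (Y1 - Y2)^2 / 2 - X3 + X3 * Q,
       Y1 * (X1 - X2 - X3 + Q),
       Y2 * (X2 - X3 - X1 + Q),
       Y3 * (X3 - X1 - X2 + Q))))"

definition change_vars :: "state7 \<Rightarrow> state7" where
  "change_vars = (\<lambda>(xi, L1, L2, L3, R1, R2, R3).
     (1 / xi, L1 / xi, L2 / xi, L3 / xi, R1 / xi, R2 / xi, R3 / xi))"

definition sing_part :: "real \<Rightarrow> real \<Rightarrow> state7" where
  "sing_part \<gamma> r = (1 / r, 1 / r, \<gamma>, - \<gamma>, 0, 1 / (2 * r) + \<gamma>, 1 / (2 * r) - \<gamma>)"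

definition C_inf_on :: "(real \<Rightarrow> 'a::real_normed_vector) \<Rightarrow> real set \<Rightarrow> bool" where
  "C_inf_on f S \<longleftrightarrow> (\<exists>D :: nat \<Rightarrow> real \<Rightarrow> 'a. D 0 = f \<and>
      (\<forall>k. \<forall>x\<in>S. (D k has_vector_derivative D (Suc k) x) (at x within S)))"

definition sphere2 :: "(real \<times> real \<times> real) set" where
  "sphere2 = {(a, b, c). a^2 + b^2 + c^2 = 1}"

definition phi_solution :: "real \<Rightarrow> real \<Rightarrow> real \<Rightarrow> real \<Rightarrow> (real \<Rightarrow> state7) \<Rightarrow> bool" where
  "phi_solution T \<alpha> \<beta> \<gamma> w \<longleftrightarrow>
     (\<forall>r\<in>{0<..T}. (w has_vector_derivative soliton_rhs (w r)) (at r within {0<..T})) \<and>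
     (\<exists>\<eta> :: real \<Rightarrow> state7. C_inf_on \<eta> {0..T} \<and> \<eta> 0 = 0 \<and>
        (\<forall>r\<in>{0<..T}. w r = sing_part \<gamma> r + \<eta> r)) \<and>
     ((\<lambda>r. case w r of (xi, L1, L2, L3, R1, R2, R3) \<Rightarrow> (xi - L1 - L2 - L3) / r)
        \<longlongrightarrow> \<alpha>) (at_right 0) \<and>
     ((\<lambda>r. case w r of (xi, L1, L2, L3, R1, R2, R3) \<Rightarrow> R1 / r) \<longlongrightarrow> \<beta>) (at_right 0) \<and>
     ((\<lambda>r. case w r of (xi, L1, L2, L3, R1, R2, R3) \<Rightarrow> (L2 - L3) / 2) \<longlongrightarrow> \<gamma>) (at_right 0)"

definition standing_phi :: "real \<Rightarrow> (real \<times> real \<times> real \<Rightarrow> state7) \<Rightarrow> bool" where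
  "standing_phi T \<phi> \<longleftrightarrow> T > 0 \<and> continuous_on sphere2 \<phi> \<and>
     (\<forall>p\<in>sphere2. fst (\<phi> p) > 1) \<and>
     (\<forall>\<alpha> \<beta> \<gamma>. (\<alpha>, \<beta>, \<gamma>) \<in> sphere2 \<longrightarrow>
        (\<exists>w. phi_solution T \<alpha> \<beta> \<gamma> w) \<and>
        (\<forall>w. phi_solution T \<alpha> \<beta> \<gamma> w \<longrightarrow> w T = \<phi> (\<alpha>, \<beta>, \<gamma>)))"

end

theory Submission
  imports Defs "HOL-Real_Asymp.Real_Asymp"
begin

text \<open>
  It suffices to treat \<open>\<gamma> \<ge> 0\<close>, since exchanging the indices 2 and 3 maps \<open>\<gamma>\<close> to \<open>- \<gamma>\<close>.
  All solutions start with \<open>R1 < R2\<close> and \<open>L2 < L1\<close>. For every pair of indices,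
  \<open>(Li - Lj)' = - \<xi> (Li - Lj) + (Ri + Rj - Rk) (Ri - Rj)\<close> and
  \<open>(Ri - Rj)' = (Ri + Rj) (Li - Lj) - Lk (Ri - Rj)\<close>, which is a cooperative linear system as long as
  \<open>Rk \<le> Ri + Rj\<close>. Hence a solution that leaves this region does so for good, either by collapsing
  (\<open>L1 < L2\<close>) or by exploding (\<open>R2 < R1\<close>); the two cases exclude each other, and each of them is open
  in the parameters. For \<open>\<gamma> = 0\<close> the solution collapses if \<open>\<beta> > 0\<close> is small and explodes in the
  Ricci-flat case \<open>\<alpha> = 0\<close>, and by openness this persists for small \<open>\<gamma>\<close>. By connectedness of an arc
  of parameters some solution with \<open>\<alpha> > 0\<close> does neither. Such a solution exists forever and
  converges: \<open>\<xi>\<close> decreases to a positive limit because of the first integral, \<open>- L3\<close> is bounded by a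
  decaying exponential, so \<open>R1 R2\<close> is monotone up to a convergent factor, and \<open>R1 / R2\<close> and \<open>R3 / R2\<close>
  are monotone. As \<open>R1 / R2\<close> increases, the limit cannot lie on the branch \<open>a = 0\<close>, \<open>b = c\<close> of
  equilibria.
\<close>

section \<open>Differential inequalities and limits\<close>

text \<open>Two obstacles shape the argument. The sign of a difference is propagated only while a
  triangle inequality between the \<open>Ri\<close> holds, and that inequality is known only as long
  as other differences keep their sign. What breaks the circle is that at the moment of leaving the
  region one index dominates both others in \<open>Li\<close> and \<open>Ri\<close>; the triangle
  inequalities needed to compare it with the others are then strict, so dominance sustains itself.
  Secondly, \<open>\<phi>\<close> is known only through its continuity and the expansion at r = 0,
  so every inequality at \<open>T\<close> is carried from r = 0 by linear equations whose damping
  behaves like 1 / r. Collapse and explosion at the ends of the arc are proved indirectly: inside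
  the region all components stay bounded on bounded time intervals, so a solution that never leaves
  would live forever, while an explicit estimate bounds the time it can spend there. The small
  parameter behind the collapse is R1 / R2 at \<open>T\<close>: for \<beta> = 0 the function R1
  vanishes identically, and continuity of \<open>\<phi>\<close> does the rest.\<close>

lemma nondecreasing_within:
  fixes f :: "real \<Rightarrow> real"
  assumes der: "\<And>t. t \<in> {a..b} \<Longrightarrow> (f has_real_derivative f' t) (at t within {a..b})"
    and nonneg: "\<And>t. t \<in> {a..b} \<Longrightarrow> 0 \<le> f' t"
    and st: "a \<le> s" "s \<le> t" "t \<le> b"
  shows "f s \<le> f t"
proof (rule DERIV_nonneg_imp_increasing_open[OF st(2)])
  fix u assume u: "s < u" "u < t"
  then have "u \<in> {a<..<b}" using st by auto
  then have "(f has_real_derivative f' u) (at u)"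
    using der[of u] at_within_Icc_at[of a u b] by auto
  then show "\<exists>y. (f has_real_derivative y) (at u) \<and> 0 \<le> y"
    using nonneg[of u] u st by auto
next
  have "continuous_on {a..b} f" using der DERIV_continuous_on by blast
  then show "continuous_on {s..t} f" using st by (auto intro: continuous_on_subset)
qed

lemma continuous_on_Icc_bounded:
  fixes f :: "real \<Rightarrow> real"
  assumes "continuous_on {a..b} f"
  obtains K where "0 \<le> K" "\<And>t. t \<in> {a..b} \<Longrightarrow> \<bar>f t\<bar> \<le> K"
proof -
  have "bounded (f ` {a..b})" using assms compact_continuous_image compact_imp_bounded by blast
  then obtain K where "\<forall>t\<in>{a..b}. \<bar>f t\<bar> \<le> K" by (auto simp: bounded_iff)
  then show ?thesis by (intro that[of "max K 0"]) (auto simp: le_max_iff_disj)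
qed

text \<open>No sign of \<open>f\<close> or \<open>K\<close> enters:
  \<open>f t * exp (- K * (t - a))\<close> is nonincreasing. Applied to \<open>- f\<close> with
  \<open>- K\<close> it gives lower bounds and estimates backwards in time.\<close>

lemma gronwall:
  fixes f :: "real \<Rightarrow> real"
  assumes der: "\<And>t. t \<in> {a..b} \<Longrightarrow> (f has_real_derivative f' t) (at t within {a..b})"
    and le: "\<And>t. t \<in> {a..b} \<Longrightarrow> f' t \<le> K * f t"
    and t: "t \<in> {a..b}"
  shows "f t \<le> f a * exp (K * (t - a))"
proof -
  let ?g = "\<lambda>t. - (f t * exp (- K * (t - a)))"
  have "?g a \<le> ?g t"
  proof (rule nondecreasing_within[where f = ?g and f' = "\<lambda>t. (K * f t - f' t) * exp (- K * (t - a))" and a = a and b = b])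
    show "(?g has_real_derivative (K * f u - f' u) * exp (- K * (u - a))) (at u within {a..b})"
      if "u \<in> {a..b}" for u
      by (auto intro!: derivative_eq_intros der[OF that] simp: algebra_simps)
  qed (use t le in auto)
  then have "f t * exp (- K * (t - a)) \<le> f a" by simp
  then have "f t * exp (- K * (t - a)) * exp (K * (t - a)) \<le> f a * exp (K * (t - a))"
    by (rule mult_right_mono) simp
  then show ?thesis by (simp add: mult.assoc flip: exp_add)
qed

text \<open>The two-sided bound on \<open>E'\<close> lets Gronwall run in both time directions, so
  one zero of the energy spreads over the whole interval.\<close>

lemma energy_vanishes:
  fixes E :: "real \<Rightarrow> real"
  assumes der: "\<And>t. t \<in> {a..b} \<Longrightarrow> (E has_real_derivative E' t) (at t within {a..b})"
    and le: "\<And>t. t \<in> {a..b} \<Longrightarrow> \<bar>E' t\<bar> \<le> K * E t"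
    and pos: "\<And>t. t \<in> {a..b} \<Longrightarrow> 0 \<le> E t"
    and z: "c \<in> {a..b}" "E c = 0" and t: "t \<in> {a..b}"
  shows "E t = 0"
proof (cases "c \<le> t")
  case True
  have "E t \<le> E c * exp (K * (t - c))"
  proof (rule gronwall[where a = c and b = t and f' = E'])
    show "(E has_real_derivative E' u) (at u within {c..t})" if "u \<in> {c..t}" for u
      by (rule has_field_derivative_subset[OF der]) (use that z t in auto)
    show "E' u \<le> K * E u" if "u \<in> {c..t}" for u
      using le[of u] that z t by auto
  qed (use True in auto)
  then show ?thesis using z pos[OF t] by simp
next
  case False
  have "- E c \<le> - E t * exp ((- K) * (c - t))"
  proof (rule gronwall[where f = "\<lambda>u. - E u" and a = t and b = c and f' = "\<lambda>u. - E' u"])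
    show "((\<lambda>u. - E u) has_real_derivative - E' u) (at u within {t..c})" if "u \<in> {t..c}" for u
      by (rule DERIV_minus, rule has_field_derivative_subset[OF der]) (use that z t in auto)
    show "- E' u \<le> - K * - E u" if "u \<in> {t..c}" for u
      using le[of u] that z t by auto
  qed (use False in auto)
  then have "E t * exp ((- K) * (c - t)) \<le> 0" using z by simp
  then have "E t \<le> 0" by (simp add: mult_le_0_iff)
  then show ?thesis using pos[OF t] by simp
qed

text \<open>The squared negative part is differentiable even at 0, where the difference quotient is
  at most \<open>\<bar>h\<bar>\<close>; this makes it usable as an energy for weak
  inequalities.\<close>

lemma min_zero_square_has_derivative:
  "((\<lambda>x. (min x 0)\<^sup>2) has_real_derivative 2 * min x 0) (at (x::real))"
proof (cases x "0::real" rule: linorder_cases)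
  case less
  have "((\<lambda>x. x\<^sup>2) has_real_derivative 2 * min x 0) (at x)"
    using less by (auto intro!: derivative_eq_intros)
  then show ?thesis
    by (rule has_field_derivative_transform_within_open[where S = "{..<0}"]) (use less in auto)
next
  case greater
  have "((\<lambda>x. 0) has_real_derivative 2 * min x 0) (at x)"
    using greater by (auto intro!: derivative_eq_intros)
  then show ?thesis
    by (rule has_field_derivative_transform_within_open[where S = "{0<..}"]) (use greater in auto)
next
  case equal
  have "((\<lambda>h. (min h 0)\<^sup>2 / h) \<longlongrightarrow> 0) (at (0::real))"
  proof (rule Lim_null_comparison)
    show "\<forall>\<^sub>F h in at (0::real). norm ((min h 0)\<^sup>2 / h) \<le> \<bar>h\<bar>"
      by (auto simp: eventually_at_filter min_def power2_eq_square)
    show "((\<lambda>h. \<bar>h\<bar>) \<longlongrightarrow> 0) (at (0::real))"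
      using tendsto_rabs[OF tendsto_ident_at[of "0::real" UNIV]] by simp
  qed
  then show ?thesis using equal by (simp add: DERIV_def)
qed

text \<open>The squared negative parts satisfy a Gronwall inequality, so no strictness is needed.\<close>
lemma cooperative_nonneg:
  fixes u y :: "real \<Rightarrow> real"
  assumes du: "\<And>t. t \<in> {a..b} \<Longrightarrow> (u has_real_derivative u' t) (at t within {a..b})"
    and dy: "\<And>t. t \<in> {a..b} \<Longrightarrow> (y has_real_derivative y' t) (at t within {a..b})"
    and u': "\<And>t. t \<in> {a..b} \<Longrightarrow> p t * u t + m t * y t \<le> u' t"
    and y': "\<And>t. t \<in> {a..b} \<Longrightarrow> n t * u t + q t * y t \<le> y' t"
    and cont: "continuous_on {a..b} p" "continuous_on {a..b} q" "continuous_on {a..b} m"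
      "continuous_on {a..b} n"
    and mn: "\<And>t. t \<in> {a..b} \<Longrightarrow> 0 \<le> m t" "\<And>t. t \<in> {a..b} \<Longrightarrow> 0 \<le> n t"
    and init: "0 \<le> u a" "0 \<le> y a" and t: "t \<in> {a..b}"
  shows "0 \<le> u t \<and> 0 \<le> y t"
proof -
  obtain K1 where K1: "\<And>t. t \<in> {a..b} \<Longrightarrow> \<bar>p t\<bar> \<le> K1"
    by (rule continuous_on_Icc_bounded[OF cont(1)]) blast
  obtain K2 where K2: "\<And>t. t \<in> {a..b} \<Longrightarrow> \<bar>q t\<bar> \<le> K2"
    by (rule continuous_on_Icc_bounded[OF cont(2)]) blast
  obtain K3 where K3: "\<And>t. t \<in> {a..b} \<Longrightarrow> \<bar>m t\<bar> \<le> K3"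
    by (rule continuous_on_Icc_bounded[OF cont(3)]) blast
  obtain K4 where K4: "\<And>t. t \<in> {a..b} \<Longrightarrow> \<bar>n t\<bar> \<le> K4"
    by (rule continuous_on_Icc_bounded[OF cont(4)]) blast
  define K where "K = max (max K1 K2) (max K3 K4)"
  have K: "\<bar>p t\<bar> \<le> K" "\<bar>q t\<bar> \<le> K" "\<bar>m t\<bar> \<le> K" "\<bar>n t\<bar> \<le> K" if "t \<in> {a..b}" for t
    using K1[OF that] K2[OF that] K3[OF that] K4[OF that] unfolding K_def
    by (simp_all add: le_max_iff_disj)
  define E where "E t = (min (u t) 0)\<^sup>2 + (min (y t) 0)\<^sup>2" for t
  have dE: "(E has_real_derivative 2 * min (u t) 0 * u' t + 2 * min (y t) 0 * y' t) (at t within {a..b})"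
    if "t \<in> {a..b}" for t
    unfolding E_def
    by (intro DERIV_add DERIV_chain2[OF min_zero_square_has_derivative] du dy that)
  have E': "2 * min (u t) 0 * u' t + 2 * min (y t) 0 * y' t \<le> (4 * K) * E t" if "t \<in> {a..b}" for t
  proof -
    let ?U = "min (u t) 0" and ?Y = "min (y t) 0"
    have K0: "0 \<le> K" using K(1)[OF that] by linarith
    have "?U * u' t \<le> ?U * (p t * u t + m t * y t)"
      by (rule mult_left_mono_neg[OF u'[OF that]]) simp
    \<comment> \<open>Cooperativity enters here: \<open>?U \<le> 0\<close> and
      \<open>?Y \<le> y t\<close>, so a nonnegative coupling \<open>m t\<close> allows
      \<open>y t\<close> to be replaced by its negative part.\<close>
    also have "\<dots> \<le> p t * ?U\<^sup>2 + m t * (?U * ?Y)"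
    proof -
      have "?U * u t = ?U\<^sup>2" by (auto simp: min_def power2_eq_square)
      moreover have "?U * y t \<le> ?U * ?Y" by (rule mult_left_mono_neg) auto
      then have "m t * (?U * y t) \<le> m t * (?U * ?Y)" by (rule mult_left_mono) (rule mn that)+
      ultimately show ?thesis by (simp add: algebra_simps)
    qed
    also have "\<dots> \<le> K * ?U\<^sup>2 + K * (?U * ?Y)"
      using K[OF that] by (intro add_mono mult_right_mono) (auto simp: mult_nonpos_nonpos)
    finally have 1: "?U * u' t \<le> K * ?U\<^sup>2 + K * (?U * ?Y)" .
    have "?Y * y' t \<le> ?Y * (n t * u t + q t * y t)"
      by (rule mult_left_mono_neg[OF y'[OF that]]) simp
    also have "\<dots> \<le> n t * (?U * ?Y) + q t * ?Y\<^sup>2"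
    proof -
      have "?Y * y t = ?Y\<^sup>2" by (auto simp: min_def power2_eq_square)
      moreover have "?Y * u t \<le> ?Y * ?U" by (rule mult_left_mono_neg) auto
      then have "n t * (?Y * u t) \<le> n t * (?Y * ?U)" by (rule mult_left_mono) (rule mn that)+
      ultimately show ?thesis by (simp add: algebra_simps)
    qed
    also have "\<dots> \<le> K * (?U * ?Y) + K * ?Y\<^sup>2"
      using K[OF that] by (intro add_mono mult_right_mono) (auto simp: mult_nonpos_nonpos)
    finally have 2: "?Y * y' t \<le> K * (?U * ?Y) + K * ?Y\<^sup>2" .
    \<comment> \<open>Both estimates contain the mixed term \<open>?U * ?Y\<close>; twice it is at
      most the energy, which accounts for the rate \<open>4 * K\<close>.\<close>
    have "0 \<le> (?U - ?Y)\<^sup>2" by simp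
    then have "2 * (?U * ?Y) \<le> ?U\<^sup>2 + ?Y\<^sup>2" by (simp add: power2_diff)
    then have "K * (2 * (?U * ?Y)) \<le> K * (?U\<^sup>2 + ?Y\<^sup>2)" using K0 by (rule mult_left_mono)
    then show ?thesis using 1 2 unfolding E_def by (simp add: algebra_simps)
  qed
  have "E t \<le> E a * exp (4 * K * (t - a))" by (rule gronwall[OF dE E' t])
  moreover have "E a = 0" using init by (simp add: E_def)
  ultimately have "(min (u t) 0)\<^sup>2 + (min (y t) 0)\<^sup>2 \<le> 0" by (simp add: E_def)
  then have "min (u t) 0 = 0" "min (y t) 0 = 0" by (auto simp: sum_power2_le_zero_iff)
  then show ?thesis by (auto simp: min_def split: if_splits)
qed

lemma nonneg_persists:
  fixes h :: "real \<Rightarrow> real"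
  assumes dh: "\<And>t. t \<in> {a..b} \<Longrightarrow> (h has_real_derivative h' t) (at t within {a..b})"
    and h': "\<And>t. t \<in> {a..b} \<Longrightarrow> p t * h t \<le> h' t"
    and cont: "continuous_on {a..b} p"
    and init: "0 \<le> h a" and t: "t \<in> {a..b}"
  shows "0 \<le> h t"
  using cooperative_nonneg[where y = "\<lambda>_. 0" and y' = "\<lambda>_. 0" and m = "\<lambda>_. 0" and n = "\<lambda>_. 0"
      and q = "\<lambda>_. 0" and u = h and u' = h' and p = p, OF dh _ _ _ cont _ _ _ _ _ init _ t] h'
  by simp

text \<open>Once weak positivity is known, \<open>p t * h t \<ge> - K * h t\<close> for a bound
  \<open>K\<close> of \<open>\<bar>p\<bar>\<close>, so \<open>h\<close> decays at most exponentially
  and cannot reach 0.\<close>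

lemma pos_persists:
  fixes h :: "real \<Rightarrow> real"
  assumes dh: "\<And>t. t \<in> {a..b} \<Longrightarrow> (h has_real_derivative h' t) (at t within {a..b})"
    and h': "\<And>t. t \<in> {a..b} \<Longrightarrow> p t * h t \<le> h' t"
    and cont: "continuous_on {a..b} p"
    and init: "0 < h a" and t: "t \<in> {a..b}"
  shows "0 < h t"
proof -
  have nn: "0 \<le> h s" if "s \<in> {a..b}" for s
    by (rule nonneg_persists[OF dh h' cont _ that]) (use init in auto)
  obtain K where K: "\<And>s. s \<in> {a..b} \<Longrightarrow> \<bar>p s\<bar> \<le> K"
    by (rule continuous_on_Icc_bounded[OF cont]) blast
  have "- h t \<le> - h a * exp ((- K) * (t - a))"
  proof (rule gronwall[where f = "\<lambda>s. - h s" and f' = "\<lambda>s. - h' s"])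
    show "- h' s \<le> - K * - h s" if "s \<in> {a..b}" for s
    proof -
      have "- K * h s \<le> p s * h s" using K[OF that] nn[OF that] by (intro mult_right_mono) auto
      then show ?thesis using h'[OF that] by simp
    qed
  qed (use t in \<open>auto intro!: DERIV_minus dh\<close>)
  moreover have "0 < h a * exp ((- K) * (t - a))" using init by simp
  ultimately show ?thesis by linarith
qed

text \<open>\<open>\<tau>\<close> is the supremum of the times up to which \<open>P\<close> holds,
  and closedness from the left puts \<open>\<tau>\<close> itself among them. Failures arbitrarily
  soon after \<open>\<tau>\<close> are what strict inequalities at \<open>\<tau>\<close> later
  contradict.\<close>

lemma first_exit:
  fixes a b :: real
  assumes "a \<le> b" and Pa: "P a"
    and closed: "\<And>t. a < t \<Longrightarrow> t \<le> b \<Longrightarrow> (\<And>s. a \<le> s \<Longrightarrow> s < t \<Longrightarrow> P s) \<Longrightarrow> P t"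
  obtains \<tau> where "a \<le> \<tau>" "\<tau> \<le> b" "\<And>s. a \<le> s \<Longrightarrow> s \<le> \<tau> \<Longrightarrow> P s"
    "\<tau> = b \<or> (\<forall>\<delta>>0. \<exists>s. \<tau> < s \<and> s < \<tau> + \<delta> \<and> s \<le> b \<and> \<not> P s)"
proof -
  define S where "S = {t. a \<le> t \<and> t \<le> b \<and> (\<forall>s. a \<le> s \<and> s \<le> t \<longrightarrow> P s)}"
  define \<tau> where "\<tau> = Sup S"
  have aS: "a \<in> S" unfolding S_def using assms(1) Pa by (auto dest: antisym)
  have bdd: "bdd_above S" unfolding S_def bdd_above_def by auto
  have 1: "a \<le> \<tau>" unfolding \<tau>_def by (rule cSup_upper[OF aS bdd])
  have 2: "\<tau> \<le> b" unfolding \<tau>_def by (rule cSup_least) (use aS in \<open>auto simp: S_def\<close>)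
  have less: "P s" if "a \<le> s" "s < \<tau>" for s
  proof -
    from that(2) obtain t where "t \<in> S" "s < t" unfolding \<tau>_def using less_cSup_iff[OF _ bdd] aS by blast
    then show ?thesis using that by (auto simp: S_def)
  qed
  have 3: "P s" if "a \<le> s" "s \<le> \<tau>" for s
  proof (cases "s < \<tau>")
    case False
    then have "s = \<tau>" using that by simp
    then show ?thesis using closed[of \<tau>] less 1 2 Pa by (cases "a = \<tau>") auto
  qed (use less that in auto)
  have 4: "\<tau> = b \<or> (\<forall>\<delta>>0. \<exists>s. \<tau> < s \<and> s < \<tau> + \<delta> \<and> s \<le> b \<and> \<not> P s)"
  proof (rule ccontr)
    assume "\<not> ?thesis"
    then obtain \<delta> where d: "\<tau> < b" "\<delta> > 0" "\<And>s. \<tau> < s \<Longrightarrow> s < \<tau> + \<delta> \<Longrightarrow> s \<le> b \<Longrightarrow> P s"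
      using 2 by force
    define t where "t = min b (\<tau> + \<delta> / 2)"
    have "t \<in> S" unfolding S_def
    proof (intro CollectI conjI allI impI)
      fix s assume "a \<le> s \<and> s \<le> t"
      then show "P s" using 3[of s] d by (cases "s \<le> \<tau>") (auto simp: t_def)
    qed (use 1 d in \<open>auto simp: t_def\<close>)
    then have "t \<le> \<tau>" unfolding \<tau>_def by (rule cSup_upper[OF _ bdd])
    then show False using d by (auto simp: t_def)
  qed
  show ?thesis by (rule that[OF 1 2 3 4])
qed

lemma real_induction:
  fixes a b :: real
  assumes ab: "a \<le> b" and Pa: "P a"
    and closed: "\<And>t. a < t \<Longrightarrow> t \<le> b \<Longrightarrow> (\<And>s. a \<le> s \<Longrightarrow> s < t \<Longrightarrow> P s) \<Longrightarrow> P t"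
    and step: "\<And>t. a \<le> t \<Longrightarrow> t < b \<Longrightarrow> (\<And>s. a \<le> s \<Longrightarrow> s \<le> t \<Longrightarrow> P s) \<Longrightarrow>
        \<exists>\<delta>>0. \<forall>s. t < s \<and> s < t + \<delta> \<and> s \<le> b \<longrightarrow> P s"
    and t: "a \<le> t" "t \<le> b"
  shows "P t"
proof -
  obtain \<tau> where \<tau>: "a \<le> \<tau>" "\<tau> \<le> b" "\<And>s. a \<le> s \<Longrightarrow> s \<le> \<tau> \<Longrightarrow> P s"
    "\<tau> = b \<or> (\<forall>\<delta>>0. \<exists>s. \<tau> < s \<and> s < \<tau> + \<delta> \<and> s \<le> b \<and> \<not> P s)"
    by (rule first_exit[of a b P, OF ab Pa closed]) blast+
  have "\<tau> = b"
  proof (rule ccontr)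
    assume "\<tau> \<noteq> b"
    then have "\<tau> < b" using \<tau>(2) by simp
    from step[OF \<tau>(1) this \<tau>(3)] obtain \<delta> where "\<delta> > 0" "\<forall>s. \<tau> < s \<and> s < \<tau> + \<delta> \<and> s \<le> b \<longrightarrow> P s" by blast
    then show False using \<tau>(4) \<open>\<tau> \<noteq> b\<close> by blast
  qed
  then show ?thesis using \<tau>(3) t by blast
qed

lemma continuous_on_le_left_limit:
  fixes f g :: "real \<Rightarrow> real"
  assumes "continuous_on {a..b} f" "continuous_on {a..b} g" "a < t" "t \<le> b"
    and le: "\<And>s. a \<le> s \<Longrightarrow> s < t \<Longrightarrow> f s \<le> g s"
  shows "f t \<le> g t"
proof (rule tendsto_le)
  show "(f \<longlongrightarrow> f t) (at t within {a..<t})" "(g \<longlongrightarrow> g t) (at t within {a..<t})"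
    using assms(1-4) unfolding continuous_on_def
    by (intro tendsto_within_subset[of _ _ t "{a..b}" "{a..<t}"]; force)+
  show "\<forall>\<^sub>F x in at t within {a..<t}. f x \<le> g x"
    using le by (auto simp: eventually_at_filter)
  have "t islimpt {a..<t}" using assms(3) by (simp add: islimpt_Ico)
  then show "at t within {a..<t} \<noteq> bot" by (simp add: trivial_limit_within)
qed

lemma continuous_on_less_right:
  fixes f g :: "real \<Rightarrow> real"
  assumes "continuous_on {a..b} f" "continuous_on {a..b} g" "t \<in> {a..b}" "f t < g t"
  shows "\<exists>\<delta>>0. \<forall>s\<in>{a..b}. \<bar>s - t\<bar> < \<delta> \<longrightarrow> f s < g s"
proof -
  have "continuous_on {a..b} (\<lambda>s. g s - f s)" using assms by (intro continuous_intros)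
  then obtain \<delta> where "\<delta> > 0" "\<forall>s\<in>{a..b}. dist s t < \<delta> \<longrightarrow> dist (g s - f s) (g t - f t) < g t - f t"
    unfolding continuous_on_iff using assms(3,4) by (metis diff_gt_0_iff_gt)
  then show ?thesis by (intro exI[of _ \<delta>]) (auto simp: dist_real_def abs_less_iff)
qed

lemma nonincreasing_tendsto_at_top:
  fixes f :: "real \<Rightarrow> real"
  assumes mono: "\<And>s t. a \<le> s \<Longrightarrow> s \<le> t \<Longrightarrow> f t \<le> f s" and bd: "\<And>t. a \<le> t \<Longrightarrow> m \<le> f t"
  obtains l where "(f \<longlongrightarrow> l) at_top" "m \<le> l" "\<And>t. a \<le> t \<Longrightarrow> l \<le> f t"
proof -
  define l where "l = Inf (f ` {a..})"
  have bdd: "bdd_below (f ` {a..})" using bd by (intro bdd_belowI[of _ m]) auto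
  have ub: "l \<le> f t" if "a \<le> t" for t
    unfolding l_def by (rule cInf_lower[OF _ bdd]) (use that in auto)
  have "(f \<longlongrightarrow> l) at_top"
  proof (rule order_tendstoI)
    fix y assume "y < l"
    then show "\<forall>\<^sub>F x in at_top. y < f x" using ub
      by (intro eventually_at_top_linorderI[of a]) force
  next
    fix y assume "l < y"
    then obtain s where s: "a \<le> s" "f s < y" unfolding l_def using cInf_less_iff[OF _ bdd] by auto
    then show "\<forall>\<^sub>F x in at_top. f x < y" using mono[OF s(1)]
      by (intro eventually_at_top_linorderI[of s]) force
  qed
  moreover have "m \<le> l" unfolding l_def by (rule cInf_greatest) (use bd in auto)
  ultimately show ?thesis using ub that by blast
qed

section \<open>Linear equations whose damping behaves like 1 / t at the singular time\<close>

lemma eventually_at_right_0_Ioc: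
  assumes "\<forall>\<^sub>F t in at_right (0::real). P t" "0 < b"
  obtains \<epsilon> where "0 < \<epsilon>" "\<epsilon> \<le> b" "\<And>t. 0 < t \<Longrightarrow> t \<le> \<epsilon> \<Longrightarrow> P t"
proof -
  obtain c where c: "c > 0" "\<And>t. 0 < t \<Longrightarrow> t < c \<Longrightarrow> P t"
    using assms(1) unfolding eventually_at_right_field by auto
  then show ?thesis using assms(2) by (intro that[of "min b (c / 2)"]) auto
qed

lemma singular_damping_ev_pos:
  fixes p :: "real \<Rightarrow> real"
  assumes "((\<lambda>t. p t - 1 / t) \<longlongrightarrow> 0) (at_right 0)"
  shows "\<forall>\<^sub>F t in at_right 0. 0 < p t"
proof -
  have "\<forall>\<^sub>F t in at_right 0. - 1 < p t - 1 / t"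
    using assms by (rule order_tendstoD) simp
  moreover have "\<forall>\<^sub>F t in at_right (0::real). t \<in> {0<..<1}"
    by (rule eventually_at_right_real) simp
  ultimately show ?thesis
  proof eventually_elim
    case (elim t)
    then have "1 < 1 / t" by simp
    then show ?case using elim by linarith
  qed
qed

text \<open>Backwards in time the damping is an expansion, so a negative value would stay
  bounded away from \<open>0\<close> as \<open>t\<close> decreases to \<open>0\<close>.\<close>
lemma nonneg_from_singular_time:
  fixes h :: "real \<Rightarrow> real"
  assumes dh: "\<And>t. t \<in> {0<..b} \<Longrightarrow> (h has_real_derivative h' t) (at t within {0<..b})"
    and h': "\<And>t. t \<in> {0<..b} \<Longrightarrow> - p t * h t \<le> h' t"
    and cont: "continuous_on {0<..b} p"
    and p: "((\<lambda>t. p t - 1 / t) \<longlongrightarrow> 0) (at_right 0)"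
    and lim: "(h \<longlongrightarrow> l) (at_right 0)" "0 \<le> l"
    and t: "t \<in> {0<..b}"
  shows "0 \<le> h t"
proof -
  have b: "0 < b" using t by auto
  obtain \<epsilon> where \<epsilon>: "0 < \<epsilon>" "\<epsilon> \<le> b" "\<And>s. 0 < s \<Longrightarrow> s \<le> \<epsilon> \<Longrightarrow> 0 < p s"
    by (rule eventually_at_right_0_Ioc[OF singular_damping_ev_pos[OF p] b]) blast
  have small: "0 \<le> h s" if s: "0 < s" "s \<le> \<epsilon>" for s
  proof (rule ccontr)
    assume neg: "\<not> 0 \<le> h s"
    define c where "c = h s"
    have "\<forall>\<^sub>F u in at_right 0. c < h u"
      by (rule order_tendstoD(1)[OF lim(1)]) (use neg lim(2) c_def in auto)
    then obtain u where u: "0 < u" "u \<le> s" "c < h u"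
      by (rule eventually_at_right_0_Ioc[OF _ s(1)]) (use s in blast)
    have sub: "{u..s} \<subseteq> {0<..b}" using u s \<epsilon> by auto
    \<comment> \<open>Since \<open>c < 0\<close> and \<open>p\<close> is positive near 0,
      subtracting \<open>c\<close> preserves the differential inequality; positivity of
      \<open>h - c\<close> at \<open>u\<close> would persist up to \<open>s\<close>, where it
      vanishes by the choice of \<open>c\<close>.\<close>
    have "0 < h s - c"
    proof (rule pos_persists[where a = u and b = s and h = "\<lambda>t. h t - c" and h' = h' and p = "\<lambda>t. - p t"])
      fix v assume v: "v \<in> {u..s}"
      show "((\<lambda>t. h t - c) has_real_derivative h' v) (at v within {u..s})"
        using has_field_derivative_subset[OF dh sub] v sub by (auto intro!: derivative_eq_intros)
      have "0 \<le> p v * - c" using \<epsilon>(3)[of v] v u s neg by (intro mult_nonneg_nonneg) (auto simp: c_def)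
      then show "- p v * (h v - c) \<le> h' v" using h'[of v] v sub by (auto simp: algebra_simps)
    qed (use u in \<open>auto intro!: continuous_intros continuous_on_subset[OF cont sub]\<close>)
    then show False by (simp add: c_def)
  qed
  show ?thesis
  proof (cases "t \<le> \<epsilon>")
    case False
    have sub: "{\<epsilon>..t} \<subseteq> {0<..b}" using \<epsilon> t by auto
    show ?thesis
    proof (rule nonneg_persists[where h = h and t = t and a = \<epsilon> and b = t and h' = h' and p = "\<lambda>t. - p t"])
      show "(h has_real_derivative h' s) (at s within {\<epsilon>..t})" if "s \<in> {\<epsilon>..t}" for s
        using has_field_derivative_subset[OF dh sub] that sub by auto
      show "- p s * h s \<le> h' s" if "s \<in> {\<epsilon>..t}" for s
        using h'[of s] that sub by auto
    qed (use False \<epsilon> small[of \<epsilon>] in \<open>auto intro!: continuous_intros continuous_on_subset[OF cont sub]\<close>)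
  qed (use small t in auto)
qed

text \<open>Near 0 the factor \<open>t\<close> is an integrating factor: the derivative of
  \<open>t * h t\<close> is \<open>t\<close> times a quantity tending to \<open>c\<close>, and
  L'Hospital's rule against \<open>t\<^sup>2\<close> produces the factor 1 / 2. The lemma converts
  sources into slopes at the singular time.\<close>

lemma singular_linear_slope:
  fixes h :: "real \<Rightarrow> real"
  assumes dh: "\<forall>\<^sub>F t in at_right 0. (h has_real_derivative - p t * h t + g t) (at t)"
    and p: "((\<lambda>t. p t - 1 / t) \<longlongrightarrow> 0) (at_right 0)"
    and h: "(h \<longlongrightarrow> 0) (at_right 0)" and g: "(g \<longlongrightarrow> c) (at_right 0)"
  shows "((\<lambda>t. h t / t) \<longlongrightarrow> c / 2) (at_right 0)"
proof -
  have pos: "\<forall>\<^sub>F t in at_right (0::real). 0 < t" by (simp add: eventually_at_right_less)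
  have "((\<lambda>t. (t * h t) / t\<^sup>2) \<longlongrightarrow> c / 2) (at_right 0)"
  proof (rule lhopital_right_0[where f' = "\<lambda>t. h t + t * (- p t * h t + g t)" and g' = "\<lambda>t. 2 * t"])
    show "((\<lambda>t. t * h t) \<longlongrightarrow> 0) (at_right 0)"
      using tendsto_mult[OF tendsto_ident_at h] by simp
    show "((\<lambda>t::real. t\<^sup>2) \<longlongrightarrow> 0) (at_right 0)"
      using tendsto_power[OF tendsto_ident_at[of "0::real" "{0<..}"], of 2] by simp
    show "\<forall>\<^sub>F t in at_right (0::real). t\<^sup>2 \<noteq> 0" "\<forall>\<^sub>F t in at_right (0::real). 2 * t \<noteq> 0"
      using pos by (eventually_elim, simp)+
    show "\<forall>\<^sub>F t in at_right 0. ((\<lambda>t. t * h t) has_real_derivative h t + t * (- p t * h t + g t)) (at t)"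
      using dh by eventually_elim (auto intro!: derivative_eq_intros simp: algebra_simps)
    show "\<forall>\<^sub>F t in at_right 0. ((\<lambda>t. t\<^sup>2) has_real_derivative 2 * t) (at (t::real))"
      by (intro always_eventually allI) (auto intro!: derivative_eq_intros)
    have "((\<lambda>t. (- (p t - 1 / t) * h t + g t) / 2) \<longlongrightarrow> (- 0 * 0 + c) / 2) (at_right 0)"
      by (intro tendsto_intros p h g) simp
    then have "((\<lambda>t. (- (p t - 1 / t) * h t + g t) / 2) \<longlongrightarrow> c / 2) (at_right 0)" by simp
    then show "((\<lambda>t. (h t + t * (- p t * h t + g t)) / (2 * t)) \<longlongrightarrow> c / 2) (at_right 0)"
      by (rule Lim_transform_eventually) (use pos in \<open>eventually_elim, simp add: field_simps\<close>)
  qed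
  then show ?thesis
    by (rule Lim_transform_eventually) (use pos in \<open>eventually_elim, simp add: power2_eq_square\<close>)
qed

text \<open>With the integrating factor \<open>exp (P t)\<close> this is L'Hospital's rule at
  infinity, which asks only the denominator to diverge; no prior bound on \<open>y\<close> is
  required.\<close>

lemma linear_relaxation_limit:
  fixes y P :: "real \<Rightarrow> real"
  assumes dy: "\<forall>\<^sub>F t in at_top. (y has_real_derivative - p t * y t + g t) (at t)"
    and dP: "\<forall>\<^sub>F t in at_top. (P has_real_derivative p t) (at t)"
    and P: "filterlim P at_top at_top"
    and p: "(p \<longlongrightarrow> p0) at_top" "0 < p0" and g: "(g \<longlongrightarrow> g0) at_top"
  shows "(y \<longlongrightarrow> g0 / p0) at_top"
proof -
  have "\<forall>\<^sub>F t in at_top. 0 < p t" by (rule order_tendstoD(1)[OF p])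
  then have p_nz: "\<forall>\<^sub>F t in at_top. p t \<noteq> 0" by eventually_elim simp
  have "((\<lambda>t. (y t * exp (P t)) / exp (P t)) \<longlongrightarrow> g0 / p0) at_top"
  proof (rule lhospital_at_top_at_top[where f' = "\<lambda>t. g t * exp (P t)" and g' = "\<lambda>t. p t * exp (P t)"])
    show "filterlim (\<lambda>t. exp (P t)) at_top at_top"
      by (rule filterlim_compose[OF exp_at_top P])
    show "\<forall>\<^sub>F t in at_top. p t * exp (P t) \<noteq> 0" using p_nz by eventually_elim simp
    show "\<forall>\<^sub>F t in at_top. ((\<lambda>t. y t * exp (P t)) has_real_derivative g t * exp (P t)) (at t)"
      using dy dP by eventually_elim (auto intro!: derivative_eq_intros simp: algebra_simps)
    show "\<forall>\<^sub>F t in at_top. ((\<lambda>t. exp (P t)) has_real_derivative p t * exp (P t)) (at t)"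
      using dP by eventually_elim (auto intro!: derivative_eq_intros)
    have "((\<lambda>t. g t / p t) \<longlongrightarrow> g0 / p0) at_top" using p g by (intro tendsto_intros) auto
    then show "((\<lambda>t. g t * exp (P t) / (p t * exp (P t))) \<longlongrightarrow> g0 / p0) at_top" by simp
  qed
  then show ?thesis by simp
qed

text \<open>The quotient \<open>f t / t\<close> tends to \<open>m\<close> by L'Hospital's rule and
  to 0 because \<open>f\<close> converges.\<close>

lemma convergent_derivative_limit_zero:
  fixes f :: "real \<Rightarrow> real"
  assumes df: "\<forall>\<^sub>F t in at_top. (f has_real_derivative f' t) (at t)"
    and f: "(f \<longlongrightarrow> l) at_top" and f': "(f' \<longlongrightarrow> m) at_top"
  shows "m = 0"
proof -
  have "((\<lambda>t. f t / t) \<longlongrightarrow> m) at_top"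
    by (rule lhospital_at_top_at_top[where f' = f' and g' = "\<lambda>_. 1"])
      (use df f' in \<open>auto intro!: derivative_eq_intros simp: filterlim_ident\<close>)
  moreover have "((\<lambda>t. f t / t) \<longlongrightarrow> 0) at_top"
    using f by (rule real_tendsto_divide_at_top) (rule filterlim_ident)
  ultimately show ?thesis using tendsto_unique trivial_limit_at_top_linorder by blast
qed

section \<open>Ordinary differential equations\<close>

text \<open>Derivatives within \<open>S\<close> are one-sided at end points, so a single notion
  covers compact, half-open and unbounded time intervals.\<close>

definition solves :: "('a::real_normed_vector \<Rightarrow> 'a) \<Rightarrow> (real \<Rightarrow> 'a) \<Rightarrow> real set \<Rightarrow> bool" where
  "solves F w S \<longleftrightarrow> (\<forall>t\<in>S. (w has_vector_derivative F (w t)) (at t within S))"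

definition lipschitz_on_balls :: "('a::real_normed_vector \<Rightarrow> 'b::real_normed_vector) \<Rightarrow> bool" where
  "lipschitz_on_balls F \<longleftrightarrow> (\<forall>N. \<exists>L. L-lipschitz_on (cball 0 N) F)"

lemma solves_subset: "solves F w S \<Longrightarrow> S' \<subseteq> S \<Longrightarrow> solves F w S'"
  unfolding solves_def by (blast intro: has_vector_derivative_within_subset)

lemma solves_continuous_on: "solves F w S \<Longrightarrow> continuous_on S w"
  unfolding solves_def
  by (auto simp: continuous_on_eq_continuous_within intro: has_vector_derivative_continuous)

lemma solves_cong:
  assumes "solves F w S" "\<And>t. t \<in> S \<Longrightarrow> F (w t) = G (v t) \<and> w t = v t"
  shows "solves G v S"
  unfolding solves_def
proof
  fix t assume t: "t \<in> S"
  have "(w has_vector_derivative G (v t)) (at t within S)"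
    using assms(1) assms(2)[OF t] t by (auto simp: solves_def)
  then show "(v has_vector_derivative G (v t)) (at t within S)"
    by (rule has_vector_derivative_transform[OF t, rotated]) (use assms(2) t in auto)
qed

text \<open>The unknown is \<open>exp (- \<mu> (t - a)) w t\<close> with \<open>\<mu> = L + 1\<close>; in this weighted norm
  the Picard operator is a contraction on the whole interval.\<close>
lemma picard_existence:
  fixes F :: "'a::euclidean_space \<Rightarrow> 'a"
  assumes F: "L-lipschitz_on UNIV F" and ab: "a \<le> b"
  obtains u where "u a = x" "solves F u {a..b}"
proof -
  \<comment> \<open>Composing with this clamp extends functions from \<open>{a..b}\<close> to
    bounded continuous functions on the line, so the Picard operator acts on a complete
    space.\<close>
  define c where "c t = max a (min b t)" for t
  have c: "c t \<in> {a..b}" for t using ab by (auto simp: c_def)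
  have c_id: "c t = t" if "t \<in> {a..b}" for t using that by (auto simp: c_def)
  have cont_c: "continuous_on UNIV c" unfolding c_def by (intro continuous_intros)
  have L: "0 \<le> L" by (rule lipschitz_on_nonneg[OF F])
  define \<mu> where "\<mu> = L + 1"
  have \<mu>: "0 < \<mu>" using L by (simp add: \<mu>_def)
  have cont_F: "continuous_on UNIV F" by (rule lipschitz_on_continuous_on[OF F])
  define J where "J f = (\<lambda>s. F (exp (\<mu> * (s - a)) *\<^sub>R f s))" for f :: "real \<Rightarrow> 'a"
  have cont_J: "continuous_on S (J f)" if "continuous_on S f" for f S
    unfolding J_def by (intro continuous_on_compose2[OF cont_F] continuous_intros that) auto
  define G where "G f t = exp (- \<mu> * (t - a)) *\<^sub>R (x + integral {a..t} (J f))" for f t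
  define \<Phi> where "\<Phi> f = Bcontfun (\<lambda>t. G (apply_bcontfun f) (c t))" for f :: "real \<Rightarrow>\<^sub>C 'a"
  have cont_G: "continuous_on {a..b} (G (apply_bcontfun f))" for f :: "real \<Rightarrow>\<^sub>C 'a"
    unfolding G_def
    by (intro continuous_intros indefinite_integral_continuous_1 integrable_continuous_real cont_J) auto
  have \<Phi>: "apply_bcontfun (\<Phi> f) t = G (apply_bcontfun f) (c t)" for f t
  proof -
    have "(\<lambda>t. G (apply_bcontfun f) (c t)) \<in> bcontfun"
      unfolding bcontfun_def
    proof (intro CollectI conjI)
      show "continuous_on UNIV (\<lambda>t. G (apply_bcontfun f) (c t))"
        by (rule continuous_on_compose2[OF cont_G cont_c]) (use c in auto)
      have "bounded (G (apply_bcontfun f) ` {a..b})"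
        using cont_G compact_continuous_image compact_imp_bounded by blast
      then show "bounded (range (\<lambda>t. G (apply_bcontfun f) (c t)))"
        by (rule bounded_subset) (use c in auto)
    qed
    then show ?thesis by (simp add: \<Phi>_def Bcontfun_inverse)
  qed
  have contr: "dist (\<Phi> f) (\<Phi> g) \<le> L / \<mu> * dist f g" for f g
  proof (rule dist_bound)
    fix t
    define \<tau> where "\<tau> = c t"
    have \<tau>: "a \<le> \<tau>" "\<tau> \<le> b" using c[of t] by (auto simp: \<tau>_def)
    let ?D = "dist f g"
    have int: "J f integrable_on {a..\<tau>}" "J g integrable_on {a..\<tau>}"
      by (intro integrable_continuous_real cont_J; simp)+
    \<comment> \<open>Integrating the exponential weight gains the factor \<open>1 / \<mu>\<close>,
      which turns the Lipschitz constant \<open>L\<close> into the contraction constant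
      \<open>L / \<mu>\<close>.\<close>
    have E: "((\<lambda>s. L * ?D * exp (\<mu> * (s - a))) has_integral
        L * ?D * exp (\<mu> * (\<tau> - a)) / \<mu> - L * ?D * exp (\<mu> * (a - a)) / \<mu>) {a..\<tau>}"
    proof (rule fundamental_theorem_of_calculus[OF \<tau>(1)])
      fix s
      have "((\<lambda>s. L * ?D * exp (\<mu> * (s - a)) / \<mu>) has_real_derivative L * ?D * exp (\<mu> * (s - a)))
          (at s within {a..\<tau>})"
        using \<mu> by (auto intro!: derivative_eq_intros)
      then show "((\<lambda>s. L * ?D * exp (\<mu> * (s - a)) / \<mu>) has_vector_derivative L * ?D * exp (\<mu> * (s - a)))
          (at s within {a..\<tau>})"
        by (simp add: has_real_derivative_iff_has_vector_derivative)
    qed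
    have "norm (integral {a..\<tau>} (\<lambda>s. J f s - J g s)) \<le> integral {a..\<tau>} (\<lambda>s. L * ?D * exp (\<mu> * (s - a)))"
    proof (rule integral_norm_bound_integral)
      show "(\<lambda>s. J f s - J g s) integrable_on {a..\<tau>}" using int by (rule integrable_diff)
      show "(\<lambda>s. L * ?D * exp (\<mu> * (s - a))) integrable_on {a..\<tau>}" using E by blast
      fix s
      have "norm (J f s - J g s) \<le> L * dist (exp (\<mu> * (s - a)) *\<^sub>R f s) (exp (\<mu> * (s - a)) *\<^sub>R g s)"
        unfolding J_def dist_norm[symmetric] by (rule lipschitz_onD[OF F]) auto
      also have "\<dots> = L * (exp (\<mu> * (s - a)) * dist (f s) (g s))"
        by (simp add: dist_norm flip: scaleR_diff_right)
      also have "\<dots> \<le> L * (exp (\<mu> * (s - a)) * ?D)"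
        by (intro mult_left_mono dist_bounded L) simp
      finally show "norm (J f s - J g s) \<le> L * ?D * exp (\<mu> * (s - a))" by (simp add: mult_ac)
    qed
    also have "\<dots> \<le> L * ?D * exp (\<mu> * (\<tau> - a)) / \<mu>"
      using integral_unique[OF E] L \<mu> by simp
    finally have I: "norm (integral {a..\<tau>} (\<lambda>s. J f s - J g s)) \<le> L * ?D * exp (\<mu> * (\<tau> - a)) / \<mu>" .
    have "dist (\<Phi> f t) (\<Phi> g t) = exp (- \<mu> * (\<tau> - a)) * norm (integral {a..\<tau>} (\<lambda>s. J f s - J g s))"
      unfolding \<Phi> \<tau>_def[symmetric] G_def
      by (simp add: dist_norm integral_diff[OF int] flip: scaleR_diff_right)
    also have "\<dots> \<le> exp (- \<mu> * (\<tau> - a)) * (L * ?D * exp (\<mu> * (\<tau> - a)) / \<mu>)"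
      by (rule mult_left_mono[OF I]) simp
    also have "\<dots> = L / \<mu> * ?D * (exp (- \<mu> * (\<tau> - a)) * exp (\<mu> * (\<tau> - a)))" by (simp add: mult_ac)
    also have "exp (- \<mu> * (\<tau> - a)) * exp (\<mu> * (\<tau> - a)) = 1" by (simp flip: exp_add)
    finally show "dist (\<Phi> f t) (\<Phi> g t) \<le> L / \<mu> * ?D" by simp
  qed
  have "\<exists>!f. \<Phi> f = f"
    by (rule banach_fix_type[of "L / \<mu>"]) (use contr L \<mu> in \<open>auto simp: \<mu>_def\<close>)
  then obtain f where f: "\<Phi> f = f" by blast
  define u where "u t = exp (\<mu> * (t - a)) *\<^sub>R f t" for t
  have Ju: "J f = (\<lambda>s. F (u s))" by (simp add: J_def u_def)
  have u: "u t = x + integral {a..t} (\<lambda>s. F (u s))" if "t \<in> {a..b}" for t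
  proof -
    have "f t = G f t" using \<Phi>[of f t] f c_id[OF that] by simp
    then have "u t = exp (\<mu> * (t - a)) *\<^sub>R exp (- \<mu> * (t - a)) *\<^sub>R (x + integral {a..t} (J f))"
      by (simp add: u_def G_def)
    also have "exp (\<mu> * (t - a)) *\<^sub>R exp (- \<mu> * (t - a)) *\<^sub>R (x + integral {a..t} (J f)) = x + integral {a..t} (J f)"
      by (simp flip: exp_add)
    finally show ?thesis by (simp add: Ju)
  qed
  have "solves F u {a..b}"
    unfolding solves_def
  proof
    fix t assume t: "t \<in> {a..b}"
    have cont: "continuous_on {a..b} (\<lambda>s. F (u s))" using cont_J[of "{a..b}" f] by (simp add: Ju)
    have "((\<lambda>t. x + integral {a..t} (\<lambda>s. F (u s))) has_vector_derivative F (u t)) (at t within {a..b})"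
      by (rule derivative_eq_intros integral_has_vector_derivative[OF cont t] | simp)+
    then show "(u has_vector_derivative F (u t)) (at t within {a..b})"
      by (rule has_vector_derivative_transform[OF t, rotated]) (use u in auto)
  qed
  moreover have "u a = x" using u[of a] ab by simp
  ultimately show ?thesis using that by blast
qed

text \<open>The squared distance is differentiable also where the distance is not; by the
  Cauchy-Schwarz inequality it obeys Gronwall with rate \<open>2 * L\<close>, and the square root
  halves the rate.\<close>

lemma solves_dist_le:
  fixes F :: "'a::euclidean_space \<Rightarrow> 'a"
  assumes F: "L-lipschitz_on S F" and u: "solves F u {a..b}" and v: "solves F v {a..b}"
    and S: "\<And>t. t \<in> {a..b} \<Longrightarrow> u t \<in> S \<and> v t \<in> S" and t: "t \<in> {a..b}"
  shows "dist (u t) (v t) \<le> dist (u a) (v a) * exp (L * (t - a))"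
proof -
  define E where "E t = (u t - v t) \<bullet> (u t - v t)" for t
  have "E t \<le> E a * exp (2 * L * (t - a))"
  proof (rule gronwall[where f' = "\<lambda>t. 2 * ((u t - v t) \<bullet> (F (u t) - F (v t)))", OF _ _ t])
    fix s assume s: "s \<in> {a..b}"
    have "((\<lambda>t. u t - v t) has_vector_derivative F (u s) - F (v s)) (at s within {a..b})"
      using u v s by (auto simp: solves_def intro!: derivative_intros)
    then have d: "((\<lambda>t. u t - v t) has_derivative (\<lambda>h. h *\<^sub>R (F (u s) - F (v s)))) (at s within {a..b})"
      by (simp add: has_vector_derivative_def)
    show "(E has_real_derivative 2 * ((u s - v s) \<bullet> (F (u s) - F (v s)))) (at s within {a..b})"
      unfolding E_def has_field_derivative_def
      by (rule has_derivative_eq_rhs[OF has_derivative_inner[OF d d]]) (auto simp: fun_eq_iff inner_commute)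
    have "(u s - v s) \<bullet> (F (u s) - F (v s)) \<le> norm (u s - v s) * norm (F (u s) - F (v s))"
      by (rule norm_cauchy_schwarz)
    also have "\<dots> \<le> norm (u s - v s) * (L * norm (u s - v s))"
      using lipschitz_onD[OF F, of "u s" "v s"] S[OF s] by (intro mult_left_mono) (auto simp: dist_norm)
    also have "\<dots> = L * E s" by (simp add: E_def power2_eq_square flip: power2_norm_eq_inner)
    finally show "2 * ((u s - v s) \<bullet> (F (u s) - F (v s))) \<le> 2 * L * E s" by simp
  qed
  then have "(dist (u t) (v t))\<^sup>2 \<le> (dist (u a) (v a) * exp (L * (t - a)))\<^sup>2"
    by (simp add: E_def dist_norm power2_norm_eq_inner power_mult_distrib mult.assoc flip: exp_double)
  then show ?thesis by (rule power2_le_imp_le) simp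
qed

lemma solves_bounded:
  assumes "solves F u {a..b}"
  obtains N where "0 \<le> N" "\<And>t. t \<in> {a..b} \<Longrightarrow> norm (u t) \<le> N"
proof -
  have "bounded (u ` {a..b})"
    using solves_continuous_on[OF assms] compact_continuous_image compact_imp_bounded by blast
  then obtain N where "0 < N" "\<forall>x\<in>u ` {a..b}. norm x \<le> N" by (auto simp: bounded_pos)
  then show ?thesis using that[of N] by auto
qed

lemma solves_unique:
  fixes F :: "'a::euclidean_space \<Rightarrow> 'a"
  assumes F: "lipschitz_on_balls F" and u: "solves F u {a..b}" and v: "solves F v {a..b}"
    and eq: "u a = v a" and t: "t \<in> {a..b}"
  shows "u t = v t"
proof -
  obtain N1 where N1: "\<And>t. t \<in> {a..b} \<Longrightarrow> norm (u t) \<le> N1" by (rule solves_bounded[OF u]) blast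
  obtain N2 where N2: "\<And>t. t \<in> {a..b} \<Longrightarrow> norm (v t) \<le> N2" by (rule solves_bounded[OF v]) blast
  obtain L where L: "L-lipschitz_on (cball 0 (max N1 N2)) F" using F by (auto simp: lipschitz_on_balls_def)
  have "dist (u t) (v t) \<le> dist (u a) (v a) * exp (L * (t - a))"
    by (rule solves_dist_le[OF L u v _ t]) (use N1 N2 in \<open>auto simp: le_max_iff_disj\<close>)
  then show ?thesis using eq by simp
qed

text \<open>The nearest-point projection onto a ball is nonexpansive, so composing with it makes a
  field that is Lipschitz on the ball globally Lipschitz. Solutions of the new field solve the old
  one as long as they stay in the ball.\<close>

definition truncate :: "real \<Rightarrow> ('a::euclidean_space \<Rightarrow> 'a) \<Rightarrow> 'a \<Rightarrow> 'a" where
  "truncate N F x = F (closest_point (cball 0 N) x)"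

lemma truncate_eq: "norm x \<le> N \<Longrightarrow> truncate N F x = F x"
  by (simp add: truncate_def closest_point_self)

lemma truncate_lipschitz:
  assumes "lipschitz_on_balls F" "0 \<le> N"
  obtains L where "L-lipschitz_on UNIV (truncate N F)"
proof -
  obtain L where L: "L-lipschitz_on (cball 0 N) F" using assms(1) by (auto simp: lipschitz_on_balls_def)
  have ne: "cball (0::'a) N \<noteq> {}" using assms(2) by simp
  have "L-lipschitz_on UNIV (truncate N F)"
  proof (rule lipschitz_onI)
    fix x y :: 'a
    have "dist (truncate N F x) (truncate N F y)
        \<le> L * dist (closest_point (cball 0 N) x) (closest_point (cball 0 N) y)"
      unfolding truncate_def by (rule lipschitz_onD[OF L]) (intro closest_point_in_set ne closed_cball)+
    also have "\<dots> \<le> L * dist x y"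
      by (intro mult_left_mono closest_point_lipschitz ne lipschitz_on_nonneg[OF L]) auto
    finally show "dist (truncate N F x) (truncate N F y) \<le> L * dist x y" .
  qed (rule lipschitz_on_nonneg[OF L])
  then show ?thesis by (rule that)
qed

text \<open>Existence up to \<open>b\<close> for nearby initial values is part of the claim. The
  field is cut off at radius \<open>N + 1\<close>, and solutions starting near \<open>w a\<close>
  stay within distance 1 of \<open>w\<close>, hence never meet the cut-off.\<close>

lemma solves_continuous_dependence:
  fixes F :: "'a::euclidean_space \<Rightarrow> 'a"
  assumes F: "lipschitz_on_balls F" and w: "solves F w {a..b}" and ab: "a \<le> b" and e: "0 < e"
  obtains d where "0 < d"
    "\<And>y. dist y (w a) < d \<Longrightarrow> \<exists>u. u a = y \<and> solves F u {a..b} \<and> dist (u b) (w b) < e"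
proof -
  obtain N where N: "0 \<le> N" "\<And>t. t \<in> {a..b} \<Longrightarrow> norm (w t) \<le> N" by (rule solves_bounded[OF w]) blast
  obtain L where L: "L-lipschitz_on UNIV (truncate (N + 1) F)"
    by (rule truncate_lipschitz[OF F, of "N + 1"]) (use N in auto)
  have L0: "0 \<le> L" by (rule lipschitz_on_nonneg[OF L])
  have wT: "solves (truncate (N + 1) F) w {a..b}"
    by (rule solves_cong[OF w]) (use N in \<open>auto simp: truncate_eq add_increasing2\<close>)
  \<comment> \<open>The exponential is the worst growth of distances up to time \<open>b\<close>;
    the 1 keeps the perturbed solution inside the ball of radius \<open>N + 1\<close>.\<close>
  define d where "d = min e 1 / exp (L * (b - a))"
  have d0: "0 < d" using e by (simp add: d_def)
  moreover have "\<exists>u. u a = y \<and> solves F u {a..b} \<and> dist (u b) (w b) < e" if y: "dist y (w a) < d" for y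
  proof -
    obtain u where u: "u a = y" "solves (truncate (N + 1) F) u {a..b}"
      by (rule picard_existence[OF L ab])
    have near: "dist (u t) (w t) < min e 1" if t: "t \<in> {a..b}" for t
    proof -
      have "dist (u t) (w t) \<le> dist (u a) (w a) * exp (L * (t - a))"
        by (rule solves_dist_le[OF L u(2) wT _ t]) auto
      also have "\<dots> \<le> dist (u a) (w a) * exp (L * (b - a))"
        using t L0 by (intro mult_left_mono) (auto intro: mult_left_mono)
      also have "\<dots> < d * exp (L * (b - a))" using y u(1) by (intro mult_strict_right_mono) auto
      finally show ?thesis by (simp add: d_def)
    qed
    have "norm (u t) \<le> N + 1" if t: "t \<in> {a..b}" for t
      using near[OF t] N(2)[OF t] norm_triangle_ineq2[of "u t" "w t"] by (auto simp: dist_norm)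
    then have "solves F u {a..b}" by (intro solves_cong[OF u(2)]) (auto simp: truncate_eq)
    then show ?thesis using u(1) near[of b] ab by auto
  qed
  ultimately show ?thesis by (rule that)
qed

text \<open>An a priori bound prevents blow-up. It is assumed only for solutions of
  \<open>F\<close>, so it is applied to a solution of the truncated field by continuous induction:
  while the norm is at most \<open>N + 1\<close> that solution solves \<open>F\<close>, and the
  bound \<open>N\<close> restores the margin.\<close>

lemma solves_extends:
  fixes F :: "'a::euclidean_space \<Rightarrow> 'a"
  assumes F: "lipschitz_on_balls F" and ab: "a \<le> b"
    and bound: "\<And>c u. a \<le> c \<Longrightarrow> c \<le> b \<Longrightarrow> u a = x \<Longrightarrow> solves F u {a..c} \<Longrightarrow> norm (u c) \<le> N"
  obtains u where "u a = x" "solves F u {a..b}"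
proof -
  \<comment> \<open>On the degenerate interval the filter of the derivative is trivial, so the
    constant function is a solution and the bound applies to \<open>x\<close>.\<close>
  have "solves F (\<lambda>_. x) {a..a}" by (simp add: solves_def has_vector_derivative_def has_derivative_def
      at_within_def bounded_linear_scaleR_left)
  then have xN: "norm x \<le> N" using bound[of a "\<lambda>_. x"] ab by simp
  then have N0: "0 \<le> N + 1" using norm_ge_zero[of x] by linarith
  obtain L where L: "L-lipschitz_on UNIV (truncate (N + 1) F)"
    by (rule truncate_lipschitz[OF F N0])
  obtain u where u: "u a = x" "solves (truncate (N + 1) F) u {a..b}"
    by (rule picard_existence[OF L ab])
  have cont: "continuous_on {a..b} (\<lambda>t. norm (u t))"
    by (intro continuous_intros solves_continuous_on[OF u(2)])
  have solves_to: "solves F u {a..t}" if "t \<le> b" "\<And>s. a \<le> s \<Longrightarrow> s \<le> t \<Longrightarrow> norm (u s) \<le> N + 1" for t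
    by (rule solves_cong[OF solves_subset[OF u(2)]]) (use that in \<open>auto simp: truncate_eq\<close>)
  have le: "norm (u t) \<le> N" if "a \<le> t" "t \<le> b" for t
    using ab
  proof (rule real_induction[where t = t])
    show "norm (u a) \<le> N" using u xN by simp
    show "norm (u t) \<le> N" if "a < t" "t \<le> b" "\<And>s. a \<le> s \<Longrightarrow> s < t \<Longrightarrow> norm (u s) \<le> N" for t
      by (rule continuous_on_le_left_limit[OF cont, of "\<lambda>_. N"]) (use that in auto)
    fix t assume t: "a \<le> t" "t < b" and le: "\<And>s. a \<le> s \<Longrightarrow> s \<le> t \<Longrightarrow> norm (u s) \<le> N"
    obtain \<delta> where \<delta>: "\<delta> > 0" "\<And>s. s \<in> {a..b} \<Longrightarrow> \<bar>s - t\<bar> < \<delta> \<Longrightarrow> norm (u s) < N + 1"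
      using continuous_on_less_right[OF cont, of "\<lambda>_. N + 1" t] le[of t] t by force
    have "norm (u s) \<le> N" if s: "t < s" "s < t + \<delta>" "s \<le> b" for s
    proof (rule bound)
      show "solves F u {a..s}"
      proof (rule solves_to[OF s(3)])
        fix r assume r: "a \<le> r" "r \<le> s"
        show "norm (u r) \<le> N + 1"
          using le[of r] \<delta>(2)[of r] r s by (cases "r \<le> t") auto
      qed
    qed (use s t u in auto)
    then show "\<exists>\<delta>>0. \<forall>s. t < s \<and> s < t + \<delta> \<and> s \<le> b \<longrightarrow> norm (u s) \<le> N"
      using \<delta>(1) by blast
  qed (use that in auto)
  have "solves F u {a..b}"
  proof (rule solves_to)
    fix s assume "a \<le> s" "s \<le> b"
    then show "norm (u s) \<le> N + 1" using le[of s] by simp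
  qed simp
  then show ?thesis using u(1) that by blast
qed

text \<open>By uniqueness the solutions on \<open>{a..b}\<close> agree on overlaps, so the diagonal
  \<open>U t t\<close> is locally one of them.\<close>

lemma solves_global:
  fixes F :: "'a::euclidean_space \<Rightarrow> 'a"
  assumes F: "lipschitz_on_balls F"
    and ex: "\<And>b. a \<le> b \<Longrightarrow> \<exists>u. u a = x \<and> solves F u {a..b}"
  obtains u where "u a = x" "solves F u {a..}"
proof -
  obtain U where U: "\<And>b. a \<le> b \<Longrightarrow> U b a = x" "\<And>b. a \<le> b \<Longrightarrow> solves F (U b) {a..b}"
    using ex by metis
  define u where "u t = U t t" for t
  have u_eq: "u t = U b t" if "a \<le> t" "t \<le> b" for t b
  proof -
    have "solves F (U b) {a..t}" by (rule solves_subset[OF U(2)]) (use that in auto)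
    then have "U t t = U b t"
      by (rule solves_unique[OF F U(2), rotated]) (use that U in auto)
    then show ?thesis by (simp add: u_def)
  qed
  have "solves F u {a..}"
    unfolding solves_def
  proof
    fix t assume t: "t \<in> {a..}"
    define b where "b = t + 1"
    have tb: "t \<in> {a..b}" using t by (simp add: b_def)
    have "u t = U b t" by (rule u_eq) (use tb in auto)
    then have "(U b has_vector_derivative F (u t)) (at t within {a..b})"
      using U(2)[of b] tb by (auto simp: solves_def)
    then have "(u has_vector_derivative F (u t)) (at t within {a..b})"
      by (rule has_vector_derivative_transform[OF tb, rotated]) (rule u_eq; simp)
    moreover have "at t within {a..b} = at t within {a..}"
      by (rule at_within_nhd[of t "{..<b}"]) (auto simp: b_def)
    ultimately show "(u has_vector_derivative F (u t)) (at t within {a..})" by simp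
  qed
  moreover have "u a = x" using u_eq[of a a] U(1)[of a] by simp
  ultimately show ?thesis using that by blast
qed

text \<open>This continues a solution past its last time \<open>a\<close>. The one-sided derivatives
  match at the joint because the field depends on the state alone and the states agree
  there.\<close>

lemma solves_append:
  assumes w: "solves F w {z<..a}" and u: "solves F u S" and S: "a \<in> S" "S \<subseteq> {a..}" and "z < a" and eq: "w a = u a"
  shows "solves F (\<lambda>t. if t \<in> {z<..a} then w t else u t) ({z<..a} \<union> S)"
  unfolding solves_def
proof
  fix t assume t: "t \<in> {z<..a} \<union> S"
  have cl: "closure {z<..a} = {z..a}" using \<open>z < a\<close> by simp
  have "closure S \<subseteq> {a..}" using S(2) by (rule closure_minimal) simp
  moreover have "a \<in> closure S" using S(1) closure_subset by blast
  ultimately have int: "closure {z<..a} \<inter> closure S = {a}" using \<open>z < a\<close> cl by auto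
  have U: "{z<..a} \<union> {a} = {z<..a}" "S \<union> {a} = S" using S(1) \<open>z < a\<close> by auto
  have closures: "t = a" if "t \<in> closure {z<..a}" "t \<in> closure S" using that int by blast
  have "((\<lambda>t. if t \<in> {z<..a} then w t else u t) has_vector_derivative
      (if t \<in> {z<..a} then F (w t) else F (u t))) (at t within {z<..a} \<union> S)"
  proof (rule has_vector_derivative_If_within_closures[OF t refl, unfolded int U])
    show "(w has_vector_derivative F (w t)) (at t within {z<..a})" if "t \<in> {z<..a}"
      using w that by (auto simp: solves_def)
    show "(u has_vector_derivative F (u t)) (at t within S)" if "t \<in> S"
      using u that by (auto simp: solves_def)
  qed (use closures eq in auto)
  then show "((\<lambda>t. if t \<in> {z<..a} then w t else u t) has_vector_derivative
      F (if t \<in> {z<..a} then w t else u t)) (at t within {z<..a} \<union> S)"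
    by (simp only: if_distrib[of F])
qed

section \<open>Polynomial vector fields are Lipschitz on balls\<close>

lemma lipschitz_on_balls_const: "lipschitz_on_balls (\<lambda>x. c)"
  unfolding lipschitz_on_balls_def using lipschitz_on_constant by blast

lemma lipschitz_on_balls_id: "lipschitz_on_balls (\<lambda>x. x)"
  unfolding lipschitz_on_balls_def using lipschitz_on_id by blast

lemma lipschitz_on_balls_add:
  "lipschitz_on_balls f \<Longrightarrow> lipschitz_on_balls g \<Longrightarrow> lipschitz_on_balls (\<lambda>x. f x + g x)"
  unfolding lipschitz_on_balls_def using lipschitz_on_add by blast

lemma lipschitz_on_balls_diff:
  "lipschitz_on_balls f \<Longrightarrow> lipschitz_on_balls g \<Longrightarrow> lipschitz_on_balls (\<lambda>x. f x - g x)"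
  unfolding lipschitz_on_balls_def using lipschitz_on_diff by blast

lemma lipschitz_on_balls_minus:
  "lipschitz_on_balls f \<Longrightarrow> lipschitz_on_balls (\<lambda>x. - f x)"
  unfolding lipschitz_on_balls_def using lipschitz_on_minus by blast

lemma lipschitz_on_balls_Pair:
  "lipschitz_on_balls f \<Longrightarrow> lipschitz_on_balls g \<Longrightarrow> lipschitz_on_balls (\<lambda>x. (f x, g x))"
  unfolding lipschitz_on_balls_def using lipschitz_on_Pair by blast

lemma lipschitz_on_balls_bounded_linear:
  assumes "bounded_linear h" "lipschitz_on_balls f"
  shows "lipschitz_on_balls (\<lambda>x. h (f x))"
  unfolding lipschitz_on_balls_def
proof
  fix N
  obtain L where "L-lipschitz_on (cball 0 N) f" using assms(2) by (auto simp: lipschitz_on_balls_def)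
  moreover obtain B where "B-lipschitz_on (f ` cball 0 N) h" by (rule bounded_linear.lipschitz_boundE[OF assms(1)])
  ultimately show "\<exists>L. L-lipschitz_on (cball 0 N) (\<lambda>x. h (f x))"
    using lipschitz_on_compose2 by blast
qed

lemma lipschitz_on_balls_mult:
  fixes f g :: "'a::real_normed_vector \<Rightarrow> real"
  assumes "lipschitz_on_balls f" "lipschitz_on_balls g"
  shows "lipschitz_on_balls (\<lambda>x. f x * g x)"
  unfolding lipschitz_on_balls_def
proof
  fix N
  obtain L M where L: "L-lipschitz_on (cball 0 N) f" and M: "M-lipschitz_on (cball 0 N) g"
    using assms unfolding lipschitz_on_balls_def by blast
  have L0: "0 \<le> L" "0 \<le> M" using L M lipschitz_on_nonneg by blast+
  \<comment> \<open>The absolute value of \<open>N\<close> keeps these bounds nonnegative when the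
    radius is negative and the ball empty.\<close>
  define A where "A = \<bar>f 0\<bar> + L * \<bar>N\<bar>"
  define B where "B = \<bar>g 0\<bar> + M * \<bar>N\<bar>"
  have A: "\<bar>f x\<bar> \<le> A" and B: "\<bar>g x\<bar> \<le> B" if "x \<in> cball 0 N" for x
  proof -
    have 0: "0 \<in> cball (0::'a) N" using that norm_ge_zero[of x] unfolding mem_cball_0 norm_zero by linarith
    have "L * norm x \<le> L * \<bar>N\<bar>" "M * norm x \<le> M * \<bar>N\<bar>" using that L0 by (auto intro!: mult_left_mono)
    then show "\<bar>f x\<bar> \<le> A" "\<bar>g x\<bar> \<le> B"
      using lipschitz_onD[OF L that 0] lipschitz_onD[OF M that 0] unfolding A_def B_def
      by (auto simp: dist_real_def)
  qed
  have "(A * M + B * L)-lipschitz_on (cball 0 N) (\<lambda>x. f x * g x)"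
  proof (rule lipschitz_onI)
    fix x y :: 'a assume xy: "x \<in> cball 0 N" "y \<in> cball 0 N"
    have "f x * g x - f y * g y = f x * (g x - g y) + g y * (f x - f y)" by (simp add: algebra_simps)
    then have "\<bar>f x * g x - f y * g y\<bar> \<le> \<bar>f x\<bar> * \<bar>g x - g y\<bar> + \<bar>g y\<bar> * \<bar>f x - f y\<bar>"
      by (metis abs_mult abs_triangle_ineq)
    also have "\<dots> \<le> A * (M * dist x y) + B * (L * dist x y)"
      using A[OF xy(1)] B[OF xy(2)] lipschitz_onD[OF L xy] lipschitz_onD[OF M xy]
      by (intro add_mono mult_mono) (auto simp: dist_real_def)
    finally show "dist (f x * g x) (f y * g y) \<le> (A * M + B * L) * dist x y"
      by (simp add: dist_real_def algebra_simps)
  next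
    show "0 \<le> A * M + B * L" using L0 by (auto simp: A_def B_def)
  qed
  then show "\<exists>L. L-lipschitz_on (cball 0 N) (\<lambda>x. f x * g x)" by blast
qed

lemma soliton_rhs_lipschitz: "lipschitz_on_balls soliton_rhs"
proof -
  note lin = lipschitz_on_balls_bounded_linear[OF bounded_linear_fst]
    lipschitz_on_balls_bounded_linear[OF bounded_linear_snd]
  show ?thesis
    unfolding soliton_rhs_def case_prod_beta power2_eq_square divide_inverse
    by (intro lipschitz_on_balls_Pair lipschitz_on_balls_add lipschitz_on_balls_diff
        lipschitz_on_balls_minus lipschitz_on_balls_mult lipschitz_on_balls_const
        lin lipschitz_on_balls_id)
qed

section \<open>The soliton system\<close>

text \<open>With seven scalar functions instead of one vector-valued curve, a permutation of the
  indices is another instance of the same locale, and a statement proved for one pair of indices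
  transfers to the others.\<close>

locale soliton_flow =
  fixes J :: "real set" and x l1 l2 l3 r1 r2 r3 :: "real \<Rightarrow> real"
  assumes dx: "t \<in> J \<Longrightarrow> (x has_real_derivative - ((l1 t)\<^sup>2 + (l2 t)\<^sup>2 + (l3 t)\<^sup>2)) (at t within J)"
    and dl1: "t \<in> J \<Longrightarrow> (l1 has_real_derivative - x t * l1 t + (r1 t)\<^sup>2 / 2 - (r2 t - r3 t)\<^sup>2 / 2) (at t within J)"
    and dl2: "t \<in> J \<Longrightarrow> (l2 has_real_derivative - x t * l2 t + (r2 t)\<^sup>2 / 2 - (r3 t - r1 t)\<^sup>2 / 2) (at t within J)"
    and dl3: "t \<in> J \<Longrightarrow> (l3 has_real_derivative - x t * l3 t + (r3 t)\<^sup>2 / 2 - (r1 t - r2 t)\<^sup>2 / 2) (at t within J)"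
    and dr1: "t \<in> J \<Longrightarrow> (r1 has_real_derivative r1 t * (l1 t - l2 t - l3 t)) (at t within J)"
    and dr2: "t \<in> J \<Longrightarrow> (r2 has_real_derivative r2 t * (l2 t - l3 t - l1 t)) (at t within J)"
    and dr3: "t \<in> J \<Longrightarrow> (r3 has_real_derivative r3 t * (l3 t - l1 t - l2 t)) (at t within J)"
begin

lemma swap12: "soliton_flow J x l2 l1 l3 r2 r1 r3"
proof (unfold_locales, goal_cases)
  case (1 t)
  show ?case by (rule DERIV_cong[OF dx[OF 1]]) (simp add: power2_eq_square algebra_simps)
next
  case (2 t)
  show ?case by (rule DERIV_cong[OF dl2[OF 2]]) (simp add: power2_eq_square algebra_simps)
next
  case (3 t)
  show ?case by (rule DERIV_cong[OF dl1[OF 3]]) (simp add: power2_eq_square algebra_simps)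
next
  case (4 t)
  show ?case by (rule DERIV_cong[OF dl3[OF 4]]) (simp add: power2_eq_square algebra_simps)
next
  case (5 t)
  show ?case by (rule DERIV_cong[OF dr2[OF 5]]) (simp add: power2_eq_square algebra_simps)
next
  case (6 t)
  show ?case by (rule DERIV_cong[OF dr1[OF 6]]) (simp add: power2_eq_square algebra_simps)
next
  case (7 t)
  show ?case by (rule DERIV_cong[OF dr3[OF 7]]) (simp add: power2_eq_square algebra_simps)
qed

lemma swap23: "soliton_flow J x l1 l3 l2 r1 r3 r2"
proof (unfold_locales, goal_cases)
  case (1 t)
  show ?case by (rule DERIV_cong[OF dx[OF 1]]) (simp add: power2_eq_square algebra_simps)
next
  case (2 t)
  show ?case by (rule DERIV_cong[OF dl1[OF 2]]) (simp add: power2_eq_square algebra_simps)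
next
  case (3 t)
  show ?case by (rule DERIV_cong[OF dl3[OF 3]]) (simp add: power2_eq_square algebra_simps)
next
  case (4 t)
  show ?case by (rule DERIV_cong[OF dl2[OF 4]]) (simp add: power2_eq_square algebra_simps)
next
  case (5 t)
  show ?case by (rule DERIV_cong[OF dr1[OF 5]]) (simp add: power2_eq_square algebra_simps)
next
  case (6 t)
  show ?case by (rule DERIV_cong[OF dr3[OF 6]]) (simp add: power2_eq_square algebra_simps)
next
  case (7 t)
  show ?case by (rule DERIV_cong[OF dr2[OF 7]]) (simp add: power2_eq_square algebra_simps)
qed

lemma cont: "continuous_on J x" "continuous_on J l1" "continuous_on J l2" "continuous_on J l3"
  "continuous_on J r1" "continuous_on J r2" "continuous_on J r3"
  by (rule DERIV_continuous_on, erule dx dl1 dl2 dl3 dr1 dr2 dr3)+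

lemma dl12: "t \<in> J \<Longrightarrow> ((\<lambda>t. l1 t - l2 t) has_real_derivative
    - x t * (l1 t - l2 t) + (r1 t + r2 t - r3 t) * (r1 t - r2 t)) (at t within J)"
  by (rule DERIV_cong[OF DERIV_diff[OF dl1 dl2]]) (auto simp: power2_eq_square field_simps)

lemma dr12: "t \<in> J \<Longrightarrow> ((\<lambda>t. r1 t - r2 t) has_real_derivative
    (r1 t + r2 t) * (l1 t - l2 t) + - l3 t * (r1 t - r2 t)) (at t within J)"
  by (rule DERIV_cong[OF DERIV_diff[OF dr1 dr2]]) (auto simp: algebra_simps)

lemma order12_persists:
  assumes sub: "{a..b} \<subseteq> J"
    and m: "\<And>t. t \<in> {a..b} \<Longrightarrow> 0 \<le> r1 t + r2 t - r3 t" "\<And>t. t \<in> {a..b} \<Longrightarrow> 0 \<le> r1 t + r2 t"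
    and init: "l2 a \<le> l1 a" "r2 a \<le> r1 a" and t: "t \<in> {a..b}"
  shows "l2 t \<le> l1 t \<and> r2 t \<le> r1 t"
proof -
  have "0 \<le> l1 t - l2 t \<and> 0 \<le> r1 t - r2 t"
  proof (rule cooperative_nonneg[where u = "\<lambda>t. l1 t - l2 t" and y = "\<lambda>t. r1 t - r2 t" and t = t
        and p = "\<lambda>t. - x t" and m = "\<lambda>t. r1 t + r2 t - r3 t" and n = "\<lambda>t. r1 t + r2 t" and q = "\<lambda>t. - l3 t"])
    show "((\<lambda>t. l1 t - l2 t) has_real_derivative
      - x s * (l1 s - l2 s) + (r1 s + r2 s - r3 s) * (r1 s - r2 s)) (at s within {a..b})" if "s \<in> {a..b}" for s
      using DERIV_subset[OF dl12 sub] that sub by blast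
    show "((\<lambda>t. r1 t - r2 t) has_real_derivative
      (r1 s + r2 s) * (l1 s - l2 s) + - l3 s * (r1 s - r2 s)) (at s within {a..b})" if "s \<in> {a..b}" for s
      using DERIV_subset[OF dr12 sub] that sub by blast
    show "0 \<le> r1 s + r2 s - r3 s" "0 \<le> r1 s + r2 s" if "s \<in> {a..b}" for s
      using m that by auto
  qed (use t init in \<open>auto intro!: continuous_intros cont[THEN continuous_on_subset, OF sub]\<close>)
  then show ?thesis by simp
qed

lemma r1_pos_persists:
  assumes sub: "{a..b} \<subseteq> J" and "0 < r1 a" and t: "t \<in> {a..b}"
  shows "0 < r1 t"
proof (rule pos_persists[where h = r1 and p = "\<lambda>t. l1 t - l2 t - l3 t" and t = t and a = a and b = b])
  show "(r1 has_real_derivative r1 s * (l1 s - l2 s - l3 s)) (at s within {a..b})" if "s \<in> {a..b}" for s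
    using DERIV_subset[OF dr1 sub] that sub by blast
qed (use assms in \<open>auto intro!: continuous_intros cont[THEN continuous_on_subset, OF sub] simp: mult_ac\<close>)

text \<open>The differences solve a homogeneous linear system, so the locus where the indices 1 and
  2 agree is invariant in both time directions. Unlike for the order relations, no sign of the
  coupling is involved.\<close>

lemma equal12_everywhere:
  assumes sub: "{a..b} \<subseteq> J" and c: "c \<in> {a..b}" "l1 c = l2 c" "r1 c = r2 c" and t: "t \<in> {a..b}"
  shows "l1 t = l2 t \<and> r1 t = r2 t"
proof -
  note cs = cont[THEN continuous_on_subset, OF sub]
  \<comment> \<open>The sum of the two coupling coefficients: up to the factor 2 it multiplies the
    mixed term in the derivative of \<open>E\<close>.\<close>
  define m where "m t = (r1 t + r2 t - r3 t) + (r1 t + r2 t)" for t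
  have "continuous_on {a..b} m" unfolding m_def by (intro continuous_intros cs)
  then obtain K1 where K1: "\<And>t. t \<in> {a..b} \<Longrightarrow> \<bar>m t\<bar> \<le> K1" by (rule continuous_on_Icc_bounded) blast
  obtain K2 where K2: "\<And>t. t \<in> {a..b} \<Longrightarrow> \<bar>x t\<bar> \<le> K2" by (rule continuous_on_Icc_bounded[OF cs(1)]) blast
  obtain K3 where K3: "\<And>t. t \<in> {a..b} \<Longrightarrow> \<bar>l3 t\<bar> \<le> K3" by (rule continuous_on_Icc_bounded[OF cs(4)]) blast
  define E where "E t = (l1 t - l2 t)\<^sup>2 + (r1 t - r2 t)\<^sup>2" for t
  have "E t = 0"
  proof (rule energy_vanishes[where E = E and t = t and a = a and b = b and c = c
        and K = "K1 + 2 * K2 + 2 * K3" and E' = "\<lambda>s. 2 * m s * ((l1 s - l2 s) * (r1 s - r2 s))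
          - 2 * x s * (l1 s - l2 s)\<^sup>2 - 2 * l3 s * (r1 s - r2 s)\<^sup>2"])
    fix s assume s: "s \<in> {a..b}"
    let ?D = "l1 s - l2 s" and ?y = "r1 s - r2 s"
    have 1: "((\<lambda>t. l1 t - l2 t) has_real_derivative
      - x s * (l1 s - l2 s) + (r1 s + r2 s - r3 s) * (r1 s - r2 s)) (at s within {a..b})"
      using DERIV_subset[OF dl12 sub] s sub by blast
    have 2: "((\<lambda>t. r1 t - r2 t) has_real_derivative
      (r1 s + r2 s) * (l1 s - l2 s) + - l3 s * (r1 s - r2 s)) (at s within {a..b})"
      using DERIV_subset[OF dr12 sub] s sub by blast
    show "(E has_real_derivative 2 * m s * (?D * ?y) - 2 * x s * ?D\<^sup>2 - 2 * l3 s * ?y\<^sup>2) (at s within {a..b})"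
      unfolding E_def m_def
      by (rule DERIV_cong[OF DERIV_add[OF DERIV_power[OF 1] DERIV_power[OF 2]]])
        (simp add: power2_eq_square algebra_simps)
    have K0: "0 \<le> K1" "0 \<le> K2" "0 \<le> K3" using K1[OF s] K2[OF s] K3[OF s] by linarith+
    have "2 * \<bar>?D * ?y\<bar> \<le> ?D\<^sup>2 + ?y\<^sup>2"
      using sum_squares_bound[of "\<bar>?D\<bar>" "\<bar>?y\<bar>"] by (simp add: abs_mult)
    then have "\<bar>m s\<bar> * (2 * \<bar>?D * ?y\<bar>) \<le> K1 * (?D\<^sup>2 + ?y\<^sup>2)"
      using K1[OF s] K0 by (intro mult_mono) auto
    moreover have "\<bar>x s\<bar> * ?D\<^sup>2 \<le> K2 * ?D\<^sup>2" "\<bar>l3 s\<bar> * ?y\<^sup>2 \<le> K3 * ?y\<^sup>2"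
      using K2[OF s] K3[OF s] by (auto intro: mult_right_mono)
    moreover have "\<bar>2 * m s * (?D * ?y) - 2 * x s * ?D\<^sup>2 - 2 * l3 s * ?y\<^sup>2\<bar>
        \<le> \<bar>m s\<bar> * (2 * \<bar>?D * ?y\<bar>) + 2 * (\<bar>x s\<bar> * ?D\<^sup>2) + 2 * (\<bar>l3 s\<bar> * ?y\<^sup>2)"
    proof -
      have "\<bar>2 * m s * (?D * ?y)\<bar> = \<bar>m s\<bar> * (2 * \<bar>?D * ?y\<bar>)" "\<bar>2 * x s * ?D\<^sup>2\<bar> = 2 * (\<bar>x s\<bar> * ?D\<^sup>2)"
        "\<bar>2 * l3 s * ?y\<^sup>2\<bar> = 2 * (\<bar>l3 s\<bar> * ?y\<^sup>2)" by (simp_all add: abs_mult)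
      then show ?thesis by linarith
    qed
    moreover have "0 \<le> K2 * ?y\<^sup>2" "0 \<le> K3 * ?D\<^sup>2" using K0 by auto
    ultimately show "\<bar>2 * m s * (?D * ?y) - 2 * x s * ?D\<^sup>2 - 2 * l3 s * ?y\<^sup>2\<bar> \<le> (K1 + 2 * K2 + 2 * K3) * E s"
      unfolding E_def by (simp add: algebra_simps)
  qed (use c t in \<open>auto simp: E_def\<close>)
  then show ?thesis by (simp add: E_def sum_power2_eq_zero_iff)
qed

lemmas r2_pos_persists = soliton_flow.r1_pos_persists[OF swap12]
lemmas r3_pos_persists = soliton_flow.r1_pos_persists[OF soliton_flow.swap12[OF swap23]]
lemmas order23_persists = soliton_flow.order12_persists[OF soliton_flow.swap23[OF swap12]]

lemmas equal23_everywhere = soliton_flow.equal12_everywhere[OF soliton_flow.swap23[OF swap12]]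

lemma order13_persists:
  assumes "{a..b} \<subseteq> J"
    and "\<And>t. t \<in> {a..b} \<Longrightarrow> 0 \<le> r1 t + r3 t - r2 t" "\<And>t. t \<in> {a..b} \<Longrightarrow> 0 \<le> r1 t + r3 t"
    and "l3 a \<le> l1 a" "r3 a \<le> r1 a" and "t \<in> {a..b}"
  shows "l3 t \<le> l1 t \<and> r3 t \<le> r1 t"
  using soliton_flow.order12_persists[OF swap23 assms] .

text \<open>Comparing 1 with 2 needs \<open>r3 \<le> r1 + r2\<close>, comparing 1 with 3 needs
  \<open>r2 \<le> r1 + r3\<close>; each follows from the other comparison, and strictly so because
  the \<open>ri\<close> are positive. Strictness keeps both for a short time, and continuous
  induction resolves the mutual dependence.\<close>

lemma dominance1_persists:
  assumes sub: "{a..b} \<subseteq> J"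
    and pos: "\<And>t. t \<in> {a..b} \<Longrightarrow> 0 < r1 t \<and> 0 < r2 t \<and> 0 < r3 t"
    and init: "l2 a \<le> l1 a" "r2 a \<le> r1 a" "l3 a \<le> l1 a" "r3 a \<le> r1 a" and t: "t \<in> {a..b}"
  shows "(l2 t \<le> l1 t \<and> r2 t \<le> r1 t) \<and> l3 t \<le> l1 t \<and> r3 t \<le> r1 t"
proof -
  have c: "continuous_on {a..b} f" if "continuous_on J f" for f :: "real \<Rightarrow> real"
    using that sub by (rule continuous_on_subset)
  define P where "P t \<longleftrightarrow> (l2 t \<le> l1 t \<and> r2 t \<le> r1 t) \<and> l3 t \<le> l1 t \<and> r3 t \<le> r1 t" for t
  have "P t"
  proof (rule real_induction[where a = a and b = b and t = t])
    show "a \<le> b" "a \<le> t" "t \<le> b" using t by auto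
    show "P a" using init by (simp add: P_def)
    show "P s" if s: "a < s" "s \<le> b" "\<And>u. a \<le> u \<Longrightarrow> u < s \<Longrightarrow> P u" for s
    proof -
      have lim: "f s \<le> h s" if "continuous_on J f" "continuous_on J h" "\<And>u. P u \<Longrightarrow> f u \<le> h u"
        for f h :: "real \<Rightarrow> real"
        by (rule continuous_on_le_left_limit[OF c[OF that(1)] c[OF that(2)] s(1,2)]) (use that(3) s(3) in blast)
      have "l2 s \<le> l1 s" "r2 s \<le> r1 s" "l3 s \<le> l1 s" "r3 s \<le> r1 s"
        by (rule lim[OF cont(3,2)] lim[OF cont(6,5)] lim[OF cont(4,2)] lim[OF cont(7,5)]; simp add: P_def)+
      then show ?thesis by (simp add: P_def)
    qed
    fix s assume s: "a \<le> s" "s < b" "\<And>u. a \<le> u \<Longrightarrow> u \<le> s \<Longrightarrow> P u"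
    have Ps: "P s" and sI: "s \<in> {a..b}" using s by auto
    have c12: "continuous_on {a..b} (\<lambda>t. r1 t + r2 t)" and c13: "continuous_on {a..b} (\<lambda>t. r1 t + r3 t)"
      by (intro continuous_intros c cont)+
    obtain d1 where d1: "d1 > 0" "\<forall>u\<in>{a..b}. \<bar>u - s\<bar> < d1 \<longrightarrow> r3 u < r1 u + r2 u"
      using continuous_on_less_right[OF c[OF cont(7)] c12 sI] Ps pos[OF sI] by (auto simp: P_def)
    obtain d2 where d2: "d2 > 0" "\<forall>u\<in>{a..b}. \<bar>u - s\<bar> < d2 \<longrightarrow> r2 u < r1 u + r3 u"
      using continuous_on_less_right[OF c[OF cont(6)] c13 sI] Ps pos[OF sI] by (auto simp: P_def)
    have "P u" if u: "s < u" "u < s + min d1 d2" "u \<le> b" for u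
    proof -
      have su: "{s..u} \<subseteq> J" using sub s u by auto
      have *: "r3 v < r1 v + r2 v \<and> r2 v < r1 v + r3 v \<and> 0 < r1 v \<and> 0 < r2 v \<and> 0 < r3 v"
        if "v \<in> {s..u}" for v
        using d1(2) d2(2) pos[of v] that u s(1,2) by auto
      have "l2 u \<le> l1 u \<and> r2 u \<le> r1 u"
        by (rule order12_persists[OF su]) (use * Ps u(1) in \<open>force simp: P_def\<close>)+
      moreover have "l3 u \<le> l1 u \<and> r3 u \<le> r1 u"
        by (rule order13_persists[OF su]) (use * Ps u(1) in \<open>force simp: P_def\<close>)+
      ultimately show ?thesis by (simp add: P_def)
    qed
    then show "\<exists>\<delta>>0. \<forall>u. s < u \<and> u < s + \<delta> \<and> u \<le> b \<longrightarrow> P u"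
      using d1(1) d2(1) by (intro exI[of _ "min d1 d2"]) auto
  qed
  then show ?thesis by (simp add: P_def)
qed

lemmas dominance2_persists = soliton_flow.dominance1_persists[OF swap12]

definition first_integral :: "real \<Rightarrow> real" where
  "first_integral t = (x t)\<^sup>2 - ((l1 t)\<^sup>2 + (l2 t)\<^sup>2 + (l3 t)\<^sup>2) + ((r1 t)\<^sup>2 + (r2 t)\<^sup>2 + (r3 t)\<^sup>2) / 2
    - r1 t * r2 t - r1 t * r3 t - r2 t * r3 t"

lemma first_integral_derivative: "t \<in> J \<Longrightarrow> (first_integral has_real_derivative 0) (at t within J)"
  unfolding first_integral_def[abs_def]
  by (rule DERIV_cong[OF DERIV_diff[OF DERIV_diff[OF DERIV_diff[OF DERIV_add[OF
      DERIV_diff[OF DERIV_power[OF dx] DERIV_add[OF DERIV_add[OF DERIV_power[OF dl1] DERIV_power[OF dl2]] DERIV_power[OF dl3]]]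
      DERIV_cdivide[OF DERIV_add[OF DERIV_add[OF DERIV_power[OF dr1] DERIV_power[OF dr2]] DERIV_power[OF dr3]]]]
      DERIV_mult[OF dr1 dr2]] DERIV_mult[OF dr1 dr3]] DERIV_mult[OF dr2 dr3]]])
    (auto simp: power2_eq_square field_simps)

lemma first_integral_const:
  assumes "{s..t} \<subseteq> J" "s \<le> t"
  shows "first_integral t = first_integral s"
proof -
  have "\<exists>c. \<forall>u\<in>{s..t}. first_integral u = c"
    by (rule has_field_derivative_zero_constant) (use assms(1) in \<open>auto intro!: DERIV_subset[OF first_integral_derivative assms(1)]\<close>)
  then show ?thesis using assms(2) by auto
qed

text \<open>Geometrically this is \<open>- u'\<close> for the soliton potential u, since \<xi> is
  the sum of the \<open>Li\<close> minus \<open>u'\<close>.\<close>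

definition defect :: "real \<Rightarrow> real" where
  "defect t = x t - l1 t - l2 t - l3 t"

text \<open>The quadratic terms that remain besides \<open>- x t * defect t\<close> add up to the
  first integral. As that is constant along solutions, the equation is linear with constant
  source.\<close>

lemma defect_derivative:
  "t \<in> J \<Longrightarrow> (defect has_real_derivative - x t * defect t + first_integral t) (at t within J)"
  unfolding defect_def[abs_def]
  by (rule DERIV_cong[OF DERIV_diff[OF DERIV_diff[OF DERIV_diff[OF dx dl1] dl2] dl3]])
    (auto simp: first_integral_def power2_eq_square field_simps)

end

section \<open>Solutions emanating from the singular orbit\<close>

text \<open>\<open>J\<close> is any nonempty initial piece of the positive half line, so the same
  results serve finite horizons and global solutions. All information about the singular orbit
  enters through these limits at 0.\<close>

locale bolt_germ = soliton_flow +
  fixes \<alpha> \<beta> \<gamma> :: real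
  assumes J_nonempty: "J \<noteq> {}" and J_pos: "t \<in> J \<Longrightarrow> 0 < t"
    and J_down: "t \<in> J \<Longrightarrow> 0 < s \<Longrightarrow> s \<le> t \<Longrightarrow> s \<in> J"
    and x_germ: "((\<lambda>t. x t - 1 / t) \<longlongrightarrow> 0) (at_right 0)"
    and l1_germ: "((\<lambda>t. l1 t - 1 / t) \<longlongrightarrow> 0) (at_right 0)"
    and l2_germ: "(l2 \<longlongrightarrow> \<gamma>) (at_right 0)"
    and l3_germ: "(l3 \<longlongrightarrow> - \<gamma>) (at_right 0)"
    and r1_germ: "((\<lambda>t. r1 t / t) \<longlongrightarrow> \<beta>) (at_right 0)"
    and r2_germ: "((\<lambda>t. r2 t - 1 / (2 * t)) \<longlongrightarrow> \<gamma>) (at_right 0)"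
    and r3_germ: "((\<lambda>t. r3 t - 1 / (2 * t)) \<longlongrightarrow> - \<gamma>) (at_right 0)"
    and defect_germ: "((\<lambda>t. (x t - l1 t - l2 t - l3 t) / t) \<longlongrightarrow> \<alpha>) (at_right 0)"
begin

lemma Icc_subset: "t \<in> J \<Longrightarrow> 0 < s \<Longrightarrow> {s..t} \<subseteq> J"
  using J_down by auto

lemma Ioc_subset: "t \<in> J \<Longrightarrow> {0<..t} \<subseteq> J"
  using J_down by auto

lemma at_within_J: "t \<in> J \<Longrightarrow> 0 < s \<Longrightarrow> s < t \<Longrightarrow> at s within J = at s"
  by (rule at_within_open_subset[where S = "{0<..<t}"]) (use J_down in auto)

lemma ev_in_J: "\<forall>\<^sub>F t in at_right 0. t \<in> J \<and> at t within J = at t"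
proof -
  obtain b where b: "b \<in> J" using J_nonempty by blast
  have "\<forall>\<^sub>F t in at_right (0::real). t \<in> {0<..<b}"
    by (rule eventually_at_right_real) (rule J_pos[OF b])
  then show ?thesis by eventually_elim (use J_down[OF b] at_within_J[OF b] in auto)
qed

lemma ev_pos: "\<forall>\<^sub>F t in at_right (0::real). 0 < t"
  by (simp add: eventually_at_right_less)

lemma start:
  assumes "\<forall>\<^sub>F s in at_right 0. P s" "t \<in> J"
  obtains \<epsilon> where "0 < \<epsilon>" "\<epsilon> \<le> t" "\<And>s. 0 < s \<Longrightarrow> s \<le> \<epsilon> \<Longrightarrow> P s"
  using eventually_at_right_0_Ioc[OF assms(1) J_pos[OF assms(2)]] by blast

lemma lim_recip: "filterlim (\<lambda>t. 1 / t) at_top (at_right (0::real))"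
  by (simp add: filterlim_inverse_at_top_right flip: inverse_eq_divide)

lemma r23_at_top: "filterlim r2 at_top (at_right 0)" "filterlim r3 at_top (at_right 0)"
proof -
  have h: "filterlim (\<lambda>t. 1 / (2 * t)) at_top (at_right (0::real))"
    using filterlim_tendsto_pos_mult_at_top[OF tendsto_const[of "1/2::real"] _ lim_recip]
    by (simp add: mult.commute)
  show "filterlim r2 at_top (at_right 0)"
    using filterlim_tendsto_add_at_top[OF r2_germ h] by simp
  show "filterlim r3 at_top (at_right 0)"
    using filterlim_tendsto_add_at_top[OF r3_germ h] by simp
qed

lemma l1_at_top: "filterlim l1 at_top (at_right 0)"
  using filterlim_tendsto_add_at_top[OF l1_germ lim_recip] by simp

lemma ev_r23_pos: "\<forall>\<^sub>F t in at_right 0. 0 < r2 t" "\<forall>\<^sub>F t in at_right 0. 0 < r3 t"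
  using r23_at_top by (auto simp: filterlim_at_top_dense)

lemma r2_pos: "t \<in> J \<Longrightarrow> 0 < r2 t"
  by (rule start[OF ev_r23_pos(1)], assumption)
    (rule r2_pos_persists[OF Icc_subset], auto)

lemma r3_pos: "t \<in> J \<Longrightarrow> 0 < r3 t"
  by (rule start[OF ev_r23_pos(2)], assumption)
    (rule r3_pos_persists[OF Icc_subset], auto)

lemma r1_tendsto_0: "(r1 \<longlongrightarrow> 0) (at_right 0)"
proof -
  have "((\<lambda>t. r1 t / t * t) \<longlongrightarrow> \<beta> * 0) (at_right 0)"
    by (intro tendsto_mult r1_germ tendsto_ident_at)
  then have "((\<lambda>t. r1 t / t * t) \<longlongrightarrow> 0) (at_right 0)" by simp
  then show ?thesis by (rule Lim_transform_eventually) (use ev_pos in \<open>eventually_elim, simp\<close>)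
qed

lemma r1_pos:
  assumes "0 < \<beta>" "t \<in> J"
  shows "0 < r1 t"
proof -
  have "\<forall>\<^sub>F t in at_right 0. 0 < r1 t / t" by (rule order_tendstoD(1)[OF r1_germ assms(1)])
  with ev_pos have "\<forall>\<^sub>F t in at_right 0. 0 < r1 t"
    by eventually_elim (simp add: zero_less_divide_iff)
  then obtain \<epsilon> where "0 < \<epsilon>" "\<epsilon> \<le> t" "0 < r1 \<epsilon>" by (rule start[OF _ assms(2)]) blast
  then show ?thesis using r1_pos_persists[OF Icc_subset[OF assms(2)], of \<epsilon> t] by auto
qed

text \<open>The 1 / t in \<open>l1\<close> cancels in the equation for \<open>r1 t / t\<close>,
  whose coefficient \<open>?k\<close> is therefore bounded near 0. Gronwall from times
  \<open>s\<close> tending to 0 makes \<open>r1\<close> vanish at some positive time, and linearity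
  keeps it zero.\<close>

lemma r1_zero:
  assumes \<beta>: "\<beta> = 0" and t: "t \<in> J"
  shows "r1 t = 0"
proof -
  let ?k = "\<lambda>t. (l1 t - 1 / t) - l2 t - l3 t"
  have "(?k \<longlongrightarrow> 0 - \<gamma> - - \<gamma>) (at_right 0)" by (intro tendsto_diff l1_germ l2_germ l3_germ)
  then have "\<forall>\<^sub>F t in at_right 0. dist (?k t) 0 < 1" using tendstoD[of ?k 0 _ 1] by simp
  then obtain \<epsilon> where \<epsilon>: "0 < \<epsilon>" "\<epsilon> \<le> t" "\<And>s. 0 < s \<Longrightarrow> s \<le> \<epsilon> \<Longrightarrow> \<bar>?k s\<bar> < 1"
    by (rule start[OF _ t]) auto
  let ?E = "\<lambda>t. (r1 t / t)\<^sup>2"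
  have bound: "?E \<epsilon> \<le> ?E s * exp (2 * \<epsilon>)" if s: "0 < s" "s \<le> \<epsilon>" for s
  proof -
    have "?E \<epsilon> \<le> ?E s * exp (2 * (\<epsilon> - s))"
    proof (rule gronwall[where f = ?E and a = s and b = \<epsilon> and f' = "\<lambda>t. 2 * ?k t * ?E t"])
      fix u assume u: "u \<in> {s..\<epsilon>}"
      have u0: "0 < u" using u s by auto
      have "(r1 has_real_derivative r1 u * (l1 u - l2 u - l3 u)) (at u within {s..\<epsilon>})"
        using DERIV_subset[OF dr1 Icc_subset] u u0 s \<epsilon> t J_down by (meson atLeastAtMost_iff)
      then have d: "((\<lambda>t. r1 t / t) has_real_derivative ?k u * (r1 u / u)) (at u within {s..\<epsilon>})"
        using u0 by (auto intro!: derivative_eq_intros simp: field_simps)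
      show "(?E has_real_derivative 2 * ?k u * ?E u) (at u within {s..\<epsilon>})"
        by (rule DERIV_cong[OF DERIV_power[OF d]]) (simp add: power2_eq_square)
      show "2 * ?k u * ?E u \<le> 2 * ?E u"
        using \<epsilon>(3)[OF u0] u by (intro mult_right_mono) auto
    qed (use s in auto)
    also have "\<dots> \<le> ?E s * exp (2 * \<epsilon>)" using s by (intro mult_left_mono) auto
    finally show ?thesis .
  qed
  have "?E \<epsilon> \<le> 0"
  proof (rule tendsto_lowerbound)
    have "((\<lambda>s. ?E s * exp (2 * \<epsilon>)) \<longlongrightarrow> \<beta>\<^sup>2 * exp (2 * \<epsilon>)) (at_right 0)"
      by (intro tendsto_intros r1_germ)
    then show "((\<lambda>s. ?E s * exp (2 * \<epsilon>)) \<longlongrightarrow> 0) (at_right 0)" using \<beta> by simp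
    have "\<forall>\<^sub>F s in at_right (0::real). s \<in> {0<..<\<epsilon>}" by (rule eventually_at_right_real[OF \<epsilon>(1)])
    then show "\<forall>\<^sub>F s in at_right 0. ?E \<epsilon> \<le> ?E s * exp (2 * \<epsilon>)"
      by eventually_elim (use bound in auto)
  qed simp
  then have z: "r1 \<epsilon> = 0" using \<epsilon>(1) by (simp add: power2_less_eq_zero_iff)
  have sub: "{\<epsilon>..t} \<subseteq> J" by (rule Icc_subset[OF t \<epsilon>(1)])
  have d: "(r1 has_real_derivative r1 s * (l1 s - l2 s - l3 s)) (at s within {\<epsilon>..t})" if "s \<in> {\<epsilon>..t}" for s
    using DERIV_subset[OF dr1 sub] that sub by blast
  have c: "continuous_on {\<epsilon>..t} (\<lambda>t. l1 t - l2 t - l3 t)"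
    by (intro continuous_intros continuous_on_subset[OF _ sub] cont)
  have "0 \<le> r1 t"
    by (rule nonneg_persists[where h = r1 and t = t, OF d _ c]) (use z \<epsilon> in \<open>auto simp: mult.commute\<close>)
  moreover have "0 \<le> - r1 t"
    by (rule nonneg_persists[where h = "\<lambda>t. - r1 t" and t = t, OF DERIV_minus[OF d] _ c])
      (use z \<epsilon> in \<open>auto simp: mult.commute\<close>)
  ultimately show ?thesis by simp
qed

lemma defect_tendsto_0: "(defect \<longlongrightarrow> 0) (at_right 0)"
proof -
  have "((\<lambda>t. defect t / t * t) \<longlongrightarrow> \<alpha> * 0) (at_right 0)"
    unfolding defect_def by (intro tendsto_mult defect_germ tendsto_ident_at)
  then have "((\<lambda>t. defect t / t * t) \<longlongrightarrow> 0) (at_right 0)" by simp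
  then show ?thesis
    by (rule Lim_transform_eventually) (use ev_pos in \<open>eventually_elim, simp\<close>)
qed

text \<open>A constant source \<open>C\<close> gives the defect the slope \<open>C / 2\<close> at 0,
  while the normalisation of the solution says that this slope is \<alpha>.\<close>

lemma first_integral_eq:
  assumes t: "t \<in> J"
  shows "first_integral t = 2 * \<alpha>"
proof -
  have const: "first_integral s = first_integral t" if "s \<in> J" for s
  proof (cases "s \<le> t")
    case True
    show ?thesis using first_integral_const[OF Icc_subset[OF t J_pos[OF that]] True] by simp
  next
    case False
    then show ?thesis using first_integral_const[OF Icc_subset[OF that J_pos[OF t]]] by simp
  qed
  have "((\<lambda>t. defect t / t) \<longlongrightarrow> first_integral t / 2) (at_right 0)"
  proof (rule singular_linear_slope[OF _ x_germ defect_tendsto_0 tendsto_const])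
    show "\<forall>\<^sub>F s in at_right 0. (defect has_real_derivative - x s * defect s + first_integral t) (at s)"
      using ev_in_J by eventually_elim (metis const defect_derivative)
  qed
  from tendsto_unique[OF trivial_limit_at_right_real this defect_germ[folded defect_def]] show ?thesis by simp
qed

lemma ddefect: "t \<in> J \<Longrightarrow> (defect has_real_derivative - x t * defect t + 2 * \<alpha>) (at t within J)"
  using defect_derivative[of t] first_integral_eq[of t] by simp

lemma nonneg_from_zero:
  assumes t: "t \<in> J"
    and dh: "\<And>s. s \<in> J \<Longrightarrow> (h has_real_derivative h' s) (at s within J)"
    and h': "\<And>s. 0 < s \<Longrightarrow> s \<le> t \<Longrightarrow> - x s * h s \<le> h' s"
    and lim: "(h \<longlongrightarrow> l) (at_right 0)" "0 \<le> l"
  shows "0 \<le> h t"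
proof (rule nonneg_from_singular_time[OF _ _ _ x_germ lim, of t h' t])
  show "(h has_real_derivative h' s) (at s within {0<..t})" if "s \<in> {0<..t}" for s
    using DERIV_subset[OF dh Ioc_subset[OF t]] that Ioc_subset[OF t] by blast
  show "continuous_on {0<..t} x" by (rule continuous_on_subset[OF cont(1) Ioc_subset[OF t]])
qed (use h' J_pos[OF t] in auto)

lemma defect_nonneg: "0 \<le> \<alpha> \<Longrightarrow> t \<in> J \<Longrightarrow> 0 \<le> defect t"
  by (rule nonneg_from_zero[OF _ ddefect _ defect_tendsto_0]) auto

lemma defect_zero:
  assumes "\<alpha> = 0" "t \<in> J"
  shows "defect t = 0"
proof -
  have "0 \<le> - defect t"
    by (rule nonneg_from_zero[where h = "\<lambda>t. - defect t" and l = 0, OF assms(2) DERIV_minus[OF ddefect]])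
      (use assms tendsto_minus[OF defect_tendsto_0] in auto)
  then show ?thesis using defect_nonneg[of t] assms by simp
qed

end

text \<open>For \<gamma> > 0 the limits at 0 separate the indices 2 and 3 strictly. For \<gamma> = 0
  they do not, and order is replaced by equality, which the exchange symmetry supplies for actual
  trajectories.\<close>

locale bolt_flow = bolt_germ +
  assumes \<alpha>_nonneg: "0 \<le> \<alpha>" and \<beta>_pos: "0 < \<beta>"
    and \<gamma>_cases: "0 < \<gamma> \<or> \<gamma> = 0 \<and> (\<forall>t\<in>J. l2 t = l3 t \<and> r2 t = r3 t)"
begin

section \<open>The region between collapse and explosion, and how solutions leave it\<close>

lemmas r_pos = r1_pos[OF \<beta>_pos] r2_pos r3_pos

lemma ev_start: "\<forall>\<^sub>F t in at_right 0. r1 t \<le> r2 t \<and> l2 t \<le> l1 t"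
proof -
  have "\<forall>\<^sub>F t in at_right 0. 1 \<le> r2 t" "\<forall>\<^sub>F t in at_right 0. \<gamma> + 1 \<le> l1 t"
    using r23_at_top l1_at_top by (auto simp: filterlim_at_top)
  moreover have "\<forall>\<^sub>F t in at_right 0. r1 t < 1" "\<forall>\<^sub>F t in at_right 0. l2 t < \<gamma> + 1"
    by (rule order_tendstoD[OF r1_tendsto_0] order_tendstoD[OF l2_germ], simp)+
  ultimately show ?thesis by eventually_elim auto
qed

text \<open>If \<gamma> > 0, both differences are close to 2 \<gamma> near 0, so the order starts
  correctly; \<open>r1 \<le> r2\<close> makes the coupling \<open>r2 + r3 - r1\<close> nonnegative
  and keeps the system for this pair cooperative.\<close>

lemma order23:
  assumes t: "t \<in> J" and le: "\<And>s. 0 < s \<Longrightarrow> s \<le> t \<Longrightarrow> r1 s \<le> r2 s"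
  shows "l3 t \<le> l2 t \<and> r3 t \<le> r2 t"
  using \<gamma>_cases
proof
  assume \<gamma>: "0 < \<gamma>"
  have "((\<lambda>t. l2 t - l3 t) \<longlongrightarrow> \<gamma> - - \<gamma>) (at_right 0)" by (intro tendsto_diff l2_germ l3_germ)
  then have 1: "\<forall>\<^sub>F t in at_right 0. 0 < l2 t - l3 t" by (rule order_tendstoD) (use \<gamma> in simp)
  have "((\<lambda>t. (r2 t - 1 / (2 * t)) - (r3 t - 1 / (2 * t))) \<longlongrightarrow> \<gamma> - - \<gamma>) (at_right 0)"
    by (intro tendsto_diff r2_germ r3_germ)
  then have 2: "\<forall>\<^sub>F t in at_right 0. 0 < (r2 t - 1 / (2 * t)) - (r3 t - 1 / (2 * t))"
    by (rule order_tendstoD) (use \<gamma> in simp)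
  obtain \<epsilon> where \<epsilon>: "0 < \<epsilon>" "\<epsilon> \<le> t"
    "\<And>s. 0 < s \<Longrightarrow> s \<le> \<epsilon> \<Longrightarrow> 0 < l2 s - l3 s \<and> 0 < (r2 s - 1 / (2 * s)) - (r3 s - 1 / (2 * s))"
    by (rule start[OF eventually_conj[OF 1 2] t]) blast
  show ?thesis
  proof (rule order23_persists[OF Icc_subset[OF t \<epsilon>(1)]])
    fix s assume s: "s \<in> {\<epsilon>..t}"
    then have "s \<in> J" "0 < s" using t \<epsilon> J_down by auto
    then show "0 \<le> r2 s + r3 s - r1 s" "0 \<le> r2 s + r3 s" using le[of s] s r_pos[of s] by auto
  qed (use \<epsilon>(2) \<epsilon>(3)[of \<epsilon>] \<epsilon>(1) in auto)
qed (use t in auto)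

lemma \<gamma>_nonneg: "0 \<le> \<gamma>" using \<gamma>_cases by auto

context
  fixes t assumes t: "t \<in> J" and le: "\<And>s. 0 < s \<Longrightarrow> s \<le> t \<Longrightarrow> r1 s \<le> r2 s"
begin

lemma order23': "0 < s \<Longrightarrow> s \<le> t \<Longrightarrow> l3 s \<le> l2 s \<and> r3 s \<le> r2 s"
  by (rule order23) (use J_down[OF t] le in auto)

text \<open>Both \<open>r1\<close> and \<open>r3\<close> lie between 0 and \<open>r2\<close>, hence
  so does their distance, and the source term of \<open>l2\<close> is nonnegative.\<close>

lemma l2_nonneg: "0 \<le> l2 t"
proof (rule nonneg_from_zero[OF t dl2 _ l2_germ \<gamma>_nonneg])
  fix s assume s: "0 < s" "s \<le> t"
  have "s \<in> J" using J_down[OF t s] .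
  then have "\<bar>r3 s - r1 s\<bar> \<le> \<bar>r2 s\<bar>"
    using r_pos[of s] le[OF s] order23'[OF s] by auto
  then have "(r3 s - r1 s)\<^sup>2 \<le> (r2 s)\<^sup>2" by (simp add: abs_le_square_iff)
  then show "- x s * l2 s \<le> - x s * l2 s + (r2 s)\<^sup>2 / 2 - (r3 s - r1 s)\<^sup>2 / 2" by simp
qed

text \<open>The source terms of \<open>l2\<close> and \<open>l3\<close> add up to
  \<open>r1 * (r2 + r3 - r1)\<close>, and \<gamma> cancels in the limit at 0.\<close>

lemma l23_nonneg: "0 \<le> l2 t + l3 t"
proof (rule nonneg_from_zero[where l = 0, OF t DERIV_add[OF dl2 dl3]])
  have "((\<lambda>t. l2 t + l3 t) \<longlongrightarrow> \<gamma> + - \<gamma>) (at_right 0)" by (intro tendsto_add l2_germ l3_germ)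
  then show "((\<lambda>t. l2 t + l3 t) \<longlongrightarrow> 0) (at_right 0)" by simp
  fix s assume s: "0 < s" "s \<le> t"
  have "s \<in> J" using J_down[OF t s] .
  then have "0 \<le> r1 s * (r2 s + r3 s - r1 s)"
    using r_pos[of s] le[OF s] by (intro mult_nonneg_nonneg) auto
  then show "- x s * (l2 s + l3 s) \<le> - x s * l2 s + (r2 s)\<^sup>2 / 2 - (r3 s - r1 s)\<^sup>2 / 2
      + (- x s * l3 s + (r3 s)\<^sup>2 / 2 - (r1 s - r2 s)\<^sup>2 / 2)"
    by (simp add: power2_eq_square field_simps)
qed auto

end

definition good :: "real \<Rightarrow> bool" where
  "good t \<longleftrightarrow> (\<forall>s. 0 < s \<and> s \<le> t \<longrightarrow> r1 s \<le> r2 s \<and> l2 s \<le> l1 s)"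

text \<open>\<open>x\<close> is the sum of the nonnegative quantities \<open>defect\<close>,
  \<open>l1\<close> and \<open>l2 + l3\<close>, so it dominates each of them. With
  \<open>\<bar>l3\<bar> \<le> l2 \<le> l1\<close> it alone controls all the
  \<open>li\<close>.\<close>

lemma good_bounds:
  assumes t: "t \<in> J" and g: "good t"
  shows "r1 t \<le> r2 t" "r3 t \<le> r2 t" "l3 t \<le> l2 t" "l2 t \<le> l1 t" "0 \<le> l2 t" "0 \<le> l2 t + l3 t"
    "defect t \<le> x t" "l1 t \<le> x t" "0 \<le> x t"
proof -
  have le: "r1 s \<le> r2 s" "l2 s \<le> l1 s" if "0 < s" "s \<le> t" for s using g that by (auto simp: good_def)
  show 1: "r1 t \<le> r2 t" "r3 t \<le> r2 t" "l3 t \<le> l2 t" "l2 t \<le> l1 t"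
    using le[of t] J_pos[OF t] order23[OF t le(1)] by auto
  show 2: "0 \<le> l2 t" "0 \<le> l2 t + l3 t" using l2_nonneg[OF t le(1)] l23_nonneg[OF t le(1)] by auto
  show "defect t \<le> x t" "l1 t \<le> x t" "0 \<le> x t"
    using 1 2 defect_nonneg[OF \<alpha>_nonneg t] unfolding defect_def by linarith+
qed

text \<open>At the last good time before an exit one of the two inequalities must be an equality,
  for otherwise continuity would keep both a little longer. The equality that holds decides which
  index dominates from then on.\<close>

lemma exit_cases:
  assumes t: "t \<in> J"
  obtains (stay) "good t"
  | (collapse) \<tau> where "0 < \<tau>" "\<tau> \<le> t" "good \<tau>" "\<And>s. \<tau> \<le> s \<Longrightarrow> s \<le> t \<Longrightarrow> r1 s \<le> r2 s \<and> l1 s \<le> l2 s"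
    "\<And>s. 0 < s \<Longrightarrow> s \<le> t \<Longrightarrow> r1 s \<le> r2 s"
  | (explode) \<tau> where "0 < \<tau>" "\<tau> \<le> t" "good \<tau>" "\<And>s. \<tau> \<le> s \<Longrightarrow> s \<le> t \<Longrightarrow> r2 s \<le> r1 s \<and> l2 s \<le> l1 s"
    "\<And>s. 0 < s \<Longrightarrow> s \<le> t \<Longrightarrow> l2 s \<le> l1 s"
proof -
  obtain \<epsilon> where \<epsilon>: "0 < \<epsilon>" "\<epsilon> \<le> t" "\<And>s. 0 < s \<Longrightarrow> s \<le> \<epsilon> \<Longrightarrow> r1 s \<le> r2 s \<and> l2 s \<le> l1 s"
    by (rule start[OF ev_start t]) blast
  have sub: "{\<epsilon>..t} \<subseteq> J" by (rule Icc_subset[OF t \<epsilon>(1)])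
  have c: "continuous_on {\<epsilon>..t} f" if "continuous_on J f" for f :: "real \<Rightarrow> real"
    using that sub by (rule continuous_on_subset)
  obtain \<tau> where \<tau>: "\<epsilon> \<le> \<tau>" "\<tau> \<le> t" "\<And>s. \<epsilon> \<le> s \<Longrightarrow> s \<le> \<tau> \<Longrightarrow> r1 s \<le> r2 s \<and> l2 s \<le> l1 s"
    "\<tau> = t \<or> (\<forall>\<delta>>0. \<exists>s. \<tau> < s \<and> s < \<tau> + \<delta> \<and> s \<le> t \<and> \<not> (r1 s \<le> r2 s \<and> l2 s \<le> l1 s))"
  proof (rule first_exit[of \<epsilon> t "\<lambda>s. r1 s \<le> r2 s \<and> l2 s \<le> l1 s"])
    show "r1 \<epsilon> \<le> r2 \<epsilon> \<and> l2 \<epsilon> \<le> l1 \<epsilon>" using \<epsilon> by auto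
    show "r1 s \<le> r2 s \<and> l2 s \<le> l1 s"
      if s: "\<epsilon> < s" "s \<le> t" "\<And>u. \<epsilon> \<le> u \<Longrightarrow> u < s \<Longrightarrow> r1 u \<le> r2 u \<and> l2 u \<le> l1 u" for s
      using continuous_on_le_left_limit[OF c[OF cont(5)] c[OF cont(6)] s(1,2)]
        continuous_on_le_left_limit[OF c[OF cont(3)] c[OF cont(2)] s(1,2)] s(3) by blast
  qed (use \<epsilon> in auto)
  have \<tau>J: "\<tau> \<in> J" "0 < \<tau>" "\<tau> \<in> {\<epsilon>..t}" using \<tau> \<epsilon> sub by auto
  have g: "good \<tau>"
    unfolding good_def
  proof (intro allI impI)
    fix s assume "0 < s \<and> s \<le> \<tau>"
    then show "r1 s \<le> r2 s \<and> l2 s \<le> l1 s" using \<epsilon>(3)[of s] \<tau>(3)[of s] by (cases "s \<le> \<epsilon>") auto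
  qed
  note gb = good_bounds[OF \<tau>J(1) g]
  have sub': "{\<tau>..t} \<subseteq> J" by (rule Icc_subset[OF t \<tau>J(2)])
  have pos: "0 < r1 s \<and> 0 < r2 s \<and> 0 < r3 s" "0 < r2 s \<and> 0 < r1 s \<and> 0 < r3 s" if "s \<in> {\<tau>..t}" for s
    using that sub' r_pos[of s] by auto
  show ?thesis
  proof (cases "\<tau> = t")
    case True
    then show ?thesis using g stay by simp
  next
    case False
    then have exits: "\<forall>\<delta>>0. \<exists>s. \<tau> < s \<and> s < \<tau> + \<delta> \<and> s \<le> t \<and> \<not> (r1 s \<le> r2 s \<and> l2 s \<le> l1 s)"
      using \<tau>(4) by simp
    consider "l1 \<tau> = l2 \<tau>" | "r1 \<tau> = r2 \<tau>" | "l2 \<tau> < l1 \<tau>" "r1 \<tau> < r2 \<tau>" using gb by linarith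
    then show ?thesis
    proof cases
      case 1
      \<comment> \<open>Equality of \<open>l1\<close> and \<open>l2\<close>, together with the order
        of 3 below 2 in the region, makes index 2 dominate both others.\<close>
      have *: "r1 s \<le> r2 s \<and> l1 s \<le> l2 s" if "\<tau> \<le> s" "s \<le> t" for s
        using dominance2_persists[OF sub' pos(2), of s] that gb 1 by auto
      have "r1 s \<le> r2 s" if "0 < s" "s \<le> t" for s
        using that g * by (cases "s \<le> \<tau>") (auto simp: good_def)
      then show ?thesis using collapse \<tau>J \<tau>(2) g * by blast
    next
      case 2
      \<comment> \<open>Index 1 inherits dominance over 3 from index 2, through
        \<open>r3 \<le> r2 = r1\<close> and \<open>l3 \<le> l2 \<le> l1\<close>.\<close>
      have *: "r2 s \<le> r1 s \<and> l2 s \<le> l1 s" if "\<tau> \<le> s" "s \<le> t" for s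
        using dominance1_persists[OF sub' pos(1), of s] that gb 2 by auto
      have "l2 s \<le> l1 s" if "0 < s" "s \<le> t" for s
        using that g * by (cases "s \<le> \<tau>") (auto simp: good_def)
      then show ?thesis using explode \<tau>J \<tau>(2) g * by blast
    next
      case 3
      obtain d1 where d1: "d1 > 0" "\<forall>u\<in>{\<epsilon>..t}. \<bar>u - \<tau>\<bar> < d1 \<longrightarrow> l2 u < l1 u"
        using continuous_on_less_right[OF c[OF cont(3)] c[OF cont(2)] \<tau>J(3) 3(1)] by blast
      obtain d2 where d2: "d2 > 0" "\<forall>u\<in>{\<epsilon>..t}. \<bar>u - \<tau>\<bar> < d2 \<longrightarrow> r1 u < r2 u"
        using continuous_on_less_right[OF c[OF cont(5)] c[OF cont(6)] \<tau>J(3) 3(2)] by blast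
      obtain s where s: "\<tau> < s" "s < \<tau> + min d1 d2" "s \<le> t" "\<not> (r1 s \<le> r2 s \<and> l2 s \<le> l1 s)"
        using exits d1(1) d2(1) by (meson min_less_iff_conj)
      then have "l2 s < l1 s" "r1 s < r2 s" using d1(2) d2(2) \<tau>(1) by auto
      then show ?thesis using s(4) by simp
    qed
  qed
qed

text \<open>Seen from the later of the two times, each alternative of \<open>exit_cases\<close>
  preserves one of the two inequalities on the whole interval from 0, so not both can have been
  violated.\<close>

lemma collapse_explode_exclusive:
  assumes "s \<in> J" "s' \<in> J" "l1 s < l2 s" "r2 s' < r1 s'"
  shows False
proof -
  define t where "t = max s s'"
  have t: "t \<in> J" "s \<le> t" "s' \<le> t" using assms(1,2) by (auto simp: t_def max_def)
  have s0: "0 < s" "0 < s'" using assms J_pos by auto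
  show False using t(1)
  proof (cases rule: exit_cases)
    case stay
    then show ?thesis using assms s0 t by (force simp: good_def)
  next
    case (collapse \<tau>)
    show ?thesis using assms(4) collapse(5)[OF s0(2) t(3)] by simp
  next
    case (explode \<tau>)
    show ?thesis using assms(3) explode(5)[OF s0(1) t(2)] by simp
  qed
qed

text \<open>After a collapse \<open>r1 \<le> r2\<close> and \<open>r3 \<le> r2\<close> make the
  source of \<open>l2 - l1\<close> nonnegative. Persistence turns a violation at any time into one
  at the end of the interval, the only place where \<open>reaches\<close> looks.\<close>

lemma collapse_persists:
  assumes t: "t \<in> J" and s: "0 < s" "s \<le> t" and l: "l1 s < l2 s"
  shows "l1 t < l2 t"
  using t
proof (cases rule: exit_cases)
  case stay
  then show ?thesis using l s by (force simp: good_def)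
next
  case (explode \<tau>)
  show ?thesis using l explode(5)[OF s] by simp
next
  case (collapse \<tau>)
  have sub: "{s..t} \<subseteq> J" by (rule Icc_subset[OF t s(1)])
  have s\<tau>: "\<tau> < s" using l s collapse(3) by (force simp: good_def)
  note le = collapse(5)
  have "0 < l2 t - l1 t"
  proof (rule pos_persists[where h = "\<lambda>t. l2 t - l1 t" and a = s and b = t and t = t and p = "\<lambda>t. - x t"])
    fix u assume u: "u \<in> {s..t}"
    then have uJ: "u \<in> J" "0 < u" "u \<le> t" using sub s by auto
    show "((\<lambda>t. l2 t - l1 t) has_real_derivative
        - x u * (l2 u - l1 u) + (r2 u + r1 u - r3 u) * (r2 u - r1 u)) (at u within {s..t})"
      using DERIV_subset[OF soliton_flow.dl12[OF swap12] sub] uJ by simp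
    have "r3 u \<le> r2 u" using order23[OF uJ(1)] le uJ by auto
    then have "0 \<le> (r2 u + r1 u - r3 u) * (r2 u - r1 u)"
      using le[OF uJ(2,3)] r_pos[OF uJ(1)] by (intro mult_nonneg_nonneg) auto
    then show "- x u * (l2 u - l1 u) \<le> - x u * (l2 u - l1 u) + (r2 u + r1 u - r3 u) * (r2 u - r1 u)" by simp
  qed (use l s in \<open>auto intro!: continuous_intros continuous_on_subset[OF cont(1) sub]\<close>)
  then show ?thesis by simp
qed

lemma explode_persists:
  assumes t: "t \<in> J" and s: "0 < s" "s \<le> t" and r: "r2 s < r1 s"
  shows "r2 t < r1 t"
  using t
proof (cases rule: exit_cases)
  case stay
  then show ?thesis using r s by (force simp: good_def)
next
  case (collapse \<tau>)
  show ?thesis using r collapse(5)[OF s] by simp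
next
  case (explode \<tau>)
  have sub: "{s..t} \<subseteq> J" by (rule Icc_subset[OF t s(1)])
  have s\<tau>: "\<tau> < s" using r s explode(3) by (force simp: good_def)
  have "0 < r1 t - r2 t"
  proof (rule pos_persists[where h = "\<lambda>t. r1 t - r2 t" and a = s and b = t and t = t and p = "\<lambda>t. - l3 t"])
    fix u assume u: "u \<in> {s..t}"
    then have uJ: "u \<in> J" "0 < u" "u \<le> t" using sub s by auto
    show "((\<lambda>t. r1 t - r2 t) has_real_derivative
      (r1 u + r2 u) * (l1 u - l2 u) + - l3 u * (r1 u - r2 u)) (at u within {s..t})"
      using DERIV_subset[OF dr12 sub] uJ by simp
    have "0 \<le> (r1 u + r2 u) * (l1 u - l2 u)"
      using explode(4)[of u] s\<tau> u r_pos[OF uJ(1)] by (intro mult_nonneg_nonneg) auto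
    then show "- l3 u * (r1 u - r2 u) \<le> (r1 u + r2 u) * (l1 u - l2 u) + - l3 u * (r1 u - r2 u)" by simp
  qed (use r s in \<open>auto intro!: continuous_intros continuous_on_subset[OF cont(4) sub]\<close>)
  then show ?thesis by simp
qed

end

section \<open>Lifetimes and convergence\<close>

context bolt_flow
begin

lemma mono_within_J:
  assumes "\<And>u. u \<in> J \<Longrightarrow> (f has_real_derivative f' u) (at u within J)"
    and st: "0 < s" "s \<le> t" "t \<in> J" and "\<And>u. s \<le> u \<Longrightarrow> u \<le> t \<Longrightarrow> 0 \<le> f' u"
  shows "f s \<le> f t"
proof (rule nondecreasing_within[where f = f and f' = f' and a = s and b = t and s = s and t = t])
  have sub: "{s..t} \<subseteq> J" by (rule Icc_subset[OF st(3,1)])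
  show "(f has_real_derivative f' u) (at u within {s..t})" if "u \<in> {s..t}" for u
    using DERIV_subset[OF assms(1) sub] sub that by blast
qed (use assms in auto)

lemma x_antimono:
  assumes "0 < s" "s \<le> t" "t \<in> J"
  shows "x t \<le> x s"
proof -
  have "- x s \<le> - x t"
  proof (rule mono_within_J[OF DERIV_minus[OF dx] assms])
    show "0 \<le> - (- ((l1 u)\<^sup>2 + (l2 u)\<^sup>2 + (l3 u)\<^sup>2))" for u
      using zero_le_power2[of "l1 u"] zero_le_power2[of "l2 u"] zero_le_power2[of "l3 u"] by linarith
  qed
  then show ?thesis by simp
qed

lemma good_down: "good t \<Longrightarrow> s \<le> t \<Longrightarrow> good s"
  by (auto simp: good_def)

text \<open>In the region \<open>l2 - l3 - l1 \<le> - l3 \<le> x\<close>, and \<open>x\<close>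
  decreases. As \<open>r2\<close> bounds the other \<open>ri\<close> and \<open>x\<close> bounds the
  \<open>li\<close>, this excludes blow-up there.\<close>

lemma r2_growth:
  assumes t: "t \<in> J" and g: "good t" and T: "0 < T" "T \<le> t"
  shows "r2 t \<le> r2 T * exp (x T * (t - T))"
proof (rule gronwall[where a = T and b = t and f' = "\<lambda>s. r2 s * (l2 s - l3 s - l1 s)" and f = r2 and t = t])
  have sub: "{T..t} \<subseteq> J" by (rule Icc_subset[OF t T(1)])
  fix s assume s: "s \<in> {T..t}"
  then have sJ: "s \<in> J" using sub by auto
  show "(r2 has_real_derivative r2 s * (l2 s - l3 s - l1 s)) (at s within {T..t})"
    using DERIV_subset[OF dr2 sub] sJ s by blast
  have "good s" using good_down[OF g] s by simp
  note gb = good_bounds[OF sJ this]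
  have "x s \<le> x T" using x_antimono[of T s] T s sJ by simp
  then have "l2 s - l3 s - l1 s \<le> x T" using gb by linarith
  then have "r2 s * (l2 s - l3 s - l1 s) \<le> r2 s * x T" by (rule mult_left_mono) (use r_pos[OF sJ] in simp)
  then show "r2 s * (l2 s - l3 s - l1 s) \<le> x T * r2 s" by (simp add: mult.commute)
qed (use T in auto)

lemma ln_ratio_derivative:
  assumes t: "t \<in> J"
  shows "((\<lambda>t. ln (r1 t) - ln (r2 t)) has_real_derivative 2 * (l1 t - l2 t)) (at t within J)"
proof -
  have "((\<lambda>t. ln (r1 t)) has_real_derivative l1 t - l2 t - l3 t) (at t within J)"
    using r_pos[OF t] dr1[OF t] by (auto intro!: derivative_eq_intros)
  moreover have "((\<lambda>t. ln (r2 t)) has_real_derivative l2 t - l3 t - l1 t) (at t within J)"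
    using r_pos[OF t] dr2[OF t] by (auto intro!: derivative_eq_intros)
  ultimately show ?thesis by (rule DERIV_cong[OF DERIV_diff]) simp
qed

end

section \<open>Symmetric solutions, \<gamma> = 0: bounds on the time spent in the region\<close>

locale symmetric_bolt_flow = bolt_flow +
  assumes \<gamma>_zero: "\<gamma> = 0" and sym: "t \<in> J \<Longrightarrow> l3 t = l2 t" "t \<in> J \<Longrightarrow> r3 t = r2 t"
begin

lemma first_integral_sym: "t \<in> J \<Longrightarrow> (x t)\<^sup>2 = (l1 t)\<^sup>2 + 2 * (l2 t)\<^sup>2 - (r1 t)\<^sup>2 / 2 + 2 * r1 t * r2 t + 2 * \<alpha>"
  using first_integral_eq[of t] unfolding first_integral_def by (simp add: sym power2_eq_square field_simps)

text \<open>The source of \<open>l2\<close> is \<open>r1 * r2 - r1\<^sup>2 / 2\<close>, which tends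
  to \<beta> / 2 as \<open>r1\<close> behaves like \<beta> t and \<open>r2\<close> like 1 / (2 t);
  the singular damping halves it once more.\<close>

lemma l2_slope: "((\<lambda>t. l2 t / t) \<longlongrightarrow> \<beta> / 4) (at_right 0)"
proof -
  let ?g = "\<lambda>t. r1 t * r2 t - (r1 t)\<^sup>2 / 2"
  have "((\<lambda>t. (r2 t - 1 / (2 * t)) * t + 1 / 2) \<longlongrightarrow> \<gamma> * 0 + 1 / 2) (at_right 0)"
    by (intro tendsto_intros r2_germ)
  then have "((\<lambda>t. (r2 t - 1 / (2 * t)) * t + 1 / 2) \<longlongrightarrow> 1 / 2) (at_right 0)" by simp
  then have "((\<lambda>t. t * r2 t) \<longlongrightarrow> 1 / 2) (at_right 0)"
    by (rule Lim_transform_eventually) (use ev_pos in \<open>eventually_elim, simp add: field_simps\<close>)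
  then have "((\<lambda>t. (r1 t / t) * (t * r2 t) - (r1 t)\<^sup>2 / 2) \<longlongrightarrow> \<beta> * (1 / 2) - 0\<^sup>2 / 2) (at_right 0)"
    by (intro tendsto_intros r1_germ r1_tendsto_0) auto
  then have "((\<lambda>t. (r1 t / t) * (t * r2 t) - (r1 t)\<^sup>2 / 2) \<longlongrightarrow> \<beta> / 2) (at_right 0)" by simp
  then have g: "(?g \<longlongrightarrow> \<beta> / 2) (at_right 0)"
    by (rule Lim_transform_eventually) (use ev_pos in \<open>eventually_elim, simp\<close>)
  have "((\<lambda>t. l2 t / t) \<longlongrightarrow> \<beta> / 2 / 2) (at_right 0)"
  proof (rule singular_linear_slope[OF _ x_germ _ g])
    show "(l2 \<longlongrightarrow> 0) (at_right 0)" using l2_germ \<gamma>_zero by simp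
    show "\<forall>\<^sub>F t in at_right 0. (l2 has_real_derivative - x t * l2 t + ?g t) (at t)"
      using ev_in_J
    proof eventually_elim
      case (elim t)
      then have d: "(l2 has_real_derivative - x t * l2 t + (r2 t)\<^sup>2 / 2 - (r3 t - r1 t)\<^sup>2 / 2) (at t)"
        using dl2[of t] by simp
      show ?case by (rule DERIV_cong[OF d]) (use elim in \<open>simp add: sym power2_eq_square field_simps\<close>)
    qed
  qed
  then show ?thesis by simp
qed

text \<open>For \<open>\<alpha> = 0\<close> the function \<open>W = r1 / 2 - l2\<close>, which vanishes on the hyperkaehler solution,
  satisfies \<open>W' = (l1 + W) W\<close>; it starts out positive and hence blows up as long as
  \<open>l1\<close> is nonnegative.\<close>
lemma ricci_flat_bounded_lifetime:
  assumes \<alpha>: "\<alpha> = 0" and le: "\<And>t. t \<in> J \<Longrightarrow> r1 t \<le> r2 t"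
  shows ricci_flat_good: "t \<in> J \<Longrightarrow> good t"
    and ricci_flat_W_pos: "t \<in> J \<Longrightarrow> 0 < r1 t / 2 - l2 t"
    and ricci_flat_lifetime: "T \<in> J \<Longrightarrow> t \<in> J \<Longrightarrow> T \<le> t \<Longrightarrow> t \<le> T + r2 T / (2 * (r1 T / 2 - l2 T)\<^sup>2)"
proof -
  define W where "W t = r1 t / 2 - l2 t" for t
  have x_eq: "x t = l1 t + 2 * l2 t" if "t \<in> J" for t
    using defect_zero[OF \<alpha> that] by (simp add: defect_def sym[OF that])
  \<comment> \<open>Inserting \<open>x = l1 + 2 * l2\<close> into the first integral, which is 0
    here, eliminates \<open>x\<close>.\<close>
  have constraint: "r1 t * r2 t = 2 * l1 t * l2 t + (l2 t)\<^sup>2 + (r1 t)\<^sup>2 / 4" if "t \<in> J" for t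
    using first_integral_sym[OF that] unfolding x_eq[OF that] \<alpha> by (simp add: power2_eq_square algebra_simps)
  have dW: "(W has_real_derivative (l1 t + W t) * W t) (at t within J)" if t: "t \<in> J" for t
    unfolding W_def
  proof (rule DERIV_cong[OF DERIV_diff[OF DERIV_cdivide[OF dr1[OF t]] dl2[OF t]]])
    show "r1 t * (l1 t - l2 t - l3 t) / 2 - (- x t * l2 t + (r2 t)\<^sup>2 / 2 - (r3 t - r1 t)\<^sup>2 / 2)
        = (l1 t + (r1 t / 2 - l2 t)) * (r1 t / 2 - l2 t)"
      unfolding x_eq[OF t] sym[OF t] using constraint[OF t]
      by (simp add: power2_eq_square field_simps)
  qed
  \<comment> \<open>At 0 the slope of \<open>r1\<close> is \<beta> and that of \<open>l2\<close> is
    \<beta> / 4, so \<open>W\<close> starts with the positive slope \<beta> / 4.\<close>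
  have "((\<lambda>t. (r1 t / t) / 2 - l2 t / t) \<longlongrightarrow> \<beta> / 2 - \<beta> / 4) (at_right 0)"
    by (intro tendsto_intros r1_germ l2_slope) simp
  then have "\<forall>\<^sub>F t in at_right 0. 0 < (r1 t / t) / 2 - l2 t / t"
    by (rule order_tendstoD) (use \<beta>_pos in simp)
  with ev_pos have ev_W: "\<forall>\<^sub>F t in at_right 0. 0 < W t"
    by eventually_elim (simp add: W_def field_simps)
  have W_pos: "0 < W t" if t: "t \<in> J" for t
  proof -
    obtain \<epsilon> where \<epsilon>: "0 < \<epsilon>" "\<epsilon> \<le> t" "0 < W \<epsilon>" by (rule start[OF ev_W t]) blast
    have sub: "{\<epsilon>..t} \<subseteq> J" by (rule Icc_subset[OF t \<epsilon>(1)])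
    show ?thesis
    proof (rule pos_persists[where a = \<epsilon> and b = t and h = W and t = t and p = "\<lambda>t. l1 t + W t"])
      show "(W has_real_derivative (l1 s + W s) * W s) (at s within {\<epsilon>..t})" if "s \<in> {\<epsilon>..t}" for s
        using DERIV_subset[OF dW sub] sub that by blast
      show "continuous_on {\<epsilon>..t} (\<lambda>t. l1 t + W t)"
        unfolding W_def by (intro continuous_intros continuous_on_subset[OF _ sub] cont) auto
    qed (use \<epsilon> in auto)
  qed
  then show "t \<in> J \<Longrightarrow> 0 < r1 t / 2 - l2 t" by (simp add: W_def)
  have l2_0: "0 \<le> l2 t" if "t \<in> J" for t
    by (rule l2_nonneg[OF that]) (use le J_down[OF that] in auto)
  \<comment> \<open>\<open>W > 0\<close> means \<open>l2 < r1 / 2\<close>; in the constraint,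
    together with \<open>r1 \<le> r2\<close>, this gives \<open>l2\<^sup>2 < l1 * l2\<close>.
    Excluding explosion thus also excludes collapse.\<close>
  have l12: "l2 t < l1 t" if t: "t \<in> J" for t
  proof -
    have "l2 t < r1 t / 2" using W_pos[OF t] by (simp add: W_def)
    then have "(l2 t)\<^sup>2 < (r1 t / 2)\<^sup>2" using l2_0[OF t] by (intro power_strict_mono) auto
    moreover have "r1 t * r1 t \<le> r1 t * r2 t" using le[OF t] r_pos[OF t] by (intro mult_left_mono) auto
    ultimately have "0 < l2 t * (l1 t - l2 t)"
      using constraint[OF t] by (simp add: power2_eq_square algebra_simps)
    then show ?thesis using l2_0[OF t] by (simp add: zero_less_mult_iff)
  qed
  show good_J: "t \<in> J \<Longrightarrow> good t" for t
    unfolding good_def using le l12 J_down by (auto intro: less_imp_le)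
  show "t \<le> T + r2 T / (2 * (r1 T / 2 - l2 T)\<^sup>2)" if T: "T \<in> J" and t: "t \<in> J" "T \<le> t"
  proof -
    have T0: "0 < T" by (rule J_pos[OF T])
    have inJ: "s \<in> J" if "T \<le> s" "s \<le> t" for s using J_down[OF t(1)] that T0 by auto
    have l1_0: "0 \<le> l1 s" if "s \<in> J" for s using l12[OF that] l2_0[OF that] by simp
    have W_mono: "W T \<le> W s" if s: "T \<le> s" "s \<le> t" for s
      by (rule mono_within_J[OF dW T0 s(1) inJ[OF s]])
        (use l1_0 W_pos inJ s in \<open>auto intro!: mult_nonneg_nonneg add_nonneg_nonneg simp: less_imp_le\<close>)
    \<comment> \<open>Linear growth of \<open>W\<close> at rate \<open>(W T)\<^sup>2\<close>
      suffices: \<open>W\<close> is at most \<open>r2 / 2\<close>, and \<open>r2\<close> does not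
      increase because its logarithmic derivative is \<open>- l1\<close>. By the stated time the two
      would have crossed.\<close>
    have "W T - (W T)\<^sup>2 * T \<le> W t - (W T)\<^sup>2 * t"
    proof (rule mono_within_J[where f = "\<lambda>s. W s - (W T)\<^sup>2 * s" and f' = "\<lambda>s. (l1 s + W s) * W s - (W T)\<^sup>2", OF _ T0 t(2,1)])
      show "((\<lambda>s. W s - (W T)\<^sup>2 * s) has_real_derivative (l1 u + W u) * W u - (W T)\<^sup>2) (at u within J)"
        if "u \<in> J" for u by (auto intro!: derivative_eq_intros dW[OF that])
      fix u assume u: "T \<le> u" "u \<le> t"
      have "W T * W T \<le> (l1 u + W u) * W u"
        using W_mono[OF u] l1_0[OF inJ[OF u]] W_pos[OF T] by (intro mult_mono) auto
      then show "0 \<le> (l1 u + W u) * W u - (W T)\<^sup>2" by (simp add: power2_eq_square)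
    qed
    moreover have "- r2 T \<le> - r2 t"
      by (rule mono_within_J[OF DERIV_minus[OF dr2] T0 t(2,1)])
        (use inJ l1_0 r_pos sym in \<open>auto intro!: mult_nonneg_nonpos simp: less_imp_le\<close>)
    moreover have "W t \<le> r2 t / 2" using l2_0[OF t(1)] le[OF t(1)] by (simp add: W_def)
    ultimately have "(W T)\<^sup>2 * (t - T) \<le> r2 T / 2" using W_pos[OF T] by (simp add: algebra_simps)
    then have "t - T \<le> r2 T / 2 / (W T)\<^sup>2" using W_pos[OF T] by (simp add: pos_le_divide_eq mult.commute)
    then show ?thesis by (simp add: W_def)
  qed
qed

text \<open>While \<open>r1\<close> stays small, \<open>ln (r1 / r2) + 2 (l1 - l2)\<close> is nonincreasing, which keeps \<open>r1\<close> small;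
  then \<open>r2\<close> cannot decay, so \<open>l1 - l2\<close> decreases at a definite rate.\<close>
lemma small_r1_bounded_lifetime:
  assumes \<alpha>: "1 / 2 \<le> \<alpha>" and le: "\<And>t. t \<in> J \<Longrightarrow> l2 t \<le> l1 t"
    and T: "T \<in> J" "0 \<le> x T" and small: "2 * r1 T * exp (2 * x T) < r2 T"
  defines "m \<equiv> exp (ln (r2 T) - l1 T - (l1 T - l2 T) / 2)"
  shows small_r1_good: "t \<in> J \<Longrightarrow> good t"
    and small_r1_lifetime: "t \<in> J \<Longrightarrow> T \<le> t \<Longrightarrow>
      t \<le> T + (l1 T - l2 T) / (r1 T / r2 T * m\<^sup>2 / 2)"
proof -
  have T0: "0 < T" by (rule J_pos[OF T(1)])
  have ln_mono: "ln (r1 s) - ln (r2 s) \<le> ln (r1 t) - ln (r2 t)" if st: "0 < s" "s \<le> t" "t \<in> J" for s t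
    by (rule mono_within_J[OF ln_ratio_derivative st]) (use le J_down[OF st(3)] st in auto)
  \<comment> \<open>The exponent \<open>2 * x T\<close> in the hypothesis pays for the term
    \<open>2 * (l1 - l2)\<close> of the monotone quantity at time \<open>T\<close>, since
    \<open>l1 - l2 \<le> x\<close> in the region.\<close>
  have small_ln: "ln (r1 T) - ln (r2 T) + 2 * x T < - ln 2"
  proof -
    have "ln (2 * r1 T * exp (2 * x T)) < ln (r2 T)" using small r_pos[OF T(1)] by (subst ln_less_cancel_iff) auto
    then show ?thesis using r_pos[OF T(1)] by (simp add: ln_mult)
  qed
  have ln_half: "2 * r1 t < r2 t" if "t \<in> J" "ln (r1 t) - ln (r2 t) < - ln 2" for t
  proof -
    have "ln (2 * r1 t) < ln (r2 t)" using that r_pos[OF that(1)] by (simp add: ln_mult)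
    then show ?thesis using r_pos[OF that(1)] by simp
  qed
  have before: "2 * r1 s < r2 s" if s: "0 < s" "s \<le> T" for s
    using ln_half[OF J_down[OF T(1) s]] ln_mono[OF s T(1)] small_ln T(2) by linarith
  \<comment> \<open>The threshold 1 / 2 for \<alpha> comes from here: the first integral gives
    \<open>x\<^sup>2 \<ge> 2 * \<alpha>\<close>, because
    \<open>2 * r1 * r2 \<ge> r1\<^sup>2 / 2\<close> in the region.\<close>
  have x_ge_1: "1 \<le> x t" if t: "t \<in> J" and g: "good t" for t
  proof -
    note gb = good_bounds[OF t g]
    have "r1 t * r1 t \<le> r1 t * r2 t" using gb r_pos[OF t] by (intro mult_left_mono) auto
    then have "1 \<le> (x t)\<^sup>2"
      using first_integral_sym[OF t] \<alpha> zero_le_square[of "l1 t"] zero_le_square[of "l2 t"]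
        zero_le_square[of "r1 t"]
      unfolding power2_eq_square by argo
    then show ?thesis using gb(9) power2_le_imp_le[of 1 "x t"] by simp
  qed
  \<comment> \<open>A bootstrap: the weak inequality up to \<open>t\<close> returns the strict one
    at \<open>t\<close>. The monotone quantity has derivative
    \<open>2 * (1 - x) * (l1 - l2) - 2 * r1 * (r2 - r1)\<close>, and both terms are
    nonpositive.\<close>
  have step: "2 * r1 t < r2 t \<and> good t"
    if t: "t \<in> J" "T \<le> t" and half: "\<And>s. T \<le> s \<Longrightarrow> s \<le> t \<Longrightarrow> 2 * r1 s \<le> r2 s" for t
  proof -
    have le_r: "r1 s \<le> r2 s" if "0 < s" "s \<le> t" for s
      using before[of s] half[of s] r_pos[OF J_down[OF t(1) that]] that by (cases "s \<le> T") auto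
    have g: "good t" unfolding good_def using le_r le J_down[OF t(1)] by auto
    have "- (ln (r1 T) - ln (r2 T) + 2 * (l1 T - l2 T)) \<le> - (ln (r1 t) - ln (r2 t) + 2 * (l1 t - l2 t))"
    proof (rule mono_within_J[OF DERIV_minus[OF DERIV_add[OF ln_ratio_derivative DERIV_cmult[OF dl12]]] T0 t(2,1)])
      fix u assume u: "T \<le> u" "u \<le> t"
      have uJ: "u \<in> J" "0 < u" using J_down[OF t(1)] u T0 by auto
      have "1 \<le> x u" by (rule x_ge_1[OF uJ(1) good_down[OF g u(2)]])
      then have "1 * (l1 u - l2 u) \<le> x u * (l1 u - l2 u)" using le[OF uJ(1)] by (intro mult_right_mono) auto
      moreover have "r1 u * r1 u \<le> r1 u * r2 u"
        using le_r[OF uJ(2) u(2)] r_pos[OF uJ(1)] by (intro mult_left_mono) auto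
      ultimately show "0 \<le> - (2 * (l1 u - l2 u) + 2 * (- x u * (l1 u - l2 u) + (r1 u + r2 u - r3 u) * (r1 u - r2 u)))"
        by (simp add: sym[OF uJ(1)] algebra_simps)
    qed
    moreover have "l1 T - l2 T \<le> x T"
      using good_bounds[OF T(1) good_down[OF g t(2)]] by linarith
    ultimately have "ln (r1 t) - ln (r2 t) < - ln 2" using small_ln le[OF t(1)] by argo
    then show ?thesis using ln_half[OF t(1)] g by blast
  qed
  have half: "2 * r1 t \<le> r2 t" if t: "t \<in> J" "T \<le> t" for t
    using t(2)
  proof (rule real_induction[where t = t])
    have sub: "{T..t} \<subseteq> J" by (rule Icc_subset[OF t(1) T0])
    have c: "continuous_on {T..t} (\<lambda>t. 2 * r1 t)" "continuous_on {T..t} r2"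
      by (intro continuous_intros continuous_on_subset[OF _ sub] cont)+
    show "2 * r1 T \<le> r2 T" using before[of T] T0 by simp
    show "2 * r1 s \<le> r2 s" if s: "T < s" "s \<le> t" "\<And>u. T \<le> u \<Longrightarrow> u < s \<Longrightarrow> 2 * r1 u \<le> r2 u" for s
      by (rule continuous_on_le_left_limit[OF c s])
    fix s assume s: "T \<le> s" "s < t" "\<And>u. T \<le> u \<Longrightarrow> u \<le> s \<Longrightarrow> 2 * r1 u \<le> r2 u"
    have "s \<in> J" using sub s by auto
    then have "2 * r1 s < r2 s" using step[of s] s by blast
    then obtain \<delta> where "\<delta> > 0" "\<forall>u\<in>{T..t}. \<bar>u - s\<bar> < \<delta> \<longrightarrow> 2 * r1 u < r2 u"
      using continuous_on_less_right[OF c, of s] s by auto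
    then show "\<exists>\<delta>>0. \<forall>u. s < u \<and> u < s + \<delta> \<and> u \<le> t \<longrightarrow> 2 * r1 u \<le> r2 u"
      using s by (intro exI[of _ \<delta>]) (auto intro: less_imp_le)
  qed (use t in auto)
  have step': "2 * r1 t < r2 t \<and> good t" if t: "t \<in> J" "T \<le> t" for t
  proof (rule step[OF t])
    show "2 * r1 s \<le> r2 s" if "T \<le> s" "s \<le> t" for s using half[of s] J_down[OF t(1)] that T0 by simp
  qed
  show "good t" if t: "t \<in> J" for t
    using step'[of t] step'[OF T(1)] good_down[of T t] t by (cases "T \<le> t") auto
  show "t \<le> T + (l1 T - l2 T) / (r1 T / r2 T * m\<^sup>2 / 2)" if t: "t \<in> J" "T \<le> t"
  proof -
    have inJ: "s \<in> J" if "T \<le> s" "s \<le> t" for s using J_down[OF t(1)] that T0 by auto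
    define q where "q = r1 T / r2 T"
    have q: "0 < q" using r_pos[OF T(1)] by (simp add: q_def)
    have m: "0 < m" by (simp add: m_def)
    \<comment> \<open>The corrections to \<open>ln r2\<close> make it nondecreasing, with derivative
      \<open>(x - 1) * l1 + x * (l1 - l2) / 2 + r1 * (r2 - 2 * r1) / 2\<close>. Both subtracted
      terms are nonnegative, so the value at \<open>T\<close>, which is \<open>ln m\<close>, bounds
      \<open>ln r2\<close> from below.\<close>
    have r2_ge: "m \<le> r2 s" if s: "T \<le> s" "s \<le> t" for s
    proof -
      have sJ: "s \<in> J" by (rule inJ[OF s])
      have "ln (r2 T) - l1 T - (l1 T - l2 T) / 2 \<le> ln (r2 s) - l1 s - (l1 s - l2 s) / 2"
      proof (rule mono_within_J[OF DERIV_diff[OF DERIV_diff[OF _ dl1] DERIV_cdivide[OF dl12]] T0 s(1) sJ])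
        show "((\<lambda>t. ln (r2 t)) has_real_derivative l2 u - l3 u - l1 u) (at u within J)" if "u \<in> J" for u
          using r_pos[OF that] dr2[OF that] by (auto intro!: derivative_eq_intros)
        fix u assume u: "T \<le> u" "u \<le> s"
        then have uJ: "u \<in> J" using inJ s by auto
        have st: "2 * r1 u < r2 u" "good u" using step'[OF uJ u(1)] by auto
        note gb = good_bounds[OF uJ st(2)]
        have x1: "1 \<le> x u" by (rule x_ge_1[OF uJ st(2)])
        have "1 * l1 u \<le> x u * l1 u" using x1 gb by (intro mult_right_mono) auto
        moreover have "0 \<le> x u * (l1 u - l2 u)" using x1 gb by (intro mult_nonneg_nonneg) auto
        moreover have "r1 u * (2 * r1 u) \<le> r1 u * r2 u" using st r_pos[OF uJ] by (intro mult_left_mono) auto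
        ultimately show "0 \<le> l2 u - l3 u - l1 u - (- x u * l1 u + (r1 u)\<^sup>2 / 2 - (r2 u - r3 u)\<^sup>2 / 2)
            - (- x u * (l1 u - l2 u) + (r1 u + r2 u - r3 u) * (r1 u - r2 u)) / 2"
          by (simp add: sym[OF uJ] power2_eq_square field_simps)
      qed auto
      also have "\<dots> \<le> ln (r2 s)"
        using good_bounds[OF sJ] step'[OF sJ s(1)] by auto
      finally have "ln m \<le> ln (r2 s)" by (simp add: m_def)
      then show ?thesis using m r_pos[OF sJ] by simp
    qed
    have r1_ge: "q * m \<le> r1 s" if s: "T \<le> s" "s \<le> t" for s
    proof -
      have sJ: "s \<in> J" by (rule inJ[OF s])
      have "ln (r1 T / r2 T) \<le> ln (r1 s / r2 s)"
        using ln_mono[OF T0 s(1) sJ] r_pos[OF sJ] r_pos[OF T(1)] by (simp add: ln_div)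
      then have "q \<le> r1 s / r2 s" using r_pos[OF sJ] r_pos[OF T(1)] by (simp add: q_def)
      then have "q * r2 s \<le> r1 s" using r_pos[OF sJ] by (simp add: pos_le_divide_eq)
      moreover have "q * m \<le> q * r2 s" using r2_ge[OF s] q by simp
      ultimately show ?thesis by simp
    qed
    \<comment> \<open>From \<open>r1 \<ge> q * m\<close> and
      \<open>r2 - r1 \<ge> r2 / 2 \<ge> m / 2\<close>, the difference \<open>l1 - l2\<close>
      decreases at least at the rate \<open>q * m\<^sup>2 / 2\<close>, but it has to stay
      nonnegative.\<close>
    have "- (l1 T - l2 T) - (q * m\<^sup>2 / 2) * T \<le> - (l1 t - l2 t) - (q * m\<^sup>2 / 2) * t"
    proof (rule mono_within_J[OF DERIV_diff[OF DERIV_minus[OF dl12] DERIV_cmult_Id] T0 t(2,1)])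
      fix u assume u: "T \<le> u" "u \<le> t"
      have uJ: "u \<in> J" by (rule inJ[OF u])
      have st: "2 * r1 u < r2 u" "good u" using step'[OF uJ u(1)] by auto
      note gb = good_bounds[OF uJ st(2)]
      have "0 \<le> x u * (l1 u - l2 u)" using gb by (intro mult_nonneg_nonneg) auto
      moreover have "(q * m) * (m / 2) \<le> r1 u * (r2 u - r1 u)"
        using r1_ge[OF u] r2_ge[OF u] st q m r_pos[OF uJ] by (intro mult_mono) auto
      ultimately show "0 \<le> - (- x u * (l1 u - l2 u) + (r1 u + r2 u - r3 u) * (r1 u - r2 u)) - q * m\<^sup>2 / 2"
        by (simp add: sym[OF uJ] power2_eq_square algebra_simps)
    qed
    then have "(q * m\<^sup>2 / 2) * (t - T) \<le> l1 T - l2 T"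
      using le[OF t(1)] by (simp add: field_simps)
    then have "t - T \<le> (l1 T - l2 T) / (q * m\<^sup>2 / 2)"
      using q m by (simp add: pos_le_divide_eq mult.commute)
    then show ?thesis by (simp add: q_def)
  qed
qed

end

section \<open>Convergence of solutions that never leave the region\<close>

context bolt_flow
begin

text \<open>The product \<open>r1 * r2\<close> and the quotients \<open>r1 / r2\<close> and
  \<open>r3 / r2\<close> determine all the \<open>ri\<close>, so these three have to converge. Each
  \<open>li\<close> then follows its source by linear relaxation with damping \<open>x\<close>, and
  convergence of \<open>x\<close> forces the limits of the \<open>li\<close> to vanish.\<close>

lemma good_forever_converges:
  assumes J: "J = {0<..}" and \<alpha>: "0 < \<alpha>" and g: "\<And>t. 0 < t \<Longrightarrow> good t"
  obtains X a where "0 < X" "\<And>t. 0 < t \<Longrightarrow> X \<le> x t" "(x \<longlongrightarrow> X) at_top"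
    "(l1 \<longlongrightarrow> 0) at_top" "(l2 \<longlongrightarrow> 0) at_top" "(l3 \<longlongrightarrow> 0) at_top"
    "(r1 \<longlongrightarrow> a) at_top" "(r2 \<longlongrightarrow> a) at_top" "(r3 \<longlongrightarrow> 0) at_top"
proof -
  have inJ: "t \<in> J" if "0 < t" for t using that J by simp
  have at_J: "at t within J = at t" if "0 < t" for t
    by (rule at_within_open) (use that J in auto)
  note gb = good_bounds[OF inJ g]
  have ev_top: "\<forall>\<^sub>F t in at_top. 0 < (t::real)" by (rule eventually_gt_at_top)
  have dx_at: "\<forall>\<^sub>F t in at_top. (x has_real_derivative - ((l1 t)\<^sup>2 + (l2 t)\<^sup>2 + (l3 t)\<^sup>2)) (at t)"
    using ev_top by eventually_elim (use dx[OF inJ] at_J in simp)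

  have t0: "1 \<in> J" by (rule inJ) simp
  have "\<forall>\<^sub>F t in at_right 0. 0 < defect t / t"
    unfolding defect_def by (rule order_tendstoD(1)[OF defect_germ \<alpha>])
  with ev_pos have "\<forall>\<^sub>F t in at_right 0. 0 < defect t"
    by eventually_elim (simp add: zero_less_divide_iff)
  then obtain T where T: "0 < T" "0 < defect T" by (rule start[OF _ t0]) blast
  have xT: "0 < x T" using gb(7)[OF T(1) T(1)] T(2) by simp
  \<comment> \<open>Where \<open>defect\<close> equals \<open>m\<close>, the source
    \<open>2 * \<alpha>\<close> still outweighs the damping because \<open>x \<le> x T\<close>. So
    \<open>m\<close> is a lower barrier for \<open>defect\<close>, which in turn is at most
    \<open>x\<close>.\<close>
  define m where "m = min (defect T) (2 * \<alpha> / x T)"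
  have m: "0 < m" using T(2) xT \<alpha> by (simp add: m_def)
  have x_ge_m: "m \<le> x t" if t: "T \<le> t" for t
  proof -
    have t0: "0 < t" using T t by simp
    have sub: "{T..t} \<subseteq> J" using T J by auto
    have "0 \<le> defect t - m"
    proof (rule nonneg_persists[where h = "\<lambda>t. defect t - m" and a = T and b = t and t = t and p = "\<lambda>t. - x t"])
      fix s assume s: "s \<in> {T..t}"
      then have sJ: "s \<in> J" "0 < s" using sub T by auto
      show "((\<lambda>t. defect t - m) has_real_derivative - x s * defect s + 2 * \<alpha>) (at s within {T..t})"
        using DERIV_diff[OF DERIV_subset[OF ddefect[OF sJ(1)] sub] DERIV_const] by simp
      have "x s * m \<le> x T * (2 * \<alpha> / x T)"
        using x_antimono[OF T(1) _ sJ(1)] s m xT by (intro mult_mono) (auto simp: m_def)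
      then show "- x s * (defect s - m) \<le> - x s * defect s + 2 * \<alpha>" using xT by (simp add: algebra_simps)
    qed (use T t in \<open>auto simp: m_def intro!: continuous_intros continuous_on_subset[OF cont(1) sub]\<close>)
    then show ?thesis using gb(7)[OF t0 t0] by linarith
  qed
  have x_mono: "x t \<le> x s" if "T \<le> s" "s \<le> t" for s t
    by (rule x_antimono) (use that T inJ in auto)
  obtain X where X: "(x \<longlongrightarrow> X) at_top" "m \<le> X" "\<And>t. T \<le> t \<Longrightarrow> X \<le> x t"
    by (rule nonincreasing_tendsto_at_top[OF x_mono x_ge_m]) blast+
  have X0: "0 < X" using m X(2) by simp
  have X_le: "X \<le> x t" if "0 < t" for t
    using X(3)[of t] X(3)[of T] x_antimono[OF that _ inJ[OF T(1)]] by (cases "T \<le> t") auto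

  \<comment> \<open>\<open>r2 / r1\<close> does not increase in the region; its value
    \<open>k + 1\<close> at \<open>T\<close> bounds it afterwards, that is,
    \<open>r2 - r1 \<le> k * r1\<close>.\<close>
  define k where "k = r2 T / r1 T - 1"
  have rT: "0 < r1 T" "0 < r2 T" using r_pos[OF inJ[OF T(1)]] by auto
  have k: "0 \<le> k" using gb(1)[OF T(1) T(1)] rT by (simp add: k_def)
  have ratio: "r2 t \<le> (k + 1) * r1 t" if t: "T \<le> t" for t
  proof -
    have sub: "{T..t} \<subseteq> J" using T J by auto
    have "0 \<le> (k + 1) * r1 t - r2 t"
    proof (rule nonneg_persists[where h = "\<lambda>t. (k + 1) * r1 t - r2 t" and a = T and b = t and t = t and p = "\<lambda>t. - l3 t"])
      fix s assume s: "s \<in> {T..t}"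
      then have sJ: "s \<in> J" "0 < s" using sub T by auto
      show "((\<lambda>t. (k + 1) * r1 t - r2 t) has_real_derivative
          (k + 1) * (r1 s * (l1 s - l2 s - l3 s)) - r2 s * (l2 s - l3 s - l1 s)) (at s within {T..t})"
        by (intro DERIV_diff DERIV_cmult DERIV_subset[OF dr1 sub] DERIV_subset[OF dr2 sub] sJ)
      have "0 \<le> ((k + 1) * r1 s + r2 s) * (l1 s - l2 s)"
        using gb(4)[OF sJ(2) sJ(2)] r_pos[OF sJ(1)] k by (intro mult_nonneg_nonneg add_nonneg_nonneg) auto
      then show "- l3 s * ((k + 1) * r1 s - r2 s)
          \<le> (k + 1) * (r1 s * (l1 s - l2 s - l3 s)) - r2 s * (l2 s - l3 s - l1 s)"
        by (simp add: algebra_simps)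
    qed (use rT t in \<open>auto simp: k_def intro!: continuous_intros continuous_on_subset[OF cont(4) sub]\<close>)
    then show ?thesis by simp
  qed

  \<comment> \<open>The source of \<open>- l3\<close> contains \<open>(r1 - r2)\<^sup>2 / 2\<close>,
    of the wrong sign. That of \<open>k / 2 * (l1 - l2)\<close> compensates it because
    \<open>r2 - r1 \<le> k * (r1 + r2 - r3)\<close>, so \<open>H' \<le> - x * H\<close>, and
    \<open>x \<ge> m\<close> gives the decay rate.\<close>
  define H where "H t = - l3 t + k / 2 * (l1 t - l2 t)" for t
  \<comment> \<open>The height of the barrier \<open>h0 * e t\<close> must be nonnegative for
    \<open>x \<ge> m\<close> to act in the right direction.\<close>
  define h0 where "h0 = max (H T) 0"
  define e where "e t = exp (- m * (t - T))" for t
  have h0: "0 \<le> h0" "H T \<le> h0" by (auto simp: h0_def)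
  have l3_lower: "- l3 t \<le> h0 * e t" if t: "T \<le> t" for t
  proof -
    have sub: "{T..t} \<subseteq> J" using T J by auto
    have t0: "0 < t" using T t by simp
    have "0 \<le> h0 * e t - H t"
    proof (rule nonneg_persists[where h = "\<lambda>t. h0 * e t - H t" and a = T and b = t and t = t and p = "\<lambda>t. - x t"])
      fix s assume s: "s \<in> {T..t}"
      then have sJ: "s \<in> J" "0 < s" "T \<le> s" using sub T by auto
      have de: "(e has_real_derivative - m * e s) (at s within {T..t})"
        unfolding e_def by (auto intro!: derivative_eq_intros)
      show "((\<lambda>t. h0 * e t - H t) has_real_derivative h0 * (- m * e s)
          - (- (- x s * l3 s + (r3 s)\<^sup>2 / 2 - (r1 s - r2 s)\<^sup>2 / 2)
            + k / 2 * (- x s * (l1 s - l2 s) + (r1 s + r2 s - r3 s) * (r1 s - r2 s)))) (at s within {T..t})"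
        unfolding H_def
        by (intro DERIV_diff[OF DERIV_cmult[OF de]] DERIV_add DERIV_minus DERIV_cmult
            DERIV_subset[OF dl3 sub] DERIV_subset[OF dl12 sub] sJ)
      note gs = gb[OF sJ(2) sJ(2)]
      have combine: "B \<le> A"
        if "E2 \<le> E1" "0 \<le> C" "0 \<le> D" "A = B + C + D / 2 + (E1 - E2) / 2" for A B C D E1 E2 :: real
        using that by simp
      have "(r2 s - r1 s) * (r2 s - r1 s) \<le> (k * (r1 s + r2 s - r3 s)) * (r2 s - r1 s)"
      proof (rule mult_right_mono)
        have "k * r1 s \<le> k * (r1 s + r2 s - r3 s)" using gs k by (intro mult_left_mono) auto
        then show "r2 s - r1 s \<le> k * (r1 s + r2 s - r3 s)" using ratio[OF sJ(3)] by (simp add: algebra_simps)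
      qed (use gs in simp)
      moreover have "0 \<le> (x s - m) * (h0 * e s)"
        using x_ge_m[OF sJ(3)] h0 by (intro mult_nonneg_nonneg) (auto simp: e_def)
      moreover have "0 \<le> (r3 s)\<^sup>2" by simp
      moreover have "(h0 * (- m * e s)
          - (- (- x s * l3 s + (r3 s)\<^sup>2 / 2 - (r1 s - r2 s)\<^sup>2 / 2)
            + k / 2 * (- x s * (l1 s - l2 s) + (r1 s + r2 s - r3 s) * (r1 s - r2 s))))
          = - x s * (h0 * e s - H s) + (x s - m) * (h0 * e s) + (r3 s)\<^sup>2 / 2
            + ((k * (r1 s + r2 s - r3 s)) * (r2 s - r1 s) - (r2 s - r1 s) * (r2 s - r1 s)) / 2"
        by (simp add: H_def power2_eq_square field_simps)
      ultimately show "- x s * (h0 * e s - H s) \<le> h0 * (- m * e s)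
          - (- (- x s * l3 s + (r3 s)\<^sup>2 / 2 - (r1 s - r2 s)\<^sup>2 / 2)
            + k / 2 * (- x s * (l1 s - l2 s) + (r1 s + r2 s - r3 s) * (r1 s - r2 s)))"
        by (rule combine)
    qed (use h0 t in \<open>auto simp: e_def intro!: continuous_intros continuous_on_subset[OF cont(1) sub]\<close>)
    moreover have "0 \<le> k / 2 * (l1 t - l2 t)" using k gb(4)[OF t0 t0] by (intro mult_nonneg_nonneg) auto
    ultimately show ?thesis by (simp add: H_def)
  qed

  \<comment> \<open>\<open>r1 * r2\<close> has logarithmic derivative \<open>- 2 * l3\<close>, and
    the exponential factor contributes \<open>- 2 * h0 * e t\<close>; the sum is nonpositive by
    \<open>l3_lower\<close>, and the factor tends to 1.\<close>
  define Z where "Z t = r1 t * r2 t * exp (2 * h0 / m * e t)" for t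
  have Z_mono: "Z t \<le> Z s" if st: "T \<le> s" "s \<le> t" for s t
  proof -
    have "- Z s \<le> - Z t"
    proof (rule mono_within_J[where f = "\<lambda>t. - Z t" and f' = "\<lambda>u. 2 * (r1 u * r2 u * exp (2 * h0 / m * e u)) * (l3 u + h0 * e u)"])
      fix u assume u: "u \<in> J"
      have de: "(e has_real_derivative - m * e u) (at u within J)"
        unfolding e_def by (auto intro!: derivative_eq_intros)
      have "(Z has_real_derivative - (2 * (r1 u * r2 u * exp (2 * h0 / m * e u)) * (l3 u + h0 * e u))) (at u within J)"
        unfolding Z_def using m
        by (auto intro!: derivative_eq_intros dr1[OF u] dr2[OF u] de simp: field_simps)
      from DERIV_minus[OF this]
      show "((\<lambda>t. - Z t) has_real_derivative 2 * (r1 u * r2 u * exp (2 * h0 / m * e u)) * (l3 u + h0 * e u)) (at u within J)"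
        by simp
    next
      fix u assume u: "s \<le> u" "u \<le> t"
      then have "u \<in> J" "T \<le> u" using st T inJ by auto
      then show "0 \<le> 2 * (r1 u * r2 u * exp (2 * h0 / m * e u)) * (l3 u + h0 * e u)"
        using l3_lower[of u] r_pos[of u] by (intro mult_nonneg_nonneg) auto
    qed (use st T inJ in auto)
    then show ?thesis by simp
  qed
  have Z_nonneg: "0 \<le> Z t" if "T \<le> t" for t
  proof -
    have "0 < t" using that T by simp
    then show ?thesis using r_pos[OF inJ, of t] by (simp add: Z_def)
  qed
  obtain Z0 where Z0: "(Z \<longlongrightarrow> Z0) at_top" "0 \<le> Z0"
    by (rule nonincreasing_tendsto_at_top[OF Z_mono Z_nonneg]) blast+
  have e_lim: "(e \<longlongrightarrow> 0) at_top"
    unfolding e_def using m by real_asymp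
  have "((\<lambda>t. Z t * exp (- (2 * h0 / m * e t))) \<longlongrightarrow> Z0 * exp (- (2 * h0 / m * 0))) at_top"
    by (intro tendsto_intros Z0 e_lim)
  then have r12_lim: "((\<lambda>t. r1 t * r2 t) \<longlongrightarrow> Z0) at_top"
    by (simp add: Z_def mult.assoc flip: exp_add)

  define \<rho> where "\<rho> t = r1 t / r2 t" for t
  define \<sigma> where "\<sigma> t = r3 t / r2 t" for t
  have d\<rho>: "(\<rho> has_real_derivative \<rho> t * (2 * (l1 t - l2 t))) (at t within J)" if "t \<in> J" for t
    unfolding \<rho>_def using r_pos[OF that]
    by (auto intro!: derivative_eq_intros dr1[OF that] dr2[OF that] simp: field_simps)
  have d\<sigma>: "(\<sigma> has_real_derivative \<sigma> t * (2 * (l3 t - l2 t))) (at t within J)" if "t \<in> J" for t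
    unfolding \<sigma>_def using r_pos[OF that]
    by (auto intro!: derivative_eq_intros dr3[OF that] dr2[OF that] simp: field_simps)
  have \<rho>_mono: "- \<rho> t \<le> - \<rho> s" if st: "T \<le> s" "s \<le> t" for s t
  proof -
    have "\<rho> s \<le> \<rho> t"
    proof (rule mono_within_J[OF d\<rho>])
      fix u assume u: "s \<le> u" "u \<le> t"
      then have u0: "0 < u" using st T by simp
      show "0 \<le> \<rho> u * (2 * (l1 u - l2 u))"
        using gb(4)[OF u0 u0] r_pos[OF inJ[OF u0]] by (auto simp: \<rho>_def intro!: mult_nonneg_nonneg)
    qed (use st T inJ in auto)
    then show ?thesis by simp
  qed
  have \<rho>_bound: "- 1 \<le> - \<rho> t" if "T \<le> t" for t
  proof -
    have "0 < t" using that T by simp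
    then show ?thesis using gb(1)[of t] r_pos[OF inJ, of t] by (simp add: \<rho>_def)
  qed
  obtain q' where q': "((\<lambda>t. - \<rho> t) \<longlongrightarrow> q') at_top" "- 1 \<le> q'" "\<And>t. T \<le> t \<Longrightarrow> q' \<le> - \<rho> t"
    by (rule nonincreasing_tendsto_at_top[OF \<rho>_mono \<rho>_bound]) blast+
  define q where "q = - q'"
  have q_lim: "(\<rho> \<longlongrightarrow> q) at_top" using tendsto_minus[OF q'(1)] by (simp add: q_def)
  \<comment> \<open>Positivity of \<open>q\<close>, inherited from \<open>\<rho> T\<close> by
    monotonicity, permits the division in the definition of \<open>b\<close> and rules out the root
    \<open>q = 0\<close> at the end.\<close>
  have "0 < \<rho> T" using rT by (simp add: \<rho>_def)
  then have q: "0 < q" "q \<le> 1" using q'(2) q'(3)[of T] by (auto simp: q_def)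
  have \<sigma>_mono: "\<sigma> t \<le> \<sigma> s" if st: "T \<le> s" "s \<le> t" for s t
  proof -
    have "- \<sigma> s \<le> - \<sigma> t"
    proof (rule mono_within_J[OF DERIV_minus[OF d\<sigma>]])
      fix u assume u: "s \<le> u" "u \<le> t"
      then have u0: "0 < u" using st T by simp
      show "0 \<le> - (\<sigma> u * (2 * (l3 u - l2 u)))"
        using gb(3)[OF u0 u0] r_pos[OF inJ[OF u0]]
        by (simp add: \<sigma>_def mult_nonneg_nonpos divide_nonpos_pos)
    qed (use st T inJ in auto)
    then show ?thesis by simp
  qed
  have \<sigma>_bound: "0 \<le> \<sigma> t" "\<sigma> t \<le> 1" if "T \<le> t" for t
  proof -
    have "0 < t" using that T by simp
    then show "0 \<le> \<sigma> t" "\<sigma> t \<le> 1" using gb(2)[of t] r_pos[OF inJ, of t] by (auto simp: \<sigma>_def)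
  qed
  obtain p where p: "(\<sigma> \<longlongrightarrow> p) at_top" "0 \<le> p" "\<And>t. T \<le> t \<Longrightarrow> p \<le> \<sigma> t"
    by (rule nonincreasing_tendsto_at_top[OF \<sigma>_mono \<sigma>_bound(1)]) blast+
  have p1: "p \<le> 1" using p(3)[of T] \<sigma>_bound(2)[of T] by simp
  define b where "b = sqrt (Z0 / q)"
  have b: "0 \<le> b" using Z0(2) q by (simp add: b_def)
  have "((\<lambda>t. sqrt (r1 t * r2 t / \<rho> t)) \<longlongrightarrow> b) at_top"
    unfolding b_def by (intro tendsto_intros r12_lim q_lim) (use q in simp)
  then have r2_lim: "(r2 \<longlongrightarrow> b) at_top"
  proof (rule Lim_transform_eventually)
    show "\<forall>\<^sub>F t in at_top. sqrt (r1 t * r2 t / \<rho> t) = r2 t"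
      using ev_top
    proof eventually_elim
      case (elim t)
      note pos = r_pos[OF inJ[OF elim]]
      then have "r1 t * r2 t / \<rho> t = (r2 t)\<^sup>2" by (simp add: \<rho>_def power2_eq_square)
      then show ?case using pos by simp
    qed
  qed
  have r1_lim: "(r1 \<longlongrightarrow> q * b) at_top"
  proof (rule Lim_transform_eventually[OF tendsto_mult[OF q_lim r2_lim]])
    show "\<forall>\<^sub>F t in at_top. \<rho> t * r2 t = r1 t"
      using ev_top by eventually_elim (use r_pos[OF inJ] in \<open>force simp: \<rho>_def\<close>)
  qed
  have r3_lim: "(r3 \<longlongrightarrow> p * b) at_top"
  proof (rule Lim_transform_eventually[OF tendsto_mult[OF p(1) r2_lim]])
    show "\<forall>\<^sub>F t in at_top. \<sigma> t * r2 t = r3 t"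
      using ev_top by eventually_elim (use r_pos[OF inJ] in \<open>force simp: \<sigma>_def\<close>)
  qed

  have "isCont x t" if "0 < t" for t
    using DERIV_isCont[of x] dx[OF inJ[OF that]] unfolding at_J[OF that] .
  then obtain P where P: "\<And>t. 0 < t \<Longrightarrow> (P has_vector_derivative x t) (at t)"
    using einterval_antiderivative[of 0 \<infinity> x] by (auto simp: zero_ereal_def)
  have dP: "\<forall>\<^sub>F t in at_top. (P has_real_derivative x t) (at t)"
    using ev_top by eventually_elim (use P in \<open>simp add: has_real_derivative_iff_has_vector_derivative\<close>)
  have P_top: "filterlim P at_top at_top"
  proof (rule filterlim_at_top_mono)
    show "filterlim (\<lambda>t. P T + m * (t - T)) at_top at_top" using m by real_asymp
    show "\<forall>\<^sub>F t in at_top. P T + m * (t - T) \<le> P t"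
    proof (rule eventually_at_top_linorderI[of T])
      fix t assume t: "T \<le> t"
      have "P T - m * T \<le> P t - m * t"
      proof (rule mono_within_J[OF DERIV_diff[OF _ DERIV_cmult_Id]])
        show "(P has_real_derivative x u) (at u within J)" if "u \<in> J" for u
          using P[of u] that J by (simp add: has_real_derivative_iff_has_vector_derivative has_vector_derivative_at_within)
        show "0 \<le> x u - m" if "T \<le> u" for u using x_ge_m[OF that] by simp
      qed (use T t inJ in auto)
      then show "P T + m * (t - T) \<le> P t" by (simp add: algebra_simps)
    qed
  qed
  define g1 where "g1 = (q * b)\<^sup>2 / 2 - (b - p * b)\<^sup>2 / 2"
  define g2 where "g2 = b\<^sup>2 / 2 - (p * b - q * b)\<^sup>2 / 2"
  define g3 where "g3 = (p * b)\<^sup>2 / 2 - (q * b - b)\<^sup>2 / 2"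
  have relax: "(l \<longlongrightarrow> g0 / X) at_top"
    if "\<And>t. t \<in> J \<Longrightarrow> (l has_real_derivative - x t * l t + g t - h t) (at t within J)"
      "((\<lambda>t. g t - h t) \<longlongrightarrow> g0) at_top" for l g h :: "real \<Rightarrow> real" and g0
  proof (rule linear_relaxation_limit[OF _ dP P_top X(1) X0 that(2)])
    show "\<forall>\<^sub>F t in at_top. (l has_real_derivative - x t * l t + (g t - h t)) (at t)"
      using ev_top by eventually_elim (use that(1)[OF inJ] at_J in \<open>simp add: algebra_simps\<close>)
  qed
  have l1_lim: "(l1 \<longlongrightarrow> g1 / X) at_top"
    unfolding g1_def by (rule relax[OF dl1]) (auto intro!: tendsto_intros r1_lim r2_lim r3_lim)
  have l2_lim: "(l2 \<longlongrightarrow> g2 / X) at_top"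
    unfolding g2_def by (rule relax[OF dl2]) (auto intro!: tendsto_intros r1_lim r2_lim r3_lim)
  have l3_lim: "(l3 \<longlongrightarrow> g3 / X) at_top"
    unfolding g3_def by (rule relax[OF dl3]) (auto intro!: tendsto_intros r1_lim r2_lim r3_lim)
  \<comment> \<open>Both \<open>x\<close> and its derivative converge, so the latter tends to 0; as
    its limit is minus a sum of squares, every \<open>gi\<close> vanishes.\<close>
  have "- ((g1 / X)\<^sup>2 + (g2 / X)\<^sup>2 + (g3 / X)\<^sup>2) = 0"
    by (rule convergent_derivative_limit_zero[OF dx_at X(1)]) (intro tendsto_intros l1_lim l2_lim l3_lim)
  then have "(g1 / X)\<^sup>2 + (g2 / X)\<^sup>2 + (g3 / X)\<^sup>2 = 0" by simp
  then have "(g1 / X)\<^sup>2 = 0" "(g2 / X)\<^sup>2 = 0" "(g3 / X)\<^sup>2 = 0"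
    using zero_le_power2[of "g1 / X"] zero_le_power2[of "g2 / X"] zero_le_power2[of "g3 / X"] by linarith+
  then have gz: "g1 = 0" "g2 = 0" "g3 = 0" using X0 by auto
  \<comment> \<open>If \<open>b = 0\<close>, all \<open>ri\<close> tend to 0. Otherwise
    \<open>g1 = 0\<close> and \<open>g2 = 0\<close> amount to \<open>q = 1 - p\<close> and
    \<open>(p - q)\<^sup>2 = 1\<close>, whence \<open>q * (q - 1) = 0\<close>.\<close>
  have qpb: "q * b = b \<and> p * b = 0"
  proof (cases "b = 0")
    case False
    then have b0: "b\<^sup>2 \<noteq> 0" by simp
    have "b\<^sup>2 * (q\<^sup>2 - (1 - p)\<^sup>2) = 2 * g1" by (simp add: g1_def power2_eq_square field_simps)
    then have "q\<^sup>2 = (1 - p)\<^sup>2" using gz b0 by simp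
    then have 1: "q = 1 - p" using q p1 by (simp add: power2_eq_iff_nonneg)
    have "b\<^sup>2 * (1 - (p - q)\<^sup>2) = 2 * g2" by (simp add: g2_def power2_eq_square field_simps)
    then have "(p - q)\<^sup>2 = 1" using gz b0 by simp
    then have "q * (q - 1) = 0" unfolding 1 by (simp add: power2_eq_square algebra_simps)
    then have "q = 1" using q by simp
    then show ?thesis using 1 by simp
  qed simp
  show ?thesis
    by (rule that[OF X0 X_le X(1), of b])
      (use l1_lim l2_lim l3_lim r1_lim r2_lim r3_lim gz qpb in simp_all)
qed

end

section \<open>The flow in the parameters\<close>

abbreviation c1 :: "state7 \<Rightarrow> real" where "c1 p \<equiv> fst p"
abbreviation c2 :: "state7 \<Rightarrow> real" where "c2 p \<equiv> fst (snd p)"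
abbreviation c3 :: "state7 \<Rightarrow> real" where "c3 p \<equiv> fst (snd (snd p))"
abbreviation c4 :: "state7 \<Rightarrow> real" where "c4 p \<equiv> fst (snd (snd (snd p)))"
abbreviation c5 :: "state7 \<Rightarrow> real" where "c5 p \<equiv> fst (snd (snd (snd (snd p))))"
abbreviation c6 :: "state7 \<Rightarrow> real" where "c6 p \<equiv> fst (snd (snd (snd (snd (snd p)))))"
abbreviation c7 :: "state7 \<Rightarrow> real" where "c7 p \<equiv> snd (snd (snd (snd (snd (snd p)))))"

abbreviation "along P J w \<equiv> P J (\<lambda>t. c1 (w t)) (\<lambda>t. c2 (w t)) (\<lambda>t. c3 (w t)) (\<lambda>t. c4 (w t))
  (\<lambda>t. c5 (w t)) (\<lambda>t. c6 (w t)) (\<lambda>t. c7 (w t))"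

lemma soliton_rhs_coords:
  "soliton_rhs p =
    (- ((c2 p)\<^sup>2 + (c3 p)\<^sup>2 + (c4 p)\<^sup>2),
     - c1 p * c2 p + (c5 p)\<^sup>2 / 2 - (c6 p - c7 p)\<^sup>2 / 2,
     - c1 p * c3 p + (c6 p)\<^sup>2 / 2 - (c7 p - c5 p)\<^sup>2 / 2,
     - c1 p * c4 p + (c7 p)\<^sup>2 / 2 - (c5 p - c6 p)\<^sup>2 / 2,
     c5 p * (c2 p - c3 p - c4 p), c6 p * (c3 p - c4 p - c2 p), c7 p * (c4 p - c2 p - c3 p))"
  by (cases p) (simp add: soliton_rhs_def)

lemma coords_derivative:
  fixes w :: "real \<Rightarrow> state7"
  assumes "(w has_vector_derivative d) F"
  shows "((\<lambda>t. c1 (w t)) has_real_derivative c1 d) F" "((\<lambda>t. c2 (w t)) has_real_derivative c2 d) F"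
    "((\<lambda>t. c3 (w t)) has_real_derivative c3 d) F" "((\<lambda>t. c4 (w t)) has_real_derivative c4 d) F"
    "((\<lambda>t. c5 (w t)) has_real_derivative c5 d) F" "((\<lambda>t. c6 (w t)) has_real_derivative c6 d) F"
    "((\<lambda>t. c7 (w t)) has_real_derivative c7 d) F"
  unfolding has_real_derivative_iff_has_vector_derivative
  by (intro bounded_linear.has_vector_derivative[OF bounded_linear_fst]
      bounded_linear.has_vector_derivative[OF bounded_linear_snd] assms)+

lemma solves_soliton_flow:
  assumes "solves soliton_rhs w J"
  shows "along soliton_flow J w"
proof -
  have d: "(w has_vector_derivative soliton_rhs (w t)) (at t within J)" if "t \<in> J" for t
    using assms that by (simp add: solves_def)
  show ?thesis
    by unfold_locales (drule d, drule coords_derivative, simp add: soliton_rhs_coords)+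
qed

section \<open>The exchange of the indices 2 and 3\<close>

definition swap23 :: "state7 \<Rightarrow> state7" where
  "swap23 p = (c1 p, c2 p, c4 p, c3 p, c5 p, c7 p, c6 p)"

lemma bounded_linear_swap23: "bounded_linear swap23"
  unfolding swap23_def
  by (intro bounded_linear_Pair bounded_linear_compose[OF bounded_linear_fst]
      bounded_linear_compose[OF bounded_linear_snd] bounded_linear_ident bounded_linear_fst bounded_linear_snd)

lemma swap23_soliton_rhs: "soliton_rhs (swap23 p) = swap23 (soliton_rhs p)"
  by (simp add: soliton_rhs_coords swap23_def power2_commute algebra_simps)

lemma swap23_F_rhs: "F_rhs (swap23 p) = swap23 (F_rhs p)"
  by (cases p) (simp add: F_rhs_def swap23_def Let_def power2_commute algebra_simps)

lemma swap23_change_vars: "change_vars (swap23 p) = swap23 (change_vars p)"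
  by (cases p) (simp add: change_vars_def swap23_def)

text \<open>The exchange maps \<open>sing_part \<gamma>\<close> to
  \<open>sing_part (- \<gamma>)\<close> and keeps the limits defining \<alpha> and \<beta>; being
  linear, it commutes with all derivatives of the smooth remainder.\<close>

lemma phi_solution_swap23:
  assumes "phi_solution T \<alpha> \<beta> \<gamma> w"
  shows "phi_solution T \<alpha> \<beta> (- \<gamma>) (\<lambda>t. swap23 (w t))"
proof -
  note sw = bounded_linear.has_vector_derivative[OF bounded_linear_swap23]
  obtain \<eta> where \<eta>: "C_inf_on \<eta> {0..T}" "\<eta> 0 = 0" "\<And>r. r \<in> {0<..T} \<Longrightarrow> w r = sing_part \<gamma> r + \<eta> r"
    using assms by (auto simp: phi_solution_def)
  obtain D where D: "D 0 = \<eta>"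
    "\<And>k x. x \<in> {0..T} \<Longrightarrow> (D k has_vector_derivative D (Suc k) x) (at x within {0..T})"
    using \<eta>(1) by (auto simp: C_inf_on_def)
  have "C_inf_on (\<lambda>t. swap23 (\<eta> t)) {0..T}"
    unfolding C_inf_on_def
    by (rule exI[of _ "\<lambda>k t. swap23 (D k t)"]) (use D sw in auto)
  moreover have "swap23 (\<eta> 0) = 0" using \<eta>(2) by (simp add: swap23_def zero_prod_def)
  moreover have "swap23 (w r) = sing_part (- \<gamma>) r + swap23 (\<eta> r)" if "r \<in> {0<..T}" for r
    unfolding \<eta>(3)[OF that] by (cases "\<eta> r") (simp add: swap23_def sing_part_def)
  moreover have "((\<lambda>t. swap23 (w t)) has_vector_derivative soliton_rhs (swap23 (w r))) (at r within {0<..T})"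
    if "r \<in> {0<..T}" for r
    using sw assms that by (auto simp: phi_solution_def swap23_soliton_rhs)
  moreover have "((\<lambda>r. (c1 (w r) - c2 (w r) - c4 (w r) - c3 (w r)) / r) \<longlongrightarrow> \<alpha>) (at_right 0)"
    using assms by (simp add: phi_solution_def case_prod_beta algebra_simps)
  moreover have "((\<lambda>r. c5 (w r) / r) \<longlongrightarrow> \<beta>) (at_right 0)"
    using assms by (simp add: phi_solution_def case_prod_beta)
  moreover have "((\<lambda>r. (c4 (w r) - c3 (w r)) / 2) \<longlongrightarrow> - \<gamma>) (at_right 0)"
  proof -
    have "((\<lambda>r. (c3 (w r) - c4 (w r)) / 2) \<longlongrightarrow> \<gamma>) (at_right 0)"
      using assms by (simp add: phi_solution_def case_prod_beta)
    from tendsto_minus[OF this] show ?thesis by (simp add: minus_divide_left)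
  qed
  ultimately show ?thesis
    unfolding phi_solution_def by (auto simp: case_prod_beta swap23_def)
qed

text \<open>\<open>phi_solution\<close> constrains a function only on \<open>{0<..T}\<close>, so it
  survives gluing to a continuation past \<open>T\<close>.\<close>

lemma phi_solution_cong:
  assumes w: "phi_solution T \<alpha> \<beta> \<gamma> w" and T: "0 < T" and eq: "\<And>r. r \<in> {0<..T} \<Longrightarrow> v r = w r"
  shows "phi_solution T \<alpha> \<beta> \<gamma> v"
proof -
  have ev: "\<forall>\<^sub>F r in at_right 0. w r = v r"
  proof -
    have "\<forall>\<^sub>F r in at_right (0::real). r \<in> {0<..<T}" by (rule eventually_at_right_real[OF T])
    then show ?thesis by eventually_elim (simp add: eq)
  qed
  have lim: "((\<lambda>r. f r (v r)) \<longlongrightarrow> l) (at_right 0)" if "((\<lambda>r. f r (w r)) \<longlongrightarrow> l) (at_right 0)"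
    for f :: "real \<Rightarrow> state7 \<Rightarrow> real" and l
    using that by (rule Lim_transform_eventually) (use ev in \<open>eventually_elim, simp\<close>)
  have "(v has_vector_derivative soliton_rhs (v r)) (at r within {0<..T})" if r: "r \<in> {0<..T}" for r
    unfolding eq[OF r]
    by (rule has_vector_derivative_transform[OF r eq]) (use w r in \<open>auto simp: phi_solution_def\<close>)
  moreover have "\<exists>\<eta>. C_inf_on \<eta> {0..T} \<and> \<eta> 0 = 0 \<and> (\<forall>r\<in>{0<..T}. v r = sing_part \<gamma> r + \<eta> r)"
    using w by (auto simp: phi_solution_def eq)
  ultimately show ?thesis
    using w lim[of "\<lambda>r p. case p of (xi, L1, L2, L3, R1, R2, R3) \<Rightarrow> (xi - L1 - L2 - L3) / r"]
      lim[of "\<lambda>r p. case p of (xi, L1, L2, L3, R1, R2, R3) \<Rightarrow> R1 / r"]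
      lim[of "\<lambda>r p. case p of (xi, L1, L2, L3, R1, R2, R3) \<Rightarrow> (L2 - L3) / 2"]
    unfolding phi_solution_def by blast
qed

text \<open>That \<eta> tends to 0 yields the limits of six components; those of
  \<open>r1 t / t\<close> and of the defect are the normalisations by \<beta> and \<alpha>.\<close>

lemma phi_solution_bolt_germ:
  assumes T: "0 < T" "T \<in> J" and J: "\<And>t. t \<in> J \<Longrightarrow> 0 < t" "\<And>s t. t \<in> J \<Longrightarrow> 0 < s \<Longrightarrow> s \<le> t \<Longrightarrow> s \<in> J"
    and w: "phi_solution T \<alpha> \<beta> \<gamma> w" "solves soliton_rhs w J"
  shows "along bolt_germ J w \<alpha> \<beta> \<gamma>"
proof -
  interpret soliton_flow J "\<lambda>t. c1 (w t)" "\<lambda>t. c2 (w t)" "\<lambda>t. c3 (w t)" "\<lambda>t. c4 (w t)"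
    "\<lambda>t. c5 (w t)" "\<lambda>t. c6 (w t)" "\<lambda>t. c7 (w t)"
    by (rule solves_soliton_flow[OF w(2)])
  obtain \<eta> where \<eta>: "C_inf_on \<eta> {0..T}" "\<eta> 0 = 0" "\<And>r. r \<in> {0<..T} \<Longrightarrow> w r = sing_part \<gamma> r + \<eta> r"
    using w(1) by (auto simp: phi_solution_def)
  obtain D where "D 0 = \<eta>"
    "\<forall>k. \<forall>x\<in>{0..T}. (D k has_vector_derivative D (Suc k) x) (at x within {0..T})"
    using \<eta>(1) by (auto simp: C_inf_on_def)
  then have "(\<eta> has_vector_derivative D 1 0) (at 0 within {0..T})"
    using T(1) by (metis One_nat_def atLeastAtMost_iff less_imp_le order_refl)
  then have "continuous (at 0 within {0..T}) \<eta>" by (rule has_vector_derivative_continuous)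
  then have "(\<eta> \<longlongrightarrow> 0) (at_right 0)"
    using \<eta>(2) T(1) by (simp add: continuous_within at_within_Icc_at_right)
  note \<eta>_lim = tendsto_fst[OF this] tendsto_snd[OF this]
  note \<eta>_lims = \<eta>_lim(1) tendsto_fst[OF \<eta>_lim(2)] tendsto_fst[OF tendsto_snd[OF \<eta>_lim(2)]]
    tendsto_fst[OF tendsto_snd[OF tendsto_snd[OF \<eta>_lim(2)]]]
    tendsto_fst[OF tendsto_snd[OF tendsto_snd[OF tendsto_snd[OF tendsto_snd[OF \<eta>_lim(2)]]]]]
    tendsto_snd[OF tendsto_snd[OF tendsto_snd[OF tendsto_snd[OF tendsto_snd[OF \<eta>_lim(2)]]]]]
  have ev: "\<forall>\<^sub>F r in at_right 0. w r = sing_part \<gamma> r + \<eta> r"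
  proof -
    have "\<forall>\<^sub>F r in at_right (0::real). r \<in> {0<..<T}" by (rule eventually_at_right_real[OF T(1)])
    then show ?thesis by eventually_elim (simp add: \<eta>(3))
  qed
  have lim: "(f \<longlongrightarrow> l') (at_right 0)"
    if "(g \<longlongrightarrow> c) (at_right 0)" "\<And>r. w r = sing_part \<gamma> r + \<eta> r \<Longrightarrow> l + g r = f r" "l' = l + c"
    for f g :: "real \<Rightarrow> real" and l l' c
    unfolding that(3)
    by (rule Lim_transform_eventually[OF tendsto_add[OF tendsto_const that(1)]])
      (use ev in eventually_elim, rule that(2))
  show ?thesis
  proof
    show "J \<noteq> {}" using T by auto
    show "((\<lambda>t. c1 (w t) - 1 / t) \<longlongrightarrow> 0) (at_right 0)"
      by (rule lim[where l = 0, OF \<eta>_lims(1)]) (simp_all add: sing_part_def)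
    show "((\<lambda>t. c2 (w t) - 1 / t) \<longlongrightarrow> 0) (at_right 0)"
      by (rule lim[where l = 0, OF \<eta>_lims(2)]) (simp_all add: sing_part_def)
    show "((\<lambda>t. c3 (w t)) \<longlongrightarrow> \<gamma>) (at_right 0)"
      by (rule lim[where l = \<gamma>, OF \<eta>_lims(3)]) (simp_all add: sing_part_def)
    show "((\<lambda>t. c4 (w t)) \<longlongrightarrow> - \<gamma>) (at_right 0)"
      by (rule lim[where l = "- \<gamma>", OF \<eta>_lims(4)]) (simp_all add: sing_part_def)
    show "((\<lambda>t. c5 (w t) / t) \<longlongrightarrow> \<beta>) (at_right 0)"
      using w(1) by (simp add: phi_solution_def case_prod_beta)
    show "((\<lambda>t. c6 (w t) - 1 / (2 * t)) \<longlongrightarrow> \<gamma>) (at_right 0)"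
      by (rule lim[where l = \<gamma>, OF \<eta>_lims(5)]) (simp_all add: sing_part_def)
    show "((\<lambda>t. c7 (w t) - 1 / (2 * t)) \<longlongrightarrow> - \<gamma>) (at_right 0)"
      by (rule lim[where l = "- \<gamma>", OF \<eta>_lims(6)]) (simp_all add: sing_part_def)
    show "((\<lambda>t. (c1 (w t) - c2 (w t) - c3 (w t) - c4 (w t)) / t) \<longlongrightarrow> \<alpha>) (at_right 0)"
      using w(1) by (simp add: phi_solution_def case_prod_beta)
  qed (fact J)+
qed

section \<open>Trajectories: solutions near r = 0 continued past \<open>T\<close>\<close>

locale standing =
  fixes T :: real and \<phi> :: "real \<times> real \<times> real \<Rightarrow> state7"
  assumes standing: "standing_phi T \<phi>"
begin

lemma T_pos: "0 < T" using standing by (simp add: standing_phi_def)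

lemma \<phi>_cont: "continuous_on sphere2 \<phi>" using standing by (simp add: standing_phi_def)

lemma \<phi>_xi: "p \<in> sphere2 \<Longrightarrow> 1 < c1 (\<phi> p)" using standing by (simp add: standing_phi_def)

lemma phi_solution_ex: "(\<alpha>, \<beta>, \<gamma>) \<in> sphere2 \<Longrightarrow> \<exists>w. phi_solution T \<alpha> \<beta> \<gamma> w"
  using standing by (simp add: standing_phi_def)

lemma phi_solution_at_T: "(\<alpha>, \<beta>, \<gamma>) \<in> sphere2 \<Longrightarrow> phi_solution T \<alpha> \<beta> \<gamma> w \<Longrightarrow> w T = \<phi> (\<alpha>, \<beta>, \<gamma>)"
  using standing by (simp add: standing_phi_def)

lemma \<phi>_swap23:
  assumes "(\<alpha>, \<beta>, \<gamma>) \<in> sphere2"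
  shows "\<phi> (\<alpha>, \<beta>, - \<gamma>) = swap23 (\<phi> (\<alpha>, \<beta>, \<gamma>))"
proof -
  obtain w where w: "phi_solution T \<alpha> \<beta> \<gamma> w" using phi_solution_ex[OF assms] by blast
  have "(\<alpha>, \<beta>, - \<gamma>) \<in> sphere2" using assms by (simp add: sphere2_def)
  from phi_solution_at_T[OF this phi_solution_swap23[OF w]] phi_solution_at_T[OF assms w]
  show ?thesis by simp
qed

fun trajectory :: "real \<times> real \<times> real \<Rightarrow> real set \<Rightarrow> (real \<Rightarrow> state7) \<Rightarrow> bool" where
  "trajectory (\<alpha>, \<beta>, \<gamma>) S w \<longleftrightarrow> phi_solution T \<alpha> \<beta> \<gamma> w \<and> solves soliton_rhs w ({0<..T} \<union> S)"

definition admissible :: "real \<times> real \<times> real \<Rightarrow> bool" where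
  "admissible p \<longleftrightarrow> p \<in> sphere2 \<and> 0 \<le> fst p \<and> 0 < fst (snd p) \<and> 0 \<le> snd (snd p)"

lemma trajectory_ex:
  assumes p: "p \<in> sphere2" and u: "solves soliton_rhs u S" "u T = \<phi> p" and S: "T \<in> S" "S \<subseteq> {T..}"
  obtains w where "trajectory p S w" "\<And>t. t \<in> S \<Longrightarrow> w t = u t"
proof -
  obtain \<alpha> \<beta> \<gamma> where p_eq: "p = (\<alpha>, \<beta>, \<gamma>)" by (cases p) auto
  obtain v where v: "phi_solution T \<alpha> \<beta> \<gamma> v" using phi_solution_ex p p_eq by blast
  have vT: "v T = u T" using phi_solution_at_T[OF _ v] p p_eq u(2) by simp
  have v_solves: "solves soliton_rhs v {0<..T}" using v by (simp add: phi_solution_def solves_def)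
  define w where "w t = (if t \<in> {0<..T} then v t else u t)" for t
  have "solves soliton_rhs w ({0<..T} \<union> S)"
    unfolding w_def by (rule solves_append[OF v_solves u(1) S T_pos vT])
  moreover have "phi_solution T \<alpha> \<beta> \<gamma> w" by (rule phi_solution_cong[OF v T_pos]) (simp add: w_def)
  moreover have "w t = u t" if "t \<in> S" for t
    using that S vT by (cases "t = T") (auto simp: w_def)
  ultimately show ?thesis using that p_eq by simp
qed

lemma trajectory_at_T: "p \<in> sphere2 \<Longrightarrow> trajectory p S w \<Longrightarrow> w T = \<phi> p"
  by (cases p) (auto intro: phi_solution_at_T)

lemma trajectory_solves: "trajectory p S w \<Longrightarrow> solves soliton_rhs w ({0<..T} \<union> S)"
  by (cases p) auto

lemma bolt_germ_trajectory:
  assumes "trajectory p S w" and S: "S = {T..} \<or> (\<exists>b\<ge>T. S = {T..b})"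
  shows "along bolt_germ ({0<..T} \<union> S) w (fst p) (fst (snd p)) (snd (snd p))"
proof -
  obtain \<alpha> \<beta> \<gamma> where p_eq: "p = (\<alpha>, \<beta>, \<gamma>)" by (cases p) auto
  have "phi_solution T \<alpha> \<beta> \<gamma> w" "solves soliton_rhs w ({0<..T} \<union> S)" using assms(1) p_eq by auto
  then show ?thesis unfolding p_eq fst_conv snd_conv
    by (intro phi_solution_bolt_germ[OF T_pos]) (use S T_pos in auto)
qed

text \<open>For \<gamma> = 0 uniqueness of the value at \<open>T\<close> makes
  \<open>\<phi> p\<close> a fixed point of the exchange. Invariance of the locus where the indices 2
  and 3 agree carries this backwards towards the singular time and forwards along
  \<open>S\<close>.\<close>

lemma trajectory_symmetric:
  assumes p: "p \<in> sphere2" "snd (snd p) = 0" and w: "trajectory p S w"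
    and S: "S = {T..} \<or> (\<exists>b\<ge>T. S = {T..b})" and t: "t \<in> {0<..T} \<union> S"
  shows "c4 (w t) = c3 (w t) \<and> c7 (w t) = c6 (w t)"
proof -
  interpret bolt_germ "{0<..T} \<union> S" "\<lambda>t. c1 (w t)" "\<lambda>t. c2 (w t)" "\<lambda>t. c3 (w t)" "\<lambda>t. c4 (w t)"
    "\<lambda>t. c5 (w t)" "\<lambda>t. c6 (w t)" "\<lambda>t. c7 (w t)" "fst p" "fst (snd p)" "snd (snd p)"
    by (rule bolt_germ_trajectory[OF w S])
  obtain \<alpha> \<beta> where p_eq: "p = (\<alpha>, \<beta>, 0)" using p(2) by (cases p) auto
  have "\<phi> p = swap23 (\<phi> p)" using \<phi>_swap23[of \<alpha> \<beta> 0] p(1) p_eq by simp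
  then have "w T = swap23 (w T)" using trajectory_at_T[OF p(1) w] by simp
  then have eq: "c4 (w T) = c3 (w T)" "c7 (w T) = c6 (w T)"
    unfolding swap23_def by (metis fst_conv snd_conv)+
  have "{min t T..max t T} \<subseteq> {0<..T} \<union> S" using S t T_pos by auto
  from equal23_everywhere[OF this, of T t] eq
  have "c3 (w t) = c4 (w t) \<and> c6 (w t) = c7 (w t)" by (auto simp: min_def max_def)
  then show ?thesis by simp
qed

lemma bolt_flow_trajectory:
  assumes p: "admissible p" and w: "trajectory p S w" and S: "S = {T..} \<or> (\<exists>b\<ge>T. S = {T..b})"
  shows "along bolt_flow ({0<..T} \<union> S) w (fst p) (fst (snd p)) (snd (snd p))"
proof -
  interpret bolt_germ "{0<..T} \<union> S" "\<lambda>t. c1 (w t)" "\<lambda>t. c2 (w t)" "\<lambda>t. c3 (w t)" "\<lambda>t. c4 (w t)"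
    "\<lambda>t. c5 (w t)" "\<lambda>t. c6 (w t)" "\<lambda>t. c7 (w t)" "fst p" "fst (snd p)" "snd (snd p)"
    by (rule bolt_germ_trajectory[OF w S])
  show ?thesis
  proof
    show "0 < snd (snd p) \<or> snd (snd p) = 0 \<and> (\<forall>t\<in>{0<..T} \<union> S. c3 (w t) = c4 (w t) \<and> c6 (w t) = c7 (w t))"
    proof (cases "snd (snd p) = 0")
      case True
      then show ?thesis using trajectory_symmetric[OF _ True w S] p by (simp add: admissible_def)
    qed (use p in \<open>auto simp: admissible_def\<close>)
  qed (use p in \<open>auto simp: admissible_def\<close>)
qed

lemma symmetric_bolt_flow_trajectory:
  assumes p: "admissible p" "snd (snd p) = 0" and w: "trajectory p S w" and S: "S = {T..} \<or> (\<exists>b\<ge>T. S = {T..b})"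
  shows "along symmetric_bolt_flow ({0<..T} \<union> S) w (fst p) (fst (snd p)) (snd (snd p))"
proof -
  interpret bolt_flow "{0<..T} \<union> S" "\<lambda>t. c1 (w t)" "\<lambda>t. c2 (w t)" "\<lambda>t. c3 (w t)" "\<lambda>t. c4 (w t)"
    "\<lambda>t. c5 (w t)" "\<lambda>t. c6 (w t)" "\<lambda>t. c7 (w t)" "fst p" "fst (snd p)" "snd (snd p)"
    by (rule bolt_flow_trajectory[OF p(1) w S])
  show ?thesis
    by unfold_locales (use p trajectory_symmetric[OF _ p(2) w S] in \<open>auto simp: admissible_def\<close>)
qed

section \<open>Collapse and explosion as open conditions on the parameters\<close>

definition reaches :: "state7 set \<Rightarrow> real \<times> real \<times> real \<Rightarrow> bool" where
  "reaches U p \<longleftrightarrow> (\<exists>b w. T \<le> b \<and> trajectory p {T..b} w \<and> w b \<in> U)"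

definition collapsing :: "state7 set" where "collapsing = {z. c2 z < c3 z}"

definition exploding :: "state7 set" where "exploding = {z. c6 z < c5 z}"

lemma open_collapsing: "open collapsing" and open_exploding: "open exploding"
  unfolding collapsing_def exploding_def by (intro open_Collect_less continuous_intros)+

text \<open>Being in \<open>U\<close> at time \<open>b\<close> survives a small change of the value
  at \<open>T\<close> by continuous dependence, and that value depends continuously on the point of
  the sphere.\<close>

lemma reaches_open:
  assumes U: "open U" and p: "p \<in> sphere2" "reaches U p"
  obtains d where "0 < d" "\<And>p'. p' \<in> sphere2 \<Longrightarrow> dist p' p < d \<Longrightarrow> reaches U p'"
proof -
  obtain b w where w: "T \<le> b" "trajectory p {T..b} w" "w b \<in> U" using p(2) by (auto simp: reaches_def)
  obtain e where e: "0 < e" "\<And>z. dist z (w b) < e \<Longrightarrow> z \<in> U" using U w(3) by (auto simp: open_dist)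
  have ws: "solves soliton_rhs w {T..b}" by (rule solves_subset[OF trajectory_solves[OF w(2)]]) auto
  obtain d where d: "0 < d"
    "\<And>y. dist y (w T) < d \<Longrightarrow> \<exists>u. u T = y \<and> solves soliton_rhs u {T..b} \<and> dist (u b) (w b) < e"
    by (rule solves_continuous_dependence[OF soliton_rhs_lipschitz ws w(1) e(1)]) blast
  obtain d' where d': "0 < d'" "\<And>p'. p' \<in> sphere2 \<Longrightarrow> dist p' p < d' \<Longrightarrow> dist (\<phi> p') (\<phi> p) < d"
    using \<phi>_cont p(1) d(1) unfolding continuous_on_iff by blast
  have "reaches U p'" if p': "p' \<in> sphere2" "dist p' p < d'" for p'
  proof -
    have "dist (\<phi> p') (w T) < d" using d'(2)[OF p'] trajectory_at_T[OF p(1) w(2)] by simp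
    then obtain u where u: "u T = \<phi> p'" "solves soliton_rhs u {T..b}" "dist (u b) (w b) < e" using d(2) by blast
    obtain v where "trajectory p' {T..b} v" "\<And>t. t \<in> {T..b} \<Longrightarrow> v t = u t"
      by (rule trajectory_ex[OF p'(1) u(2,1)]) (use w(1) in auto)
    then show ?thesis unfolding reaches_def using w(1) e(2)[OF u(3)] by force
  qed
  then show ?thesis using d'(1) that by blast
qed

lemma trajectory_unique:
  assumes p: "p \<in> sphere2" and w: "trajectory p {T..b} w" "trajectory p {T..b'} w'" and t: "T \<le> t" "t \<le> b" "t \<le> b'"
  shows "w t = w' t"
proof (rule solves_unique[OF soliton_rhs_lipschitz, of w T t w'])
  show "solves soliton_rhs w {T..t}" "solves soliton_rhs w' {T..t}"
    by (rule solves_subset[OF trajectory_solves[OF w(1)]] solves_subset[OF trajectory_solves[OF w(2)]];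
        use t in auto)+
qed (use t trajectory_at_T[OF p w(1)] trajectory_at_T[OF p w(2)] in auto)

lemma reaches_exclusive:
  assumes p: "admissible p" and A: "reaches collapsing p" and B: "reaches exploding p"
  shows False
proof -
  have ps: "p \<in> sphere2" using p by (simp add: admissible_def)
  obtain b w where w: "T \<le> b" "trajectory p {T..b} w" "c2 (w b) < c3 (w b)"
    using A by (auto simp: reaches_def collapsing_def)
  obtain b' w' where w': "T \<le> b'" "trajectory p {T..b'} w'" "c6 (w' b') < c5 (w' b')"
    using B by (auto simp: reaches_def exploding_def)
  show False
  proof (cases "b \<le> b'")
    case True
    have "w b = w' b" by (rule trajectory_unique[OF ps w(2) w'(2)]) (use True w w' in auto)
    then show ?thesis
      using bolt_flow.collapse_explode_exclusive[OF bolt_flow_trajectory[OF p w'(2)], of b b'] w w' True by auto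
  next
    case False
    have "w b' = w' b'" by (rule trajectory_unique[OF ps w(2) w'(2)]) (use False w w' in auto)
    then show ?thesis
      using bolt_flow.collapse_explode_exclusive[OF bolt_flow_trajectory[OF p w(2)], of b b'] w w' False by auto
  qed
qed

text \<open>A strict violation at any time persists to the end of the interval, where it would
  witness \<open>reaches\<close>.\<close>

lemma not_collapsing_le:
  assumes p: "admissible p" "\<not> reaches collapsing p" and w: "trajectory p {T..b} w" and b: "T \<le> b"
    and s: "s \<in> {0<..T} \<union> {T..b}"
  shows "c3 (w s) \<le> c2 (w s)"
proof (rule ccontr)
  assume "\<not> ?thesis"
  then have "c2 (w b) < c3 (w b)"
    using bolt_flow.collapse_persists[OF bolt_flow_trajectory[OF p(1) w], of b s] b s T_pos by auto
  then show False using p(2) w b by (auto simp: reaches_def collapsing_def)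
qed

lemma not_exploding_le:
  assumes p: "admissible p" "\<not> reaches exploding p" and w: "trajectory p {T..b} w" and b: "T \<le> b"
    and s: "s \<in> {0<..T} \<union> {T..b}"
  shows "c5 (w s) \<le> c6 (w s)"
proof (rule ccontr)
  assume "\<not> ?thesis"
  then have "c6 (w b) < c5 (w b)"
    using bolt_flow.explode_persists[OF bolt_flow_trajectory[OF p(1) w], of b s] b s T_pos by auto
  then show False using p(2) w b by (auto simp: reaches_def exploding_def)
qed

lemma norm_state7_le: "norm (p :: state7) \<le> \<bar>c1 p\<bar> + \<bar>c2 p\<bar> + \<bar>c3 p\<bar> + \<bar>c4 p\<bar> + \<bar>c5 p\<bar> + \<bar>c6 p\<bar> + \<bar>c7 p\<bar>"
proof -
  obtain a b c d e f g where p: "p = (a, b, c, d, e, f, g)" by (cases p) auto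
  have "norm p \<le> norm a + (norm b + (norm c + (norm d + (norm e + (norm f + norm g)))))"
    unfolding p by (intro order.trans[OF norm_Pair_le] add_mono order_refl)
  then show ?thesis by (simp add: p)
qed

text \<open>A form of \<open>good\<close> that presupposes no instance of \<open>bolt_flow\<close>,
  so that it can be assumed for all horizons at once.\<close>

definition ordered_until :: "real \<Rightarrow> (real \<Rightarrow> state7) \<Rightarrow> bool" where
  "ordered_until b w \<longleftrightarrow> (\<forall>s. 0 < s \<and> s \<le> b \<longrightarrow> c5 (w s) \<le> c6 (w s) \<and> c3 (w s) \<le> c2 (w s))"

lemma good_extends:
  assumes p: "admissible p"
    and good: "\<And>b w. T \<le> b \<Longrightarrow> trajectory p {T..b} w \<Longrightarrow> ordered_until b w"
    and b: "T \<le> b"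
  obtains u where "u T = \<phi> p" "solves soliton_rhs u {T..b}"
proof -
  have ps: "p \<in> sphere2" using p by (simp add: admissible_def)
  define X where "X = c1 (\<phi> p)"
  define R where "R = c6 (\<phi> p) * exp (X * (b - T))"
  \<comment> \<open>\<open>4 * X\<close> accounts for \<open>x\<close> and the \<open>li\<close>,
    \<open>3 * R\<close> for the \<open>ri\<close>; \<open>R\<close> uses the full length
    \<open>b - T\<close>, which makes the bound independent of \<open>c\<close>.\<close>
  have "norm (u c) \<le> 4 * X + 3 * R"
    if c: "T \<le> c" "c \<le> b" and u: "u T = \<phi> p" "solves soliton_rhs u {T..c}" for c u
  proof -
    obtain w where w: "trajectory p {T..c} w" "\<And>t. t \<in> {T..c} \<Longrightarrow> w t = u t"
      by (rule trajectory_ex[OF ps u(2,1)]) (use c in auto)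
    interpret bolt_flow "{0<..T} \<union> {T..c}" "\<lambda>t. c1 (w t)" "\<lambda>t. c2 (w t)" "\<lambda>t. c3 (w t)" "\<lambda>t. c4 (w t)"
      "\<lambda>t. c5 (w t)" "\<lambda>t. c6 (w t)" "\<lambda>t. c7 (w t)" "fst p" "fst (snd p)" "snd (snd p)"
      by (rule bolt_flow_trajectory[OF p w(1)]) (use c in auto)
    have cJ: "c \<in> {0<..T} \<union> {T..c}" using c by auto
    have g: "local.good c" unfolding good_def using good[OF c(1) w(1)] by (auto simp: ordered_until_def)
    have wT: "w T = \<phi> p" by (rule trajectory_at_T[OF ps w(1)])
    note gb = good_bounds[OF cJ g]
    have x: "c1 (w c) \<le> X" using x_antimono[OF T_pos c(1) cJ] wT by (simp add: X_def)
    have "c6 (w c) \<le> c6 (\<phi> p) * exp (X * (c - T))"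
      using r2_growth[OF cJ g T_pos c(1)] wT by (simp add: X_def)
    also have "\<dots> \<le> R"
      unfolding R_def using r_pos(2)[of T] wT c \<phi>_xi[OF ps] T_pos
      by (intro mult_left_mono) (auto simp: X_def)
    finally have r2: "c6 (w c) \<le> R" .
    have "norm (w c) \<le> \<bar>c1 (w c)\<bar> + \<bar>c2 (w c)\<bar> + \<bar>c3 (w c)\<bar> + \<bar>c4 (w c)\<bar> + \<bar>c5 (w c)\<bar> + \<bar>c6 (w c)\<bar> + \<bar>c7 (w c)\<bar>"
      by (rule norm_state7_le)
    also have "\<dots> \<le> 4 * X + 3 * R"
      using gb x r2 r_pos[OF cJ] by linarith
    finally show ?thesis using w(2)[of c] c by simp
  qed
  then obtain u where "u T = \<phi> p" "solves soliton_rhs u {T..b}"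
    by (rule solves_extends[OF soliton_rhs_lipschitz b]) blast+
  then show ?thesis by (rule that)
qed

lemma good_trajectory_ex:
  assumes p: "admissible p"
    and good: "\<And>b w. T \<le> b \<Longrightarrow> trajectory p {T..b} w \<Longrightarrow> ordered_until b w"
    and b: "T \<le> b"
  obtains w where "trajectory p {T..b} w"
proof -
  have ps: "p \<in> sphere2" using p by (simp add: admissible_def)
  obtain u where u: "u T = \<phi> p" "solves soliton_rhs u {T..b}" by (rule good_extends[OF p good b])
  show ?thesis by (rule trajectory_ex[OF ps u(2,1)]) (use b that in auto)
qed

end

section \<open>The two ends of the arc of parameters for \<gamma> = 0\<close>

context standing
begin

text \<open>Without explosion the trajectory would be ordered on every horizon and hence exist on
  all of them, against the lifetime bound \<open>M\<close>.\<close>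

lemma ricci_flat_explodes:
  "reaches exploding (0, 1, 0)"
proof (rule ccontr)
  let ?p = "(0, 1, 0) :: real \<times> real \<times> real"
  assume not: "\<not> reaches exploding ?p"
  have p: "admissible ?p" "snd (snd ?p) = 0" by (auto simp: admissible_def sphere2_def)
  have ps: "?p \<in> sphere2" by (simp add: sphere2_def)
  define M where "M = T + c6 (\<phi> ?p) / (2 * (c5 (\<phi> ?p) / 2 - c3 (\<phi> ?p))\<^sup>2)"
  have *: "ordered_until b w \<and> b \<le> M"
    if b: "T \<le> b" and w: "trajectory ?p {T..b} w" for b w
  proof -
    interpret symmetric_bolt_flow "{0<..T} \<union> {T..b}" "\<lambda>t. c1 (w t)" "\<lambda>t. c2 (w t)" "\<lambda>t. c3 (w t)"
      "\<lambda>t. c4 (w t)" "\<lambda>t. c5 (w t)" "\<lambda>t. c6 (w t)" "\<lambda>t. c7 (w t)" 0 1 0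
      using symmetric_bolt_flow_trajectory[OF p w] b by simp
    have J: "b \<in> {0<..T} \<union> {T..b}" "T \<in> {0<..T} \<union> {T..b}" using b T_pos by auto
    have le: "c5 (w s) \<le> c6 (w s)" if "s \<in> {0<..T} \<union> {T..b}" for s
      by (rule not_exploding_le[OF p(1) not w b that])
    have "good b" by (rule ricci_flat_good[OF refl le J(1)])
    moreover have "b \<le> M"
      using ricci_flat_lifetime[OF refl le J(2,1) b] trajectory_at_T[OF ps w] by (simp add: M_def)
    ultimately show ?thesis unfolding good_def ordered_until_def by blast
  qed
  define b where "b = max T M + 1"
  have b: "T \<le> b" "M < b" by (auto simp: b_def)
  obtain w where "trajectory ?p {T..b} w"
    by (rule good_trajectory_ex[OF p(1) _ b(1)]) (use * in blast)+
  then show False using *[OF b(1)] b(2) by fastforce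
qed

text \<open>At angle 0 the parameter \<beta> is 0, so R1 vanishes and the smallness condition
  \<open>f < g\<close> holds; continuity of \<open>\<phi>\<close> extends it to small positive
  angles. A bounded lifetime then excludes the absence of collapse.\<close>

lemma collapses_near_flat:
  obtains \<theta> where "0 < \<theta>" "\<theta> < pi / 2" "reaches collapsing (cos \<theta>, sin \<theta>, 0)"
proof -
  define f where "f \<theta> = 2 * c5 (\<phi> (cos \<theta>, sin \<theta>, 0)) * exp (2 * c1 (\<phi> (cos \<theta>, sin \<theta>, 0)))" for \<theta>
  define g where "g \<theta> = c6 (\<phi> (cos \<theta>, sin \<theta>, 0))" for \<theta>
  have sph: "(cos \<theta>, sin \<theta>, 0) \<in> sphere2" for \<theta> by (simp add: sphere2_def)
  have "continuous_on {0..pi / 3} (\<lambda>\<theta>. \<phi> (cos \<theta>, sin \<theta>, 0))"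
    by (rule continuous_on_compose2[OF \<phi>_cont]) (use sph in \<open>auto intro!: continuous_intros\<close>)
  then have c: "continuous_on {0..pi / 3} f" "continuous_on {0..pi / 3} g"
    unfolding f_def g_def by (intro continuous_intros; assumption)+
  have "f 0 < g 0"
  proof -
    have s: "(1, 0, 0) \<in> sphere2" using sph[of 0] by simp
    obtain w where w: "phi_solution T 1 0 0 w" using phi_solution_ex[OF s] by blast
    have "solves soliton_rhs w {0<..T}" using w by (simp add: phi_solution_def solves_def)
    then interpret bolt_germ "{0<..T}" "\<lambda>t. c1 (w t)" "\<lambda>t. c2 (w t)" "\<lambda>t. c3 (w t)"
      "\<lambda>t. c4 (w t)" "\<lambda>t. c5 (w t)" "\<lambda>t. c6 (w t)" "\<lambda>t. c7 (w t)" 1 0 0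
      by (intro phi_solution_bolt_germ[OF T_pos _ _ _ w]) (use T_pos in auto)
    have "T \<in> {0<..T}" using T_pos by simp
    from r1_zero[OF refl this] r2_pos[OF this] show ?thesis
      using phi_solution_at_T[OF s w] by (simp add: f_def g_def)
  qed
  then obtain \<delta> where \<delta>: "0 < \<delta>" "\<And>\<theta>. \<theta> \<in> {0..pi / 3} \<Longrightarrow> \<bar>\<theta> - 0\<bar> < \<delta> \<Longrightarrow> f \<theta> < g \<theta>"
    using continuous_on_less_right[OF c, of 0] by force
  \<comment> \<open>The bound pi / 3 ensures \<open>cos \<theta> \<ge> 1 / 2\<close>, as required of
    \<alpha>.\<close>
  define \<theta> where "\<theta> = min (pi / 3) (\<delta> / 2)"
  have \<theta>: "0 < \<theta>" "\<theta> \<le> pi / 3" "\<theta> < pi / 2" "f \<theta> < g \<theta>"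
    using \<delta>(1) \<delta>(2)[of \<theta>] pi_gt_zero by (auto simp: \<theta>_def min_def)
  let ?p = "(cos \<theta>, sin \<theta>, 0) :: real \<times> real \<times> real"
  have "cos (pi / 3) \<le> cos \<theta>" by (rule cos_monotone_0_pi_le) (use \<theta> pi_gt_zero in auto)
  then have \<alpha>: "1 / 2 \<le> cos \<theta>" by (simp add: cos_60)
  have "0 < sin \<theta>" by (rule sin_gt_zero) (use \<theta> pi_gt_zero in linarith)+
  then have p: "admissible ?p" "snd (snd ?p) = 0" using \<alpha> sph by (auto simp: admissible_def)
  have "reaches collapsing ?p"
  proof (rule ccontr)
    assume not: "\<not> reaches collapsing ?p"
    define M where "M = T + (c2 (\<phi> ?p) - c3 (\<phi> ?p)) / (c5 (\<phi> ?p) / c6 (\<phi> ?p)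
      * (exp (ln (c6 (\<phi> ?p)) - c2 (\<phi> ?p) - (c2 (\<phi> ?p) - c3 (\<phi> ?p)) / 2))\<^sup>2 / 2)"
    have *: "ordered_until b w \<and> b \<le> M"
      if b: "T \<le> b" and w: "trajectory ?p {T..b} w" for b w
    proof -
      interpret symmetric_bolt_flow "{0<..T} \<union> {T..b}" "\<lambda>t. c1 (w t)" "\<lambda>t. c2 (w t)" "\<lambda>t. c3 (w t)"
        "\<lambda>t. c4 (w t)" "\<lambda>t. c5 (w t)" "\<lambda>t. c6 (w t)" "\<lambda>t. c7 (w t)" "cos \<theta>" "sin \<theta>" 0
        using symmetric_bolt_flow_trajectory[OF p w] b by simp
      have J: "b \<in> {0<..T} \<union> {T..b}" "T \<in> {0<..T} \<union> {T..b}" using b T_pos by auto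
      have wT: "w T = \<phi> ?p" by (rule trajectory_at_T[OF sph w])
      have le: "c3 (w s) \<le> c2 (w s)" if "s \<in> {0<..T} \<union> {T..b}" for s
        by (rule not_collapsing_le[OF p(1) not w b that])
      have x: "0 \<le> c1 (w T)" using \<phi>_xi[OF sph, of \<theta>] wT by simp
      have small: "2 * c5 (w T) * exp (2 * c1 (w T)) < c6 (w T)"
        using \<theta>(4) wT by (simp add: f_def g_def)
      have "good b" by (rule small_r1_good[OF \<alpha> le J(2) x small J(1)])
      moreover have "b \<le> M"
        using small_r1_lifetime[OF \<alpha> le J(2) x small J(1) b] wT by (simp add: M_def)
      ultimately show ?thesis unfolding good_def ordered_until_def by blast
    qed
    define b where "b = max T M + 1"
    have b: "T \<le> b" "M < b" by (auto simp: b_def)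
    obtain w where "trajectory ?p {T..b} w"
      by (rule good_trajectory_ex[OF p(1) _ b(1)]) (use * in blast)+
    then show False using *[OF b(1)] b(2) by fastforce
  qed
  then show ?thesis using that \<theta> by blast
qed

section \<open>Connectedness along circles of latitude on the sphere of parameters\<close>

definition path :: "real \<Rightarrow> real \<Rightarrow> real \<times> real \<times> real" where
  "path \<gamma> \<theta> = (sqrt (1 - \<gamma>\<^sup>2) * cos \<theta>, sqrt (1 - \<gamma>\<^sup>2) * sin \<theta>, \<gamma>)"

lemma path_sphere:
  assumes "\<bar>\<gamma>\<bar> < 1"
  shows "path \<gamma> \<theta> \<in> sphere2"
proof -
  have "\<gamma>\<^sup>2 < 1" using assms by (simp add: abs_square_less_1)
  then have "(sqrt (1 - \<gamma>\<^sup>2))\<^sup>2 * ((cos \<theta>)\<^sup>2 + (sin \<theta>)\<^sup>2) + \<gamma>\<^sup>2 = 1" by simp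
  then show ?thesis unfolding path_def sphere2_def
    by (simp only: mem_Collect_eq case_prod_conv power_mult_distrib distrib_left)
qed

lemma path_admissible:
  assumes "0 \<le> \<gamma>" "\<gamma> < 1" "0 < \<theta>" "\<theta> \<le> pi / 2"
  shows "admissible (path \<gamma> \<theta>)"
proof -
  have "0 < 1 - \<gamma>\<^sup>2" using assms(1,2) by (simp add: power_less_one_iff)
  moreover have "0 < sin \<theta>" "0 \<le> cos \<theta>"
    by (rule sin_gt_zero cos_ge_zero; use assms pi_gt_zero in linarith)+
  ultimately show ?thesis
    using assms path_sphere[of \<gamma> \<theta>] by (auto simp: admissible_def path_def)
qed

lemma reaches_path_open:
  assumes "open U" "reaches U (path 0 \<theta>)"
  obtains d where "0 < d" "\<And>\<gamma>. \<bar>\<gamma>\<bar> < d \<Longrightarrow> \<bar>\<gamma>\<bar> < 1 \<Longrightarrow> reaches U (path \<gamma> \<theta>)"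
proof -
  obtain e where e: "0 < e" "\<And>p'. p' \<in> sphere2 \<Longrightarrow> dist p' (path 0 \<theta>) < e \<Longrightarrow> reaches U p'"
    by (rule reaches_open[OF assms(1) path_sphere assms(2)]) auto
  have "isCont (\<lambda>\<gamma>. path \<gamma> \<theta>) 0" unfolding path_def by (intro continuous_intros)
  then obtain d where "0 < d" "\<And>\<gamma>. dist \<gamma> 0 < d \<Longrightarrow> dist (path \<gamma> \<theta>) (path 0 \<theta>) < e"
    using e(1) unfolding continuous_at_eps_delta by blast
  then show ?thesis using that[of d] e(2) path_sphere by simp
qed

lemma reaches_path_openin:
  assumes "open U" "\<bar>\<gamma>\<bar> < 1"
  shows "openin (top_of_set S) {\<theta> \<in> S. reaches U (path \<gamma> \<theta>)}"
  unfolding openin_euclidean_subtopology_iff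
proof (intro conjI ballI)
  fix \<theta> assume "\<theta> \<in> {\<theta> \<in> S. reaches U (path \<gamma> \<theta>)}"
  then have r: "reaches U (path \<gamma> \<theta>)" by simp
  obtain e where e: "0 < e" "\<And>p'. p' \<in> sphere2 \<Longrightarrow> dist p' (path \<gamma> \<theta>) < e \<Longrightarrow> reaches U p'"
    by (rule reaches_open[OF assms(1) path_sphere[OF assms(2)] r]) auto
  have "isCont (path \<gamma>) \<theta>" unfolding path_def by (intro continuous_intros)
  then obtain d where "0 < d" "\<And>\<theta>'. dist \<theta>' \<theta> < d \<Longrightarrow> dist (path \<gamma> \<theta>') (path \<gamma> \<theta>) < e"
    using e(1) unfolding continuous_at_eps_delta by blast
  then show "\<exists>d>0. \<forall>\<theta>'\<in>S. dist \<theta>' \<theta> < d \<longrightarrow> \<theta>' \<in> {\<theta> \<in> S. reaches U (path \<gamma> \<theta>)}"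
    using e(2) path_sphere[OF assms(2)] by blast
qed auto

lemma borderline_parameter:
  obtains \<delta> where "0 < \<delta>" "\<delta> \<le> 1" "\<And>\<gamma>. 0 \<le> \<gamma> \<Longrightarrow> \<gamma> < \<delta> \<Longrightarrow> \<exists>p. admissible p \<and> 0 < fst p \<and> snd (snd p) = \<gamma>
    \<and> \<not> reaches collapsing p \<and> \<not> reaches exploding p"
proof -
  obtain \<theta>0 where \<theta>0: "0 < \<theta>0" "\<theta>0 < pi / 2" "reaches collapsing (cos \<theta>0, sin \<theta>0, 0)"
    by (rule collapses_near_flat)
  obtain d1 where d1: "0 < d1" "\<And>\<gamma>. \<bar>\<gamma>\<bar> < d1 \<Longrightarrow> \<bar>\<gamma>\<bar> < 1 \<Longrightarrow> reaches collapsing (path \<gamma> \<theta>0)"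
    by (rule reaches_path_open[OF open_collapsing, of \<theta>0]) (use \<theta>0 in \<open>auto simp: path_def\<close>)
  obtain d2 where d2: "0 < d2" "\<And>\<gamma>. \<bar>\<gamma>\<bar> < d2 \<Longrightarrow> \<bar>\<gamma>\<bar> < 1 \<Longrightarrow> reaches exploding (path \<gamma> (pi / 2))"
    by (rule reaches_path_open[OF open_exploding, of "pi / 2"]) (use ricci_flat_explodes in \<open>auto simp: path_def\<close>)
  define \<delta> where "\<delta> = min 1 (min d1 d2)"
  have "\<exists>p. admissible p \<and> 0 < fst p \<and> snd (snd p) = \<gamma> \<and> \<not> reaches collapsing p \<and> \<not> reaches exploding p"
    if \<gamma>: "0 \<le> \<gamma>" "\<gamma> < \<delta>" for \<gamma>
  proof -
    have \<gamma>1: "\<bar>\<gamma>\<bar> < 1" "\<bar>\<gamma>\<bar> < d1" "\<bar>\<gamma>\<bar> < d2" using \<gamma> by (auto simp: \<delta>_def)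
    define S where "S = {\<theta>0..pi / 2}"
    define A where "A = {\<theta> \<in> S. reaches collapsing (path \<gamma> \<theta>)}"
    define B where "B = {\<theta> \<in> S. reaches exploding (path \<gamma> \<theta>)}"
    have adm: "admissible (path \<gamma> \<theta>)" if "\<theta> \<in> S" for \<theta>
      by (rule path_admissible) (use that \<gamma> \<gamma>1 \<theta>0 in \<open>auto simp: S_def\<close>)
    have opens: "openin (top_of_set S) A" "openin (top_of_set S) B"
      unfolding A_def B_def by (rule reaches_path_openin[OF _ \<gamma>1(1)] open_collapsing open_exploding)+
    have "\<theta>0 \<in> A" "pi / 2 \<in> B" using d1(2)[of \<gamma>] d2(2)[of \<gamma>] \<gamma>1 \<theta>0 by (auto simp: A_def B_def S_def)
    moreover have "A \<inter> B = {}" using reaches_exclusive[OF adm] by (auto simp: A_def B_def)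
    moreover have "connected S" by (simp add: S_def)
    ultimately have "\<not> S \<subseteq> A \<union> B" using opens unfolding connected_openin by blast
    then obtain \<theta> where \<theta>: "\<theta> \<in> S" "\<theta> \<notin> A" "\<theta> \<notin> B" by blast
    \<comment> \<open>The end of the arc where \<alpha> = 0 is itself exploding; excluding it gives
      \<alpha> > 0, on which convergence relies.\<close>
    have "\<theta> \<noteq> pi / 2" using \<theta>(3) \<open>pi / 2 \<in> B\<close> by blast
    then have "0 < cos \<theta>" using \<theta>(1) \<theta>0 by (intro cos_gt_zero) (auto simp: S_def)
    moreover have "0 < 1 - \<gamma>\<^sup>2" using \<gamma>1(1) by (simp add: abs_square_less_1)
    ultimately show ?thesis
      using \<theta> adm[OF \<theta>(1)] by (intro exI[of _ "path \<gamma> \<theta>"]) (auto simp: A_def B_def path_def)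
  qed
  then show ?thesis using that[of \<delta>] d1(1) d2(1) by (auto simp: \<delta>_def)
qed

lemma borderline_converges:
  assumes p: "admissible p" "0 < fst p" and not: "\<not> reaches collapsing p" "\<not> reaches exploding p"
  obtains w X a where "solves soliton_rhs w {0<..}" "w T = \<phi> p" "0 < X" "\<And>t. 0 < t \<Longrightarrow> X \<le> c1 (w t)"
    "(w \<longlongrightarrow> (X, 0, 0, 0, a, a, 0)) at_top"
proof -
  have ps: "p \<in> sphere2" using p by (simp add: admissible_def)
  have good: "ordered_until b w"
    if "T \<le> b" "trajectory p {T..b} w" for b w
    unfolding ordered_until_def
  proof (intro allI impI)
    fix s assume "0 < s \<and> s \<le> b"
    then have s: "s \<in> {0<..T} \<union> {T..b}" by auto
    show "c5 (w s) \<le> c6 (w s) \<and> c3 (w s) \<le> c2 (w s)"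
      using not_collapsing_le[OF p(1) not(1) that(2,1) s] not_exploding_le[OF p(1) not(2) that(2,1) s] by simp
  qed
  have "\<exists>u. u T = \<phi> p \<and> solves soliton_rhs u {T..b}" if "T \<le> b" for b
    using good_extends[OF p(1) good that] by blast
  then obtain u where u: "u T = \<phi> p" "solves soliton_rhs u {T..}"
    by (rule solves_global[OF soliton_rhs_lipschitz]) blast
  obtain w where w: "trajectory p {T..} w" by (rule trajectory_ex[OF ps u(2,1)]) auto
  have J: "{0<..T} \<union> {T..} = {0<..}" using T_pos by auto
  interpret bolt_flow "{0<..}" "\<lambda>t. c1 (w t)" "\<lambda>t. c2 (w t)" "\<lambda>t. c3 (w t)" "\<lambda>t. c4 (w t)"
    "\<lambda>t. c5 (w t)" "\<lambda>t. c6 (w t)" "\<lambda>t. c7 (w t)" "fst p" "fst (snd p)" "snd (snd p)"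
    using bolt_flow_trajectory[OF p(1) w] unfolding J by simp
  \<comment> \<open>Restricted to a finite horizon the global solution is a trajectory there, so the
    order on finite horizons holds for all times.\<close>
  have tr: "trajectory p {T..b} w" if "T \<le> b" for b
  proof -
    have "solves soliton_rhs w ({0<..T} \<union> {T..b})"
      by (rule solves_subset[OF trajectory_solves[OF w]]) auto
    then show ?thesis using w by (cases p) auto
  qed
  have g: "local.good t" for t
    unfolding good_def using good[OF _ tr, of "max t T"] by (auto simp: ordered_until_def)
  obtain X a where lims: "0 < X" "\<And>t. 0 < t \<Longrightarrow> X \<le> c1 (w t)" "((\<lambda>t. c1 (w t)) \<longlongrightarrow> X) at_top"
    "((\<lambda>t. c2 (w t)) \<longlongrightarrow> 0) at_top" "((\<lambda>t. c3 (w t)) \<longlongrightarrow> 0) at_top" "((\<lambda>t. c4 (w t)) \<longlongrightarrow> 0) at_top"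
    "((\<lambda>t. c5 (w t)) \<longlongrightarrow> a) at_top" "((\<lambda>t. c6 (w t)) \<longlongrightarrow> a) at_top" "((\<lambda>t. c7 (w t)) \<longlongrightarrow> 0) at_top"
    using good_forever_converges[OF refl p(2) g] by blast
  have "((\<lambda>t. (c1 (w t), c2 (w t), c3 (w t), c4 (w t), c5 (w t), c6 (w t), c7 (w t)))
      \<longlongrightarrow> (X, 0, 0, 0, a, a, 0)) at_top"
    by (intro tendsto_Pair lims)
  then have "(w \<longlongrightarrow> (X, 0, 0, 0, a, a, 0)) at_top" by simp
  moreover have "solves soliton_rhs w {0<..}" using trajectory_solves[OF w] unfolding J .
  ultimately show ?thesis using that trajectory_at_T[OF ps w] lims(1,2) by blast
qed

end

section \<open>Passage to the system (F)\<close>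

lemma change_vars_coords:
  "change_vars p = (1 / c1 p, c2 p / c1 p, c3 p / c1 p, c4 p / c1 p, c5 p / c1 p, c6 p / c1 p, c7 p / c1 p)"
  by (cases p) (simp add: change_vars_def)

lemma F_rhs_coords:
  "F_rhs p = (let Q = (c2 p)\<^sup>2 + (c3 p)\<^sup>2 + (c4 p)\<^sup>2 in
    (c1 p * Q,
     (c5 p)\<^sup>2 / 2 - (c6 p - c7 p)\<^sup>2 / 2 - c2 p + c2 p * Q,
     (c6 p)\<^sup>2 / 2 - (c7 p - c5 p)\<^sup>2 / 2 - c3 p + c3 p * Q,
     (c7 p)\<^sup>2 / 2 - (c5 p - c6 p)\<^sup>2 / 2 - c4 p + c4 p * Q,
     c5 p * (c2 p - c3 p - c4 p + Q), c6 p * (c3 p - c4 p - c2 p + Q), c7 p * (c4 p - c2 p - c3 p + Q)))"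
  by (cases p) (simp add: F_rhs_def)

text \<open>The factor \<open>c1 (w t)\<close> is \<xi>, the derivative of the new time with respect
  to the old one.\<close>

lemma change_vars_derivative:
  assumes w: "(w has_vector_derivative soliton_rhs (w t)) (at t)" and x: "c1 (w t) \<noteq> 0"
  shows "((\<lambda>t. change_vars (w t)) has_vector_derivative c1 (w t) *\<^sub>R F_rhs (change_vars (w t))) (at t)"
proof -
  define q where "q = w t"
  have x': "c1 q \<noteq> 0" using x by (simp add: q_def)
  note d = coords_derivative[OF w, folded q_def]
  have quot: "((\<lambda>t. f (w t) / c1 (w t)) has_vector_derivative
      (f' * c1 q - f q * c1 (soliton_rhs q)) / (c1 q * c1 q)) (at t)"
    if "((\<lambda>t. f (w t)) has_real_derivative f') (at t)" for f f'
    unfolding has_real_derivative_iff_has_vector_derivative[symmetric] q_def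
    by (rule DERIV_divide[OF that d(1)[unfolded q_def] x])
  let ?Q = "\<lambda>f. (f (soliton_rhs q) * c1 q - f q * c1 (soliton_rhs q)) / (c1 q * c1 q)"
  have "((\<lambda>t. change_vars (w t)) has_vector_derivative
      ((0 * c1 q - 1 * c1 (soliton_rhs q)) / (c1 q * c1 q), ?Q (\<lambda>p. c2 p), ?Q (\<lambda>p. c3 p),
        ?Q (\<lambda>p. c4 p), ?Q (\<lambda>p. c5 p), ?Q (\<lambda>p. c6 p), ?Q (\<lambda>p. c7 p))) (at t)"
    unfolding change_vars_coords
    by (intro has_vector_derivative_Pair quot quot[of "\<lambda>_. 1"] DERIV_const d)
  moreover have "((0 * c1 q - 1 * c1 (soliton_rhs q)) / (c1 q * c1 q), ?Q (\<lambda>p. c2 p), ?Q (\<lambda>p. c3 p),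
      ?Q (\<lambda>p. c4 p), ?Q (\<lambda>p. c5 p), ?Q (\<lambda>p. c6 p), ?Q (\<lambda>p. c7 p)) = c1 q *\<^sub>R F_rhs (change_vars q)"
    using x' unfolding F_rhs_coords change_vars_coords soliton_rhs_coords Let_def
    by (simp add: power2_eq_square) (simp add: field_simps)
  ultimately show ?thesis by (simp add: q_def)
qed

text \<open>The new time is the integral of \<xi> from \<open>T\<close>. Since \<xi> stays above
  \<open>X > 0\<close>, it increases to infinity, so the transformed solution is global as well and
  inherits the limit.\<close>

lemma reparametrize:
  assumes w: "solves soliton_rhs w {0<..}" and X: "0 < X" "\<And>t. 0 < t \<Longrightarrow> X \<le> c1 (w t)" and T: "0 < T"
    and lim: "(w \<longlongrightarrow> (X, 0, 0, 0, a, b, c)) at_top"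
  obtains z where "z 0 = change_vars (w T)"
    "\<forall>s\<in>{0..}. (z has_vector_derivative F_rhs (z s)) (at s within {0..})"
    "(z \<longlongrightarrow> (1 / X, 0, 0, 0, a / X, b / X, c / X)) at_top"
proof -
  have dw: "(w has_vector_derivative soliton_rhs (w t)) (at t)" if "0 < t" for t
  proof -
    have "(w has_vector_derivative soliton_rhs (w t)) (at t within {0<..})"
      using w that by (simp add: solves_def)
    then show ?thesis using at_within_open[of t "{0<..}"] that by simp
  qed
  have dx: "((\<lambda>t. c1 (w t)) has_real_derivative c1 (soliton_rhs (w t))) (at t)" if "0 < t" for t
    by (rule coords_derivative(1)[OF dw[OF that]])
  have "isCont (\<lambda>t. c1 (w t)) t" if "0 < t" for t
    by (rule DERIV_isCont[OF dx[OF that]])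
  then obtain P where P: "\<And>t. 0 < t \<Longrightarrow> (P has_vector_derivative c1 (w t)) (at t)"
    using einterval_antiderivative[of 0 \<infinity> "\<lambda>t. c1 (w t)"] by (auto simp: zero_ereal_def)
  define G where "G t = P t - P T" for t
  have dG: "(G has_real_derivative c1 (w t)) (at t)" if "0 < t" for t
    using DERIV_diff[OF P[OF that, folded has_real_derivative_iff_has_vector_derivative] DERIV_const[of "P T"]]
    by (simp add: G_def[abs_def])
  have growth: "X * (t - s) \<le> G t - G s" if st: "0 < s" "s \<le> t" for s t
  proof -
    have "G s - X * s \<le> G t - X * t"
    proof (rule nondecreasing_within[where a = s and b = t and f = "\<lambda>t. G t - X * t" and f' = "\<lambda>t. c1 (w t) - X"])
      fix u assume u: "u \<in> {s..t}"
      then have u0: "0 < u" using st by auto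
      show "((\<lambda>t. G t - X * t) has_real_derivative c1 (w u) - X) (at u within {s..t})"
        by (rule DERIV_diff[OF has_field_derivative_at_within[OF dG[OF u0]] DERIV_cmult_Id])
      show "0 \<le> c1 (w u) - X" using X(2)[OF u0] by simp
    qed (use st in auto)
    then show ?thesis by (simp add: algebra_simps)
  qed
  have G_less: "G s < G t" if "0 < s" "s < t" for s t
  proof -
    have "0 < X * (t - s)" using that X(1) by simp
    then show ?thesis using growth[of s t] that by linarith
  qed
  have inj: "inj_on G {0<..}"
    by (rule inj_onI) (metis G_less greaterThan_iff less_irrefl linorder_neqE)
  \<comment> \<open>Inverting on all positive times makes \<open>T\<close> an interior point, so the
    inverse is differentiable at \<open>s = 0\<close> too.\<close>
  define \<rho> where "\<rho> = inv_into {0<..} G"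
  have \<rho>_G: "\<rho> (G t) = t" if "0 < t" for t unfolding \<rho>_def by (rule inv_into_f_f[OF inj]) (use that in simp)
  have onto: "\<exists>t\<ge>T. G t = s" if s: "0 \<le> s" for s
  proof -
    \<comment> \<open>\<open>G\<close> grows at least at rate \<open>X\<close>, so it has reached
      \<open>s\<close> by this time, and the intermediate value theorem applies.\<close>
    define t where "t = T + s / X"
    have t: "T \<le> t" using s X(1) by (simp add: t_def)
    have "G T = 0" by (simp add: G_def)
    moreover have "s \<le> G t" using growth[OF T t] \<open>G T = 0\<close> X(1) by (simp add: t_def)
    moreover have "continuous_on {T..t} G"
      using dG T by (intro continuous_at_imp_continuous_on ballI DERIV_isCont[OF dG]) auto
    ultimately obtain u where "T \<le> u" "G u = s" using IVT'[of G T s t] s t by auto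
    then show ?thesis by blast
  qed
  have d\<rho>: "(\<rho> has_real_derivative 1 / c1 (w t)) (at (G t))" if t: "0 < t" for t
    unfolding has_field_derivative_def
  proof (rule has_derivative_inverse_strong[of "{0<..}" t G \<rho> "(*) (c1 (w t))"])
    show "continuous_on {0<..} G"
      by (intro continuous_at_imp_continuous_on ballI DERIV_isCont[OF dG]) auto
    show "(G has_derivative (*) (c1 (w t))) (at t)" using dG[OF t] by (simp add: has_field_derivative_def)
    show "(*) (c1 (w t)) \<circ> (*) (1 / c1 (w t)) = id" using X(1) X(2)[OF t] by (auto simp: fun_eq_iff)
  qed (use t \<rho>_G in auto)
  define z where "z s = change_vars (w (\<rho> s))" for s
  have "z 0 = change_vars (w T)" using \<rho>_G[OF T] by (simp add: z_def G_def)
  moreover have "(z has_vector_derivative F_rhs (z s)) (at s within {0..})" if s: "0 \<le> s" for s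
  proof -
    obtain t where t: "T \<le> t" "G t = s" using onto[OF s] by blast
    have t0: "0 < t" using t T by simp
    have x: "c1 (w t) \<noteq> 0" using X(1) X(2)[OF t0] by simp
    have \<rho>s: "\<rho> s = t" using \<rho>_G[OF t0] t by simp
    have "((\<lambda>t. change_vars (w t)) \<circ> \<rho> has_vector_derivative
        (1 / c1 (w t)) *\<^sub>R (c1 (w t) *\<^sub>R F_rhs (change_vars (w t)))) (at s)"
    proof (rule vector_diff_chain_at)
      show "(\<rho> has_vector_derivative 1 / c1 (w t)) (at s)"
        using d\<rho>[OF t0] t by (simp add: has_real_derivative_iff_has_vector_derivative)
      show "((\<lambda>t. change_vars (w t)) has_vector_derivative c1 (w t) *\<^sub>R F_rhs (change_vars (w t))) (at (\<rho> s))"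
        unfolding \<rho>s by (rule change_vars_derivative[OF dw[OF t0] x])
    qed
    then have "(z has_vector_derivative F_rhs (z s)) (at s)"
      using x by (simp add: z_def[abs_def] o_def \<rho>s)
    then show ?thesis by (rule has_vector_derivative_at_within)
  qed
  moreover have "(z \<longlongrightarrow> (1 / X, 0, 0, 0, a / X, b / X, c / X)) at_top"
  proof -
    have "filterlim \<rho> at_top at_top"
      unfolding filterlim_at_top
    proof
      fix N
      define M where "M = max N T"
      show "\<forall>\<^sub>F s in at_top. N \<le> \<rho> s"
      proof (rule eventually_at_top_linorderI[of "max 0 (G M)"])
        fix s assume s: "max 0 (G M) \<le> s"
        obtain t where t: "T \<le> t" "G t = s" using onto[of s] s by auto
        have "\<not> t < M" using G_less[of t M] t T s by auto
        then show "N \<le> \<rho> s" using \<rho>_G[of t] t T by (auto simp: M_def)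
      qed
    qed
    then have "((\<lambda>s. w (\<rho> s)) \<longlongrightarrow> (X, 0, 0, 0, a, b, c)) at_top"
      by (rule filterlim_compose[OF lim])
    moreover have "isCont change_vars (X, 0, 0, 0, a, b, c)"
      unfolding change_vars_coords[abs_def] using X(1) by (intro continuous_intros) auto
    ultimately have "(z \<longlongrightarrow> change_vars (X, 0, 0, 0, a, b, c)) at_top"
      unfolding z_def by (rule isCont_tendsto_compose[rotated])
    then show ?thesis by (simp add: change_vars_def)
  qed
  ultimately show ?thesis using that[of z] by simp
qed

theorem theorem5p2:
  fixes T :: real and \<phi> :: "real \<times> real \<times> real \<Rightarrow> state7"
  assumes "standing_phi T \<phi>"
  shows "\<exists>I :: real set. open I \<and> is_interval I \<and> 0 \<in> I \<and>
    (\<forall>\<gamma>\<in>I. \<exists>\<alpha> \<beta>. \<alpha>^2 + \<beta>^2 + \<gamma>^2 = 1 \<and>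
       (\<exists>z :: real \<Rightarrow> state7. \<exists>l a b c.
          z 0 = change_vars (\<phi> (\<alpha>, \<beta>, \<gamma>)) \<and>
          (\<forall>s\<in>{0..}. (z has_vector_derivative F_rhs (z s)) (at s within {0..})) \<and>
          (z \<longlongrightarrow> (l, 0, 0, 0, a, b, c)) at_top \<and>
          l > 0 \<and> ((a = b \<and> c = 0) \<or> (a = c \<and> b = 0))))"
proof -
  interpret standing T \<phi> by unfold_locales (rule assms)
  obtain \<delta> where \<delta>: "0 < \<delta>" "\<delta> \<le> 1" "\<And>\<gamma>. 0 \<le> \<gamma> \<Longrightarrow> \<gamma> < \<delta> \<Longrightarrow> \<exists>p. admissible p \<and> 0 < fst p \<and> snd (snd p) = \<gamma>
    \<and> \<not> reaches collapsing p \<and> \<not> reaches exploding p"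
    by (rule borderline_parameter) blast
  have nonneg: "\<exists>\<alpha> \<beta> z l a. (\<alpha>, \<beta>, \<gamma>) \<in> sphere2 \<and> z 0 = change_vars (\<phi> (\<alpha>, \<beta>, \<gamma>)) \<and>
      (\<forall>s\<in>{0..}. (z has_vector_derivative F_rhs (z s)) (at s within {0..})) \<and>
      (z \<longlongrightarrow> (l, 0, 0, 0, a, a, 0)) at_top \<and> l > 0" if \<gamma>: "0 \<le> \<gamma>" "\<gamma> < \<delta>" for \<gamma>
  proof -
    obtain p where p: "admissible p" "0 < fst p" "snd (snd p) = \<gamma>" "\<not> reaches collapsing p" "\<not> reaches exploding p"
      using \<delta>(3)[OF \<gamma>] by blast
    obtain w X a where w: "solves soliton_rhs w {0<..}" "w T = \<phi> p" "0 < X" "\<And>t. 0 < t \<Longrightarrow> X \<le> c1 (w t)"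
      "(w \<longlongrightarrow> (X, 0, 0, 0, a, a, 0)) at_top"
      by (rule borderline_converges[OF p(1,2,4,5)]) blast
    obtain z where z: "z 0 = change_vars (w T)"
      "\<forall>s\<in>{0..}. (z has_vector_derivative F_rhs (z s)) (at s within {0..})"
      "(z \<longlongrightarrow> (1 / X, 0, 0, 0, a / X, a / X, 0 / X)) at_top"
      by (rule reparametrize[OF w(1,3,4) T_pos w(5)]) blast
    have p_eq: "(fst p, fst (snd p), \<gamma>) = p" "p \<in> sphere2" using p by (auto simp: admissible_def)
    have "(z \<longlongrightarrow> (1 / X, 0, 0, 0, a / X, a / X, 0)) at_top" "0 < 1 / X"
      using z(3) w(3) by simp_all
    then show ?thesis using z(1,2) w(2)
      by (intro exI[of _ "fst p"] exI[of _ "fst (snd p)"] exI[of _ z] exI[of _ "1 / X"] exI[of _ "a / X"])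
        (simp add: p_eq)
  qed
  show ?thesis
  proof (intro exI[of _ "{-\<delta><..<\<delta>}"] conjI ballI)
    fix \<gamma> assume \<gamma>: "\<gamma> \<in> {-\<delta><..<\<delta>}"
    show "\<exists>\<alpha> \<beta>. \<alpha>^2 + \<beta>^2 + \<gamma>^2 = 1 \<and>
       (\<exists>z :: real \<Rightarrow> state7. \<exists>l a b c.
          z 0 = change_vars (\<phi> (\<alpha>, \<beta>, \<gamma>)) \<and>
          (\<forall>s\<in>{0..}. (z has_vector_derivative F_rhs (z s)) (at s within {0..})) \<and>
          (z \<longlongrightarrow> (l, 0, 0, 0, a, b, c)) at_top \<and>
          l > 0 \<and> ((a = b \<and> c = 0) \<or> (a = c \<and> b = 0)))"
    proof (cases "0 \<le> \<gamma>")
      case True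
      then obtain \<alpha> \<beta> z l a where z: "(\<alpha>, \<beta>, \<gamma>) \<in> sphere2" "z 0 = change_vars (\<phi> (\<alpha>, \<beta>, \<gamma>))"
        "\<forall>s\<in>{0..}. (z has_vector_derivative F_rhs (z s)) (at s within {0..})"
        "(z \<longlongrightarrow> (l, 0, 0, 0, a, a, 0)) at_top" "l > 0"
        using nonneg[of \<gamma>] \<gamma> by auto
      have "\<alpha>^2 + \<beta>^2 + \<gamma>^2 = 1" using z(1) by (simp add: sphere2_def)
      then show ?thesis
        by - (rule exI[of _ \<alpha>], rule exI[of _ \<beta>], rule conjI, assumption,
            rule exI[of _ z], rule exI[of _ l], rule exI[of _ a], rule exI[of _ a],
            rule exI[of _ 0], use z(2-5) in simp)
    next
      case False
      then obtain \<alpha> \<beta> z l a where z: "(\<alpha>, \<beta>, - \<gamma>) \<in> sphere2" "z 0 = change_vars (\<phi> (\<alpha>, \<beta>, - \<gamma>))"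
        "\<And>s. s \<in> {0..} \<Longrightarrow> (z has_vector_derivative F_rhs (z s)) (at s within {0..})"
        "(z \<longlongrightarrow> (l, 0, 0, 0, a, a, 0)) at_top" "l > 0"
        using nonneg[of "- \<gamma>"] \<gamma> by auto
      \<comment> \<open>The solution found for \<open>- \<gamma>\<close> is exchanged into one for
        \<gamma>; its limit \<open>(a, a, 0)\<close> in the last three components becomes
        \<open>(a, 0, a)\<close>, the second alternative.\<close>
      have "\<phi> (\<alpha>, \<beta>, \<gamma>) = swap23 (\<phi> (\<alpha>, \<beta>, - \<gamma>))" using \<phi>_swap23[OF z(1)] by simp
      then have "swap23 (z 0) = change_vars (\<phi> (\<alpha>, \<beta>, \<gamma>))" by (simp add: z(2) swap23_change_vars)
      moreover have "((\<lambda>s. swap23 (z s)) has_vector_derivative F_rhs (swap23 (z s))) (at s within {0..})"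
        if "s \<in> {0..}" for s
        unfolding swap23_F_rhs by (rule bounded_linear.has_vector_derivative[OF bounded_linear_swap23 z(3)[OF that]])
      moreover have "((\<lambda>s. swap23 (z s)) \<longlongrightarrow> (l, 0, 0, 0, a, 0, a)) at_top"
        using bounded_linear.tendsto[OF bounded_linear_swap23 z(4)] by (simp add: swap23_def)
      ultimately have *: "\<exists>z l a b c. z 0 = change_vars (\<phi> (\<alpha>, \<beta>, \<gamma>)) \<and>
          (\<forall>s\<in>{0..}. (z has_vector_derivative F_rhs (z s)) (at s within {0..})) \<and>
          (z \<longlongrightarrow> (l, 0, 0, 0, a, b, c)) at_top \<and> l > 0 \<and> ((a = b \<and> c = 0) \<or> (a = c \<and> b = 0))"
        by - (rule exI[of _ "\<lambda>s. swap23 (z s)"], rule exI[of _ l], rule exI[of _ a], rule exI[of _ 0],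
            rule exI[of _ a], use z(5) in simp)
      have "\<alpha>^2 + \<beta>^2 + \<gamma>^2 = 1" using z(1) by (simp add: sphere2_def)
      then show ?thesis using * by blast
    qed
  qed (use \<delta>(1) in \<open>auto simp: is_interval_convex_1\<close>)
qed

end
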